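(* Let $R$ be a finitely generated commutative algebra over a field $\Bbbk$ of characteristic zero. Let $\mathcal F^\bullet$ be a filtration on $D_{R|\Bbbk}$ that is linearly dominated by the order filtration. Suppose that $(D_{R|\Bbbk},\mathcal F^\bullet)$ is linearly simple with finite dimension and finite positive multiplicity. If $R$ is holonomic as a $D_{R|\Bbbk}$-module, then for every nonzero element $f\in R$, $R_f(s)\boldsymbol{f^s}$ has finite length as a $D_{R(s)|\Bbbk(s)}$-module.
   Context: Differential operators: $D^0_{R|\Bbbk}$ is the set of multiplications by elements of $R$; $D^i_{R|\Bbbk}=\{\delta\in\operatorname{End}_\Bbbk(R):[\delta,r]\in D^{i-1}_{R|\Bbbk}\ \forall r\in R\}$; $D_{R|\Bbbk}=\bigcup_iD^i_{R|\Bbbk}$; $\operatorname{ord}(\delta)$ is the least $i$ with $\delta\in D^i_{R|\Bbbk}$. A filtration on a $\Bbbk$-algebra $A$ is an ascending exhaustive sequence $(\mathcal F^i)_{i\in\mathbb N}$ of finite-dimensional $\Bbbk$-subspaces with $\mathcal F^0=\Bbbk$ and $\mathcal F^i\mathcal F^j\subseteq\mathcal F^{i+j}$. A filtration $\mathcal F^\bullet$ on $D_{R|\Bbbk}$ is linearly dominated by the order filtration if there is a positive integer $C$ with $\mathcal F^i\subseteq D^{Ci}_{R|\Bbbk}$ for all $i$. A compatible filtration on a left $A$-module is an ascending exhaustive sequence of finite-dimensional subspaces $\mathcal G^i$ with $\mathcal F^i\mathcal G^j\subseteq\mathcal G^{i+j}$. $\operatorname{Dim}(\mathcal G^\bullet)=\inf\{t\ge0:\exists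 C,\ \dim_\Bbbk\mathcal G^i\le Ci^t\ \forall i\gg0\}$; if $d=\operatorname{Dim}(\mathcal G^\bullet)<\infty$, the multiplicity is $\operatorname e(\mathcal G^\bullet)=\limsup_i\dim_\Bbbk\mathcal G^i/i^d$. $(A,\mathcal F^\bullet)$ is linearly simple if there is a positive integer $C$ such that $1\in\mathcal F^{Ci}\delta\mathcal F^{Ci}$ for all $i\in\mathbb N$ and all nonzero $\delta\in\mathcal F^i$. For linearly simple $(A,\mathcal F^\bullet)$ of finite dimension and positive finite multiplicity, a nonzero $A$-module is holonomic if it admits a compatible filtration of dimension $\frac12\operatorname{Dim}(\mathcal F^\bullet)$ and finite multiplicity; the zero module is holonomic by convention. Let $s$ be an indeterminate, $R(s)=R\otimes_\Bbbk\Bbbk(s)$; one identifies $D_{R(s)|\Bbbk(s)}=D_{R|\Bbbk}\otimes_\Bbbk\Bbbk(s)$. $R_f(s)\boldsymbol{f^s}$ is the free $R_f\otimes_\Bbbk\Bbbk(s)$-module of rank one on the formal symbol $\boldsymbol{f^s}$, with the $\Bbbk(s)$-linear action, for $\delta\in D_{R|\Bbbk}$, $\delta\cdot a(s)\boldsymbol{f^s}=\sum_{i=0}^{\operatorname{ord}(\delta)}\binom si f^{-i}\delta^{(i)}(a(s))\boldsymbol{f^s}$, where $\delta^{(0)}=\delta$, $\delta^{(i)}=[\delta^{(i-1)},f]$, $\binom si=s(s-1)\cdots(s-i+1)/i!$, and operators in $D_{R|\Bbbk}$ act on $R_f$ by the standard extension. *)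

theory Defs
  imports
    Complex_Main
    "HOL-Library.Function_Algebras"
    "HOL-Library.Extended_Real"
    "HOL-Library.Liminf_Limsup"
    "HOL-Library.Poly_Mapping"
    "HOL-Computational_Algebra.Polynomial_Factorial"
    "HOL-Algebra.Module"
begin

section \<open>Commutative algebras over a field\<close>

text \<open>The ground field and the commutative algebra are types; the algebra structure is the
  scalar multiplication \<open>sc\<close>.\<close>

locale comm_algebra = vector_space sc
  for sc :: "'k::field \<Rightarrow> 'r::comm_ring_1 \<Rightarrow> 'r" +
  assumes sc_mult: "sc c (x * y) = sc c x * y"

definition subalgebra :: "('k::field \<Rightarrow> 'r::comm_ring_1 \<Rightarrow> 'r) \<Rightarrow> 'r set \<Rightarrow> bool" where
  "subalgebra sc B \<longleftrightarrow>
     1 \<in> B \<and> (\<forall>x\<in>B. \<forall>y\<in>B. x + y \<in> B \<and> x * y \<in> B) \<and> (\<forall>c. \<forall>x\<in>B. sc c x \<in> B)"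

definition finitely_generated_algebra :: "('k::field \<Rightarrow> 'r::comm_ring_1 \<Rightarrow> 'r) \<Rightarrow> bool" where
  "finitely_generated_algebra sc \<longleftrightarrow>
     (\<exists>X. finite X \<and> \<Inter>{B. subalgebra sc B \<and> X \<subseteq> B} = UNIV)"


section \<open>Differential operators\<close>

definition commutator :: "('r::comm_ring_1 \<Rightarrow> 'r) \<Rightarrow> 'r \<Rightarrow> 'r \<Rightarrow> 'r" where
  "commutator \<delta> r = (\<lambda>x. \<delta> (r * x) - r * \<delta> x)"

primrec diff_ops_le :: "('k::field \<Rightarrow> 'r::comm_ring_1 \<Rightarrow> 'r) \<Rightarrow> nat \<Rightarrow> ('r \<Rightarrow> 'r) set" where
  "diff_ops_le sc 0 = {\<lambda>x. r * x | r. True}"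
| "diff_ops_le sc (Suc n) =
     {\<delta>. Vector_Spaces.linear sc sc \<delta> \<and> (\<forall>r. commutator \<delta> r \<in> diff_ops_le sc n)}"

definition diff_ops :: "('k::field \<Rightarrow> 'r::comm_ring_1 \<Rightarrow> 'r) \<Rightarrow> ('r \<Rightarrow> 'r) set" where
  "diff_ops sc = (\<Union>n. diff_ops_le sc n)"

definition diff_order :: "('k::field \<Rightarrow> 'r::comm_ring_1 \<Rightarrow> 'r) \<Rightarrow> ('r \<Rightarrow> 'r) \<Rightarrow> nat" where
  "diff_order sc \<delta> = (LEAST n. \<delta> \<in> diff_ops_le sc n)"

definition op_scale :: "('k \<Rightarrow> 'r \<Rightarrow> 'r) \<Rightarrow> 'k \<Rightarrow> ('r \<Rightarrow> 'r) \<Rightarrow> 'r \<Rightarrow> 'r" where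
  "op_scale sc c \<delta> = (\<lambda>x. sc c (\<delta> x))"


section \<open>Filtrations, dimension and multiplicity\<close>

text \<open>An associative algebra is given by its carrier \<open>A\<close>, a subspace of an ambient vector space
  with scalar multiplication \<open>scA\<close>, together with the product \<open>mul\<close> and the identity \<open>e\<close>.
  A module is a vector space with scalar multiplication \<open>scM\<close> and the action \<open>act\<close> of \<open>A\<close>.
  The product of two subspaces is the span of the elementwise products; for an inclusion into a
  subspace it is enough to test these products.\<close>

definition finite_dim_subspace :: "('k::field \<Rightarrow> 'v::ab_group_add \<Rightarrow> 'v) \<Rightarrow> 'v set \<Rightarrow> bool" where
  "finite_dim_subspace scV V \<longleftrightarrow> (\<exists>B. finite B \<and> Modules.module.span scV B = V)"

definition filtration ::
  "('k::field \<Rightarrow> 'a::ab_group_add \<Rightarrow> 'a) \<Rightarrow> 'a set \<Rightarrow> ('a \<Rightarrow> 'a \<Rightarrow> 'a) \<Rightarrow> 'a \<Rightarrow> (nat \<Rightarrow> 'a set) \<Rightarrow> bool" where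
  "filtration scA A mul e F \<longleftrightarrow>
     (\<forall>i. finite_dim_subspace scA (F i)) \<and>
     (\<forall>i. F i \<subseteq> F (Suc i)) \<and>
     (\<Union>i. F i) = A \<and>
     F 0 = {scA c e | c. True} \<and>
     (\<forall>i j. \<forall>a\<in>F i. \<forall>b\<in>F j. mul a b \<in> F (i + j))"

definition compatible_filtration ::
  "(nat \<Rightarrow> 'a set) \<Rightarrow> ('k::field \<Rightarrow> 'm::ab_group_add \<Rightarrow> 'm) \<Rightarrow> ('a \<Rightarrow> 'm \<Rightarrow> 'm) \<Rightarrow> (nat \<Rightarrow> 'm set) \<Rightarrow> bool" where
  "compatible_filtration F scM act G \<longleftrightarrow>
     (\<forall>i. finite_dim_subspace scM (G i)) \<and>
     (\<forall>i. G i \<subseteq> G (Suc i)) \<and>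
     (\<Union>i. G i) = UNIV \<and>
     (\<forall>i j. \<forall>a\<in>F i. \<forall>m\<in>G j. act a m \<in> G (i + j))"

text \<open>The infimum is taken in the extended reals, so the dimension is \<open>\<infinity>\<close> if no exponent works.\<close>

definition filtration_Dim ::
  "('k::field \<Rightarrow> 'v::ab_group_add \<Rightarrow> 'v) \<Rightarrow> (nat \<Rightarrow> 'v set) \<Rightarrow> ereal" where
  "filtration_Dim scV G =
     Inf {ereal t | t. t \<ge> 0 \<and>
       (\<exists>C::real. \<forall>\<^sub>F i in sequentially. real (vector_space.dim scV (G i)) \<le> C * real i powr t)}"

text \<open>Only meaningful if the dimension is finite.\<close>

definition filtration_mult ::
  "('k::field \<Rightarrow> 'v::ab_group_add \<Rightarrow> 'v) \<Rightarrow> (nat \<Rightarrow> 'v set) \<Rightarrow> ereal" where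
  "filtration_mult scV G =
     limsup (\<lambda>i. ereal (real (vector_space.dim scV (G i))
                        / real i powr real_of_ereal (filtration_Dim scV G)))"

definition linearly_simple ::
  "('k::field \<Rightarrow> 'a::ab_group_add \<Rightarrow> 'a) \<Rightarrow> ('a \<Rightarrow> 'a \<Rightarrow> 'a) \<Rightarrow> 'a \<Rightarrow> (nat \<Rightarrow> 'a set) \<Rightarrow> bool" where
  "linearly_simple scA mul e F \<longleftrightarrow>
     (\<exists>C::nat. C > 0 \<and>
       (\<forall>i. \<forall>\<delta>\<in>F i. \<delta> \<noteq> 0 \<longrightarrow>
          e \<in> Modules.module.span scA {mul (mul a \<delta>) b | a b. a \<in> F (C * i) \<and> b \<in> F (C * i)}))"

definition linearly_dominated ::
  "('k::field \<Rightarrow> 'r::comm_ring_1 \<Rightarrow> 'r) \<Rightarrow> (nat \<Rightarrow> ('r \<Rightarrow> 'r) set) \<Rightarrow> bool" where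
  "linearly_dominated sc F \<longleftrightarrow> (\<exists>C::nat. C > 0 \<and> (\<forall>i. F i \<subseteq> diff_ops_le sc (C * i)))"

definition holonomic ::
  "('k::field \<Rightarrow> 'a::ab_group_add \<Rightarrow> 'a) \<Rightarrow> (nat \<Rightarrow> 'a set)
    \<Rightarrow> ('k \<Rightarrow> 'm::ab_group_add \<Rightarrow> 'm) \<Rightarrow> ('a \<Rightarrow> 'm \<Rightarrow> 'm) \<Rightarrow> bool" where
  "holonomic scA F scM act \<longleftrightarrow>
     (\<forall>m::'m. m = 0) \<or>
     (\<exists>G. compatible_filtration F scM act G \<and>
          filtration_Dim scM G = filtration_Dim scA F / 2 \<and>
          filtration_mult scM G < \<infinity>)"


section \<open>Modules of finite length\<close>

text \<open>Here \<open>A\<close> may be noncommutative; existence of a composition series.\<close>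

definition finite_length :: "('a, 'c) ring_scheme \<Rightarrow> ('a, 'm, 'd) module_scheme \<Rightarrow> bool" where
  "finite_length A M \<longleftrightarrow>
     (\<exists>(n::nat) N. N 0 = {\<zero>\<^bsub>M\<^esub>} \<and> N n = carrier M \<and>
        (\<forall>i\<le>n. submodule (N i) A M) \<and>
        (\<forall>i<n. N i \<subset> N (Suc i) \<and>
               \<not> (\<exists>L. submodule L A M \<and> N i \<subset> L \<and> L \<subset> N (Suc i))))"


section \<open>The localization at an element\<close>

text \<open>The pair \<open>(a, m)\<close> represents \<open>a / f ^ m\<close>. The element \<open>f\<close> may be a zero divisor (even
  nilpotent), whence the additional power of \<open>f\<close>.\<close>

definition loc_rel :: "'r::comm_ring_1 \<Rightarrow> (('r \<times> nat) \<times> ('r \<times> nat)) set" where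
  "loc_rel f = {((a, m), (b, n)). \<exists>l. f ^ l * (f ^ n * a - f ^ m * b) = 0}"

definition loc_frac :: "'r::comm_ring_1 \<Rightarrow> 'r \<times> nat \<Rightarrow> ('r \<times> nat) set" where
  "loc_frac f p = loc_rel f `` {p}"

text \<open>Operations on quotients are given as in \<^theory>\<open>HOL.Equiv_Relations\<close>, by a union over
  representatives: all of them contribute the same class.\<close>

definition localization ::
  "('k::field \<Rightarrow> 'r::comm_ring_1 \<Rightarrow> 'r) \<Rightarrow> 'r \<Rightarrow> ('k, ('r \<times> nat) set) module" where
  "localization sc f =
     \<lparr> carrier = UNIV // loc_rel f,
       monoid.mult = (\<lambda>X Y. \<Union>(a, m)\<in>X. \<Union>(b, n)\<in>Y. loc_frac f (a * b, m + n)),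
       one = loc_frac f (1, 0),
       zero = loc_frac f (0, 0),
       add = (\<lambda>X Y. \<Union>(a, m)\<in>X. \<Union>(b, n)\<in>Y. loc_frac f (f ^ n * a + f ^ m * b, m + n)),
       smult = (\<lambda>c X. \<Union>(a, m)\<in>X. loc_frac f (sc c a, m)) \<rparr>"

text \<open>The standard extension of a differential operator \<open>\<delta>\<close> of order at most \<open>n\<close> to the
  localization, by recursion on \<open>n\<close>:
  \<open>\<delta> (a / g) = (\<delta> a - [\<delta>, g] (a / g)) / g\<close> with \<open>g = f ^ m\<close>, where \<open>[\<delta>, g]\<close> has order at
  most \<open>n - 1\<close>; it is forced by \<open>\<delta> (g * x) = g * \<delta> x + [\<delta>, g] x\<close> for \<open>x = a / g\<close>.\<close>

primrec ext_frac :: "'r::comm_ring_1 \<Rightarrow> nat \<Rightarrow> ('r \<Rightarrow> 'r) \<Rightarrow> 'r \<times> nat \<Rightarrow> 'r \<times> nat" where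
  "ext_frac f 0 \<delta> p = (case p of (a, m) \<Rightarrow> (\<delta> a, m))"
| "ext_frac f (Suc n) \<delta> p = (case p of (a, m) \<Rightarrow>
     (case ext_frac f n (commutator \<delta> (f ^ m)) (a, m) of (b, k) \<Rightarrow> (f ^ k * \<delta> a - b, k + m)))"

definition loc_op ::
  "('k::field \<Rightarrow> 'r::comm_ring_1 \<Rightarrow> 'r) \<Rightarrow> 'r \<Rightarrow> ('r \<Rightarrow> 'r) \<Rightarrow> ('r \<times> nat) set \<Rightarrow> ('r \<times> nat) set" where
  "loc_op sc f \<delta> X = (\<Union>p\<in>X. loc_frac f (ext_frac f (diff_order sc \<delta>) \<delta> p))"


section \<open>Extension of scalars to the field of rational functions\<close>

type_synonym 'k ratfun = "'k poly fract"

abbreviation const_rf :: "'k::field \<Rightarrow> 'k ratfun" where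
  "const_rf c \<equiv> to_fract [:c:]"

abbreviation s_rf :: "'k::field ratfun" where
  "s_rf \<equiv> to_fract [:0, 1:]"

text \<open>The tensor product \<open>V \<otimes> k(s)\<close> over \<open>k\<close> is the free abelian group on
  \<open>V \<times> k(s)\<close> modulo the subgroup (the span over the integers) generated by the usual
  relations. \<open>V\<close> may carry a product, in which case so does the tensor product.\<close>

definition tensor_gens :: "('k::field, 'v, 'd) module_scheme \<Rightarrow> ('v \<times> 'k ratfun \<Rightarrow>\<^sub>0 int) set" where
  "tensor_gens V =
     {frag_of (v \<oplus>\<^bsub>V\<^esub> w, p) - frag_of (v, p) - frag_of (w, p)
        | v w p. v \<in> carrier V \<and> w \<in> carrier V} \<union>
     {frag_of (v, p + q) - frag_of (v, p) - frag_of (v, q) | v p q. v \<in> carrier V} \<union>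
     {frag_of (c \<odot>\<^bsub>V\<^esub> v, p) - frag_of (v, const_rf c * p) | c v p. v \<in> carrier V}"

definition tensor_reps :: "('k::field, 'v, 'd) module_scheme \<Rightarrow> ('v \<times> 'k ratfun \<Rightarrow>\<^sub>0 int) set" where
  "tensor_reps V = {x. Poly_Mapping.keys x \<subseteq> carrier V \<times> UNIV}"

definition tensor_rel ::
  "('k::field, 'v, 'd) module_scheme \<Rightarrow> (('v \<times> 'k ratfun \<Rightarrow>\<^sub>0 int) \<times> ('v \<times> 'k ratfun \<Rightarrow>\<^sub>0 int)) set" where
  "tensor_rel V =
     {(x, y). x \<in> tensor_reps V \<and> y \<in> tensor_reps V \<and>
              x - y \<in> Modules.module.span frag_cmul (tensor_gens V)}"

definition tensor_class ::
  "('k::field, 'v, 'd) module_scheme \<Rightarrow> ('v \<times> 'k ratfun \<Rightarrow>\<^sub>0 int) \<Rightarrow> ('v \<times> 'k ratfun \<Rightarrow>\<^sub>0 int) set" where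
  "tensor_class V x = tensor_rel V `` {x}"

definition ratfun_ext ::
  "('k::field, 'v, 'd) module_scheme \<Rightarrow> ('k ratfun, ('v \<times> 'k ratfun \<Rightarrow>\<^sub>0 int) set) module" where
  "ratfun_ext V =
     \<lparr> carrier = tensor_reps V // tensor_rel V,
       monoid.mult = (\<lambda>X Y. \<Union>x\<in>X. \<Union>y\<in>Y. tensor_class V
                 (frag_extend (\<lambda>(v, p). frag_extend (\<lambda>(w, q). frag_of (v \<otimes>\<^bsub>V\<^esub> w, p * q)) y) x)),
       one = tensor_class V (frag_of (\<one>\<^bsub>V\<^esub>, 1)),
       zero = tensor_class V 0,
       add = (\<lambda>X Y. \<Union>x\<in>X. \<Union>y\<in>Y. tensor_class V (x + y)),
       smult = (\<lambda>r X. \<Union>x\<in>X. tensor_class V (frag_extend (\<lambda>(v, p). frag_of (v, r * p)) x)) \<rparr>"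


section \<open>The ring \<open>D(s)\<close> and the module \<open>R\<^sub>f(s) f\<^sup>s\<close>\<close>

definition diff_op_algebra ::
  "('k::field \<Rightarrow> 'r::comm_ring_1 \<Rightarrow> 'r) \<Rightarrow> ('k, 'r \<Rightarrow> 'r) module" where
  "diff_op_algebra sc =
     \<lparr> carrier = diff_ops sc, monoid.mult = (\<circ>), one = id, zero = 0, add = (+), smult = op_scale sc \<rparr>"

text \<open>The differential operators of \<open>R(s)\<close> over \<open>k(s)\<close>, in the form \<open>D \<otimes> k(s)\<close>.\<close>

definition diff_op_algebra_s ::
  "('k::field \<Rightarrow> 'r::comm_ring_1 \<Rightarrow> 'r) \<Rightarrow> ('k ratfun, (('r \<Rightarrow> 'r) \<times> 'k ratfun \<Rightarrow>\<^sub>0 int) set) module" where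
  "diff_op_algebra_s sc = ratfun_ext (diff_op_algebra sc)"

definition binom_s :: "nat \<Rightarrow> 'k::field_char_0 ratfun" where
  "binom_s i = (\<Prod>j<i. s_rf - of_nat j) / of_nat (fact i)"

text \<open>For \<open>\<delta>\<close> in \<open>D\<close> and \<open>u\<close> in the localization, the tensor representing \<open>\<delta> \<cdot> (u \<otimes> p) f\<^sup>s\<close>,
  with \<open>((\<lambda>\<epsilon>. commutator \<epsilon> f) ^^ i) \<delta>\<close> the iterated commutator with \<open>f\<close>.\<close>

definition fs_action ::
  "('k::field_char_0 \<Rightarrow> 'r::comm_ring_1 \<Rightarrow> 'r) \<Rightarrow> 'r \<Rightarrow> ('r \<Rightarrow> 'r) \<Rightarrow> ('r \<times> nat) set \<times> 'k ratfun
     \<Rightarrow> (('r \<times> nat) set \<times> 'k ratfun \<Rightarrow>\<^sub>0 int)" where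
  "fs_action sc f \<delta> = (\<lambda>(u, p). \<Sum>i\<le>diff_order sc \<delta>.
     frag_of (loc_frac f (1, i) \<otimes>\<^bsub>localization sc f\<^esub> loc_op sc f (((\<lambda>\<epsilon>. commutator \<epsilon> f) ^^ i) \<delta>) u,
              binom_s i * p))"

text \<open>Being free of rank one on the symbol \<open>f\<^sup>s\<close>, the module has the additive group of
  \<open>R\<^sub>f(s)\<close>: an element \<open>x\<close> stands for \<open>x f\<^sup>s\<close>. The scalars are those of
  \<open>diff_op_algebra_s sc\<close>, with \<open>(\<delta> \<otimes> q) \<cdot> y = q * (\<delta> \<cdot> y)\<close>. The fields \<open>mult\<close> and \<open>one\<close> of the
  record play no role for a module.\<close>

definition fs_module ::
  "('k::field_char_0 \<Rightarrow> 'r::comm_ring_1 \<Rightarrow> 'r) \<Rightarrow> 'r \<Rightarrow>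
     ((('r \<Rightarrow> 'r) \<times> 'k ratfun \<Rightarrow>\<^sub>0 int) set, (('r \<times> nat) set \<times> 'k ratfun \<Rightarrow>\<^sub>0 int) set) module" where
  "fs_module sc f = (let V = localization sc f; Vs = ratfun_ext V in
     \<lparr> carrier = carrier Vs, monoid.mult = monoid.mult Vs, one = one Vs, zero = zero Vs, add = add Vs,
       smult = (\<lambda>P X. \<Union>t\<in>P. \<Union>x\<in>X. tensor_class V
                 (frag_extend (\<lambda>(\<delta>, q). frag_extend (\<lambda>(u, p). fs_action sc f \<delta> (u, q * p)) x) t)) \<rparr>)"

end

theory Submission
  imports Defs "HOL-Computational_Algebra.Formal_Power_Series"
begin

text \<open>The proof embeds the module in a space of germs. For a natural number \<open>n\<close>, substituting
\<open>s = n\<close> in \<open>(a / f ^ m) f\<^sup>s\<close> gives the element \<open>f ^ (n - m) * a\<close> of \<open>R\<close>, for all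
\<open>n \<ge> m\<close>. So an element of \<open>R\<^sub>f(s) f\<^sup>s\<close> yields a germ at infinity of sequences
in \<open>R\<close>, where a rational function \<open>p\<close> in \<open>k(s)\<close> acts on the \<open>n\<close>-th entry by its value at
\<open>n\<close>. Since \<open>\<delta>\<close> satisfies a Leibniz rule with binomial coefficients,
\<open>\<delta> (f ^ n * x) = (\<Sum>j. (n choose j) * f ^ (n - j) * \<delta>\<^sup>(\<^sup>j\<^sup>) x)\<close>, the twisted action of \<open>\<delta>\<close>
on \<open>R\<^sub>f(s) f\<^sup>s\<close> becomes the entrywise application of \<open>\<delta>\<close> (lemma \<open>twisted_action_germ\<close>).
In this model the action of \<open>D\<close> is visibly associative and \<open>k(s)\<close>-linear. The map to germs is
injective (lemma \<open>tensor_eval_eq_0_imp_span\<close>) because a polynomial with coefficients in a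
\<open>k\<close>-vector space which vanishes at all large integers is zero. Hence submodules of
\<open>R\<^sub>f(s) f\<^sup>s\<close> correspond to subspaces of the space of germs stable under \<open>D\<close> and \<open>k(s)\<close>.

Finite length comes from Bernstein's inequality. Let \<open>P \<subset> Q\<close> be stable subspaces, and let
\<open>r j\<close> be the dimension over \<open>k(s)\<close> of the \<open>j\<close>-th step of the filtration induced on
\<open>Q / P\<close>. If \<open>F i\<close> had larger dimension than \<open>r (C * i + n) * r (C * i + i + n)\<close>, a nontrivial
combination over \<open>k(s)\<close> of a basis of \<open>F i\<close> would map step \<open>C * i + n\<close> of \<open>Q\<close> into \<open>P\<close>.
Linear simplicity only concerns operators over \<open>k\<close>, so the coefficients are specialised at
\<open>s = \<alpha>\<close>. This gives a nonzero \<open>\<delta>\<close> in \<open>F i\<close> which maps that step of \<open>Q\<close> into \<open>P\<close> up to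
multiples of \<open>s - \<alpha>\<close>. From \<open>1 \<in> F\<^sup>C\<^sup>i \<delta> F\<^sup>C\<^sup>i\<close> it follows that
a vector \<open>m\<close> of \<open>Q\<close> outside \<open>P\<close> is divisible by \<open>s - \<alpha>\<close> modulo \<open>P\<close>, inside a finitely
generated \<open>k[s]\<close>-module that is the same for all \<open>\<alpha>\<close>. As \<open>k\<close> is infinite, this is impossible
(lemma \<open>bernstein_inequality\<close>).

Summing over a chain of submodules, with \<open>dim F i\<close> at least \<open>c * i powr d\<close> infinitely often and the
module filtration of dimension \<open>O(i powr (d / 2))\<close>, bounds the length of the chain by a constant
(lemma \<open>chain_length_bounded\<close>), and a chain of maximal length is a composition series. The
filtration on \<open>R\<^sub>f(s) f\<^sup>s\<close> is built from one on \<open>R\<close> that witnesses holonomicity: its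
\<open>i\<close>-th step is spanned over \<open>k(s)\<close> by the \<open>(g / f ^ (c * i)) f\<^sup>s\<close> with \<open>g \<in> G (b * i)\<close>. If
\<open>F i\<close> consists of operators of order at most \<open>c * i\<close>, then \<open>F j\<close> introduces at most \<open>c * j\<close>
further powers of \<open>f\<close> in the denominator, so for suitable \<open>b\<close> this filtration is compatible with
\<open>F\<close>; and its growth is that of \<open>G\<close>, up to a constant factor.\<close>

section \<open>Linear algebra\<close>

text \<open>Gaussian elimination: an equation with a nonzero coefficient removes one unknown.\<close>

lemma homogeneous_system_nontrivial_solution:
  fixes a :: "'e \<Rightarrow> 'j \<Rightarrow> 'c::field"
  assumes "finite E" "finite J" "card E < card J"
  shows "\<exists>p. (\<exists>j\<in>J. p j \<noteq> 0) \<and> (\<forall>e\<in>E. (\<Sum>j\<in>J. p j * a e j) = 0)"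
  using assms
proof (induction E arbitrary: J a rule: finite_induct)
  case empty
  then have "J \<noteq> {}" by auto
  then show ?case by (intro exI[of _ "\<lambda>_. 1"]) auto
next
  case (insert e E)
  show ?case
  proof (cases "\<forall>j\<in>J. a e j = 0")
    case True
    from insert have "card E < card J" by simp
    with insert.IH[OF insert.prems(1), of a] obtain p where
      "\<exists>j\<in>J. p j \<noteq> 0" "\<forall>e\<in>E. (\<Sum>j\<in>J. p j * a e j) = 0" by blast
    with True show ?thesis by (intro exI[of _ p]) auto
  next
    case False
    then obtain j0 where j0: "j0 \<in> J" "a e j0 \<noteq> 0" by blast
    define J' where "J' = J - {j0}"
    have J: "J = insert j0 J'" "j0 \<notin> J'" "finite J'" using j0 insert.prems unfolding J'_def by auto
    have "card E < card J'" using insert.prems insert.hyps J by simp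
    then obtain p' where p': "\<exists>j\<in>J'. p' j \<noteq> 0"
      "\<And>e'. e' \<in> E \<Longrightarrow> (\<Sum>j\<in>J'. p' j * (a e' j - a e' j0 * a e j / a e j0)) = 0"
      using insert.IH[OF J(3), of "\<lambda>e' j. a e' j - a e' j0 * a e j / a e j0"] by blast
    define S where "S = (\<Sum>j\<in>J'. p' j * a e j)"
    define p where "p = (\<lambda>j. if j = j0 then - S / a e j0 else p' j)"
    have sum: "(\<Sum>j\<in>J. p j * a e' j) = - S / a e j0 * a e' j0 + (\<Sum>j\<in>J'. p' j * a e' j)" for e'
    proof -
      have "(\<Sum>j\<in>J'. p j * a e' j) = (\<Sum>j\<in>J'. p' j * a e' j)"
        using J(2) by (intro sum.cong) (auto simp: p_def)
      then show ?thesis using J by (simp add: p_def)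
    qed
    have "(\<Sum>j\<in>J. p j * a e' j) = 0" if "e' \<in> insert e E" for e'
    proof (cases "e' = e")
      case True
      then show ?thesis using j0 by (simp add: sum S_def)
    next
      case False
      then have "e' \<in> E" using that by simp
      from p'(2)[OF this] have "(\<Sum>j\<in>J'. p' j * a e' j) - (a e' j0 / a e j0) * S = 0"
        by (simp add: algebra_simps sum_subtractf S_def sum_distrib_left)
      then show ?thesis by (simp add: sum algebra_simps)
    qed
    moreover have "\<exists>j\<in>J. p j \<noteq> 0"
      using p'(1) J(1,2) unfolding p_def by auto
    ultimately show ?thesis by blast
  qed
qed

lemma to_fract_sum: "to_fract (\<Sum>i\<in>I. g i) = (\<Sum>i\<in>I. to_fract (g i))"
  by (induction I rule: infinite_finite_induct) auto

lemma common_denominator: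
  fixes S :: "'a::idom fract set"
  assumes "finite S"
  shows "\<exists>h. h \<noteq> 0 \<and> (\<forall>p\<in>S. \<exists>q. to_fract h * p = to_fract q)"
  using assms
proof (induction S rule: finite_induct)
  case empty
  show ?case by (intro exI[of _ 1]) auto
next
  case (insert p S)
  then obtain h where h: "h \<noteq> 0" "\<And>p. p \<in> S \<Longrightarrow> \<exists>q. to_fract h * p = to_fract q" by blast
  obtain a b where p: "p = Fract a b" "b \<noteq> 0" by (cases p) auto
  have "\<exists>q. to_fract (h * b) * p = to_fract q"
    using p by (intro exI[of _ "h * a"]) (simp add: Fract_conv_to_fract)
  moreover have "\<exists>q. to_fract (h * b) * p' = to_fract q" if p': "p' \<in> S" for p'
  proof -
    obtain q where "to_fract h * p' = to_fract q" using h(2)[OF p'] by blast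
    then have "to_fract (h * b) * p' = to_fract (b * q)" by (simp add: ac_simps)
    then show ?thesis by blast
  qed
  ultimately show ?case using h(1) p(2) by (intro exI[of _ "h * b"]) (simp del: to_fract_mult)
qed

lemma (in vector_space) finite_dim_subspace_basis:
  assumes "finite_dim_subspace scale U"
  obtains B where "finite B" "independent B" "span B = U" "card B = dim U"
proof -
  obtain X where X: "finite X" "span X = U" using assms unfolding finite_dim_subspace_def by blast
  obtain B where B: "B \<subseteq> U" "independent B" "U \<subseteq> span B" "card B = dim U"
    using basis_exists by metis
  have "finite B" using independent_span_bound[OF X(1) B(2)] B(1) X(2) by blast
  moreover have "span B = U" using B X by (metis span_minimal subspace_span subset_antisym)
  ultimately show thesis using B that by blast
qed

lemma (in vector_space) finite_dim_subspace_Int: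
  assumes "finite_dim_subspace scale U" "subspace W"
  shows "finite_dim_subspace scale (W \<inter> U)"
proof -
  obtain X where X: "finite X" "span X = U" using assms unfolding finite_dim_subspace_def by blast
  obtain B where B: "B \<subseteq> W \<inter> U" "independent B" "W \<inter> U \<subseteq> span B" using basis_exists by metis
  have "finite B" using independent_span_bound[OF X(1) B(2)] B(1) X(2) by blast
  moreover have "subspace (W \<inter> U)" using assms(2) X by (metis subspace_inter subspace_span)
  then have "span B = W \<inter> U" using B by (metis span_minimal subset_antisym)
  ultimately show ?thesis unfolding finite_dim_subspace_def by blast
qed

text \<open>The elements of \<open>B - B0\<close> form a basis of \<open>Q / P\<close>, and the coordinates of a vector of \<open>Q\<close> at
these elements vanish exactly if it lies in \<open>P\<close>. This replaces the quotient space.\<close>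

lemma (in vector_space) relative_basis:
  assumes "finite_dim_subspace scale P" "finite_dim_subspace scale Q" "P \<subseteq> Q"
  obtains B0 B where "B0 \<subseteq> B" "finite B" "independent B" "span B0 = P" "span B = Q"
    "card (B - B0) = dim Q - dim P"
proof -
  obtain B0 where B0: "finite B0" "independent B0" "span B0 = P" "card B0 = dim P"
    using finite_dim_subspace_basis[OF assms(1)] by blast
  obtain X where X: "finite X" "span X = Q" using assms(2) unfolding finite_dim_subspace_def by blast
  have "B0 \<subseteq> Q" using B0(3) assms(3) span_superset by blast
  from maximal_independent_subset_extend[OF this B0(2)]
  obtain B where B: "B0 \<subseteq> B" "B \<subseteq> Q" "independent B" "Q \<subseteq> span B" by blast
  have fB: "finite B" using independent_span_bound[OF X(1) B(3)] B(2) X(2) by blast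
  have spB: "span B = Q" using B X by (metis span_minimal subspace_span subset_antisym)
  have "card B = dim Q" using B dim_unique by metis
  then have "card (B - B0) = dim Q - dim P" using B0 B(1) by (simp add: card_Diff_subset)
  then show thesis using that B B0 fB spB by blast
qed

lemma (in vector_space) separating_functional:
  assumes "subspace P" "m \<notin> P"
  obtains \<phi> where "\<And>x y. \<phi> (x + y) = \<phi> x + \<phi> y" "\<And>c x. \<phi> (scale c x) = c * \<phi> x"
    "\<And>x. x \<in> P \<Longrightarrow> \<phi> x = 0" "\<phi> m \<noteq> 0"
proof -
  obtain B0 where B0: "B0 \<subseteq> P" "independent B0" "P \<subseteq> span B0" using basis_exists by metis
  have sp: "span B0 = P" using B0 assms(1) by (metis span_minimal subset_antisym)
  have ind: "independent (insert m B0)" using B0(2) sp assms(2) by (simp add: independent_insertI)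
  define B where "B = extend_basis (insert m B0)"
  have B: "independent B" "span B = UNIV" "insert m B0 \<subseteq> B"
    unfolding B_def using independent_extend_basis[OF ind] span_extend_basis[OF ind]
      extend_basis_superset[OF ind] by auto
  define \<phi> where "\<phi> x = representation B x m" for x
  show thesis
  proof
    show "\<phi> (x + y) = \<phi> x + \<phi> y" for x y
      unfolding \<phi>_def using B by (simp add: representation_add)
    show "\<phi> (scale c x) = c * \<phi> x" for c x
      unfolding \<phi>_def using B by (simp add: representation_scale)
    show "\<phi> x = 0" if "x \<in> P" for x
    proof -
      have "representation B x = representation B0 x"
        using B that sp by (intro representation_extend) auto
      moreover have "m \<notin> B0" using sp assms(2) span_superset by blast
      ultimately show ?thesis unfolding \<phi>_def using representation_ne_zero by metis
    qed
    show "\<phi> m \<noteq> 0" unfolding \<phi>_def using B by (simp add: representation_basis)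
  qed
qed

text \<open>The form in which products of binomial expansions meet the Vandermonde identity.\<close>

lemma (in vector_space) double_sum_diagonals:
  fixes N :: nat
  assumes "\<And>t. t > N \<Longrightarrow> c t = 0"
  shows "(\<Sum>i\<le>N. \<Sum>l\<le>N. scale (A i * B l) (c (i + l))) = (\<Sum>t\<le>N. scale (\<Sum>i\<le>t. A i * B (t - i)) (c t))"
proof -
  have "(\<Sum>i\<le>N. \<Sum>l\<le>N. scale (A i * B l) (c (i + l)))
      = (\<Sum>(i, l)\<in>{..N} \<times> {..N}. scale (A i * B l) (c (i + l)))"
    by (simp add: sum.cartesian_product)
  also have "\<dots> = (\<Sum>(i, l)\<in>{(i, l). i + l \<le> N}. scale (A i * B l) (c (i + l)))"
  proof (rule sum.mono_neutral_right)
    show "\<forall>x\<in>{..N} \<times> {..N} - {(i, l). i + l \<le> N}. (case x of (i, l) \<Rightarrow> scale (A i * B l) (c (i + l))) = 0"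
    proof
      fix x assume x: "x \<in> {..N} \<times> {..N} - {(i, l). i + l \<le> N}"
      then have "fst x + snd x > N" by (auto simp: not_le[symmetric])
      then show "(case x of (i, l) \<Rightarrow> scale (A i * B l) (c (i + l))) = 0"
        using assms[of "fst x + snd x"] by (simp add: case_prod_beta)
    qed
  qed auto
  also have "\<dots> = (\<Sum>t\<le>N. \<Sum>i\<le>t. scale (A i * B (t - i)) (c (i + (t - i))))"
    by (rule sum.triangle_reindex_eq)
  also have "\<dots> = (\<Sum>t\<le>N. scale (\<Sum>i\<le>t. A i * B (t - i)) (c t))"
    by (simp add: scale_sum_left)
  finally show ?thesis .
qed

text \<open>A linear functional that does not vanish at \<open>w e\<close> turns the hypothesis into a nonzero polynomial
of degree less than \<open>E\<close> with \<open>E\<close> distinct roots.\<close>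

lemma (in vector_space) vandermonde_independence:
  fixes w :: "nat \<Rightarrow> 'b"
  assumes char: "inj (of_nat :: nat \<Rightarrow> 'a)"
    and zero: "\<And>n. N \<le> n \<Longrightarrow> n < N + E \<Longrightarrow> (\<Sum>e<E. scale (of_nat n ^ e) (w e)) = 0"
    and e: "e < E"
  shows "w e = 0"
proof (rule ccontr)
  assume "w e \<noteq> 0"
  then obtain \<phi> where \<phi>: "\<And>x y. \<phi> (x + y) = \<phi> x + \<phi> y" "\<And>c x. \<phi> (scale c x) = c * \<phi> x" "\<phi> (w e) \<noteq> 0"
    using separating_functional[of "{0}" "w e"] subspace_single_0
    by (metis (no_types, lifting) singletonD)
  have \<phi>0: "\<phi> 0 = 0" using \<phi>(2)[of 0 0] by simp
  have \<phi>sum: "\<phi> (\<Sum>i\<in>I. g i) = (\<Sum>i\<in>I. \<phi> (g i))" for I :: "nat set" and g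
    by (induction I rule: infinite_finite_induct) (auto simp: \<phi> \<phi>0)
  define P where "P = (\<Sum>i<E. monom (\<phi> (w i)) i)"
  have coeffP: "coeff P i = (if i < E then \<phi> (w i) else 0)" for i
    unfolding P_def by (simp add: coeff_sum sum.delta cong: if_cong)
  have P: "P \<noteq> 0" using coeffP[of e] e \<phi>(3) by auto
  have "degree P < E"
    using degree_le[of "E - 1" P] coeffP e by fastforce
  moreover have "of_nat ` {N..<N + E} \<subseteq> {x. poly P x = 0}"
  proof clarify
    fix n assume n: "n \<in> {N..<N + E}"
    have "poly P (of_nat n) = \<phi> (\<Sum>i<E. scale (of_nat n ^ i) (w i))"
      unfolding P_def \<phi>sum by (simp add: poly_sum poly_monom \<phi> mult.commute)
    then show "poly P (of_nat n) = 0" using zero[of n] n \<phi>0 by simp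
  qed
  then have "card (of_nat ` {N..<N + E} :: 'a set) \<le> card {x. poly P x = 0}"
    by (intro card_mono poly_roots_finite P)
  moreover have "card (of_nat ` {N..<N + E} :: 'a set) = E"
    using char by (subst card_image) (auto intro: inj_on_subset)
  ultimately show False using card_poly_roots_bound[OF P] by simp
qed

section \<open>Bernstein's inequality over rational function fields\<close>

text \<open>An action of a filtered algebra over \<open>k\<close> on a vector space over \<open>k(s)\<close>. Keeping the algebra over
\<open>k\<close>, without extending its scalars, allows linear simplicity to be used as it is. The filtration
\<open>G\<close> may exhaust only a subspace: the module of interest is a subspace of a larger ambient space.\<close>

locale filtered_action =
  A: vector_space scA + V: vector_space scV
  for scA :: "'k::field_char_0 \<Rightarrow> 'a::ab_group_add \<Rightarrow> 'a"
    and scV :: "'k ratfun \<Rightarrow> 'v::ab_group_add \<Rightarrow> 'v" +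
  fixes mul :: "'a \<Rightarrow> 'a \<Rightarrow> 'a" and e :: 'a and F :: "nat \<Rightarrow> 'a set"
    and act :: "'a \<Rightarrow> 'v \<Rightarrow> 'v" and G :: "nat \<Rightarrow> 'v set"
  assumes filt: "filtration scA (\<Union>i. F i) mul e F"
    and act_mul: "\<lbrakk>a \<in> F i; b \<in> F j\<rbrakk> \<Longrightarrow> act (mul a b) v = act a (act b v)"
    and act_unit: "act e v = v"
    and act_add_left: "\<lbrakk>a \<in> F i; b \<in> F i\<rbrakk> \<Longrightarrow> act (a + b) v = act a v + act b v"
    and act_scale_left: "a \<in> F i \<Longrightarrow> act (scA c a) v = scV (const_rf c) (act a v)"
    and act_add: "a \<in> F i \<Longrightarrow> act a (v + w) = act a v + act a w"
    and act_scale: "a \<in> F i \<Longrightarrow> act a (scV p v) = scV p (act a v)"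
    and G_fin: "finite_dim_subspace scV (G i)"
    and G_Suc: "G i \<subseteq> G (Suc i)"
    and G_act: "\<lbrakk>a \<in> F i; v \<in> G j\<rbrakk> \<Longrightarrow> act a v \<in> G (i + j)"
begin

definition stable :: "'v set \<Rightarrow> bool" where
  "stable P \<longleftrightarrow> V.subspace P \<and> (\<forall>i. \<forall>a\<in>F i. \<forall>v\<in>P. act a v \<in> P)"

lemma F_subspace: "A.subspace (F i)"
  using filt unfolding filtration_def finite_dim_subspace_def by (metis A.subspace_span)

lemma F_mono: "i \<le> j \<Longrightarrow> F i \<subseteq> F j"
  using filt unfolding filtration_def by (metis lift_Suc_mono_le)

lemma G_mono: "i \<le> j \<Longrightarrow> G i \<subseteq> G j"
  using G_Suc by (metis lift_Suc_mono_le)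

lemma F_mul: "\<lbrakk>a \<in> F i; b \<in> F j\<rbrakk> \<Longrightarrow> mul a b \<in> F (i + j)"
  using filt unfolding filtration_def by blast

lemma unit_mem: "e \<in> F i"
proof -
  have "scA 1 e \<in> F 0" using filt unfolding filtration_def by blast
  then show ?thesis using F_mono[of 0 i] by auto
qed

lemma act_zero: "a \<in> F i \<Longrightarrow> act a 0 = 0"
  using act_scale[of a i 0 0] by simp

lemma act_sum:
  assumes "a \<in> F i"
  shows "act a (\<Sum>x\<in>X. g x) = (\<Sum>x\<in>X. act a (g x))"
  using assms by (induction X rule: infinite_finite_induct) (auto simp: act_add act_zero)

lemma act_sum_left:
  assumes "finite X" "X \<subseteq> F i"
  shows "(\<Sum>x\<in>X. scA (c x) x) \<in> F i \<and> act (\<Sum>x\<in>X. scA (c x) x) v = (\<Sum>x\<in>X. scV (const_rf (c x)) (act x v))"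
  using assms
proof (induction X rule: finite_induct)
  case empty
  have "act 0 v = scV (const_rf 0) (act e v)"
    using act_scale_left[OF unit_mem[of i], of 0] by simp
  then show ?case using A.subspace_0[OF F_subspace] by simp
next
  case (insert x X)
  then have x: "x \<in> F i" and X: "(\<Sum>x\<in>X. scA (c x) x) \<in> F i"
      "act (\<Sum>x\<in>X. scA (c x) x) v = (\<Sum>x\<in>X. scV (const_rf (c x)) (act x v))" by auto
  from x have sx: "scA (c x) x \<in> F i" using A.subspace_scale[OF F_subspace] by blast
  show ?case using insert.hyps X sx A.subspace_add[OF F_subspace sx X(1)]
    by (simp add: act_add_left[OF sx X(1)] act_scale_left[OF x])
qed

text \<open>Write \<open>\<delta>(s)\<close> for the combination \<open>\<Sum>x\<in>D. q x * x\<close> over \<open>k[s]\<close> and \<open>\<delta>\<close> for its value at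
\<open>s = \<alpha>\<close>. Modulo \<open>P\<close>, the operator \<open>\<delta>(s)\<close> annihilates \<open>act b m\<close> for \<open>b \<in> F c\<close>, so there \<open>\<delta>\<close>
agrees with \<open>\<delta> - \<delta>(s)\<close>, which is divisible by \<open>s - \<alpha>\<close>. Since \<open>e\<close> is a combination of terms
\<open>a * \<delta> * b\<close>, the same divisibility holds for \<open>m\<close>. It is measured by the functional \<open>\<phi>\<close>, with
\<open>h\<close> a common denominator of the values involved.\<close>

lemma specialised_factor:
  assumes lin: "e \<in> A.span {mul (mul a \<delta>) b | a b. a \<in> F c \<and> b \<in> F c}"
    and D: "finite D" "D \<subseteq> F i"
    and \<delta>: "\<delta> = (\<Sum>x\<in>D. scA (poly (q x) \<alpha>) x)"
    and P: "stable P"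
    and kill: "\<And>b. b \<in> F c \<Longrightarrow> (\<Sum>x\<in>D. scV (to_fract (q x)) (act x (act b m))) \<in> P"
    and \<phi>: "\<And>x y. \<phi> (x + y) = \<phi> x + \<phi> y" "\<And>c x. \<phi> (scV c x) = c * \<phi> x"
      "\<And>x. x \<in> P \<Longrightarrow> \<phi> x = 0"
    and h: "\<And>x. x \<in> F (c + i + c) \<Longrightarrow> \<exists>r. to_fract h * \<phi> (act x m) = to_fract r"
  shows "\<exists>r. to_fract h * \<phi> m = to_fract ([:-\<alpha>, 1:] * r)"
proof -
  have \<phi>0: "\<phi> 0 = 0" using \<phi>(2)[of 0 0] by simp
  have \<phi>sum: "\<phi> (\<Sum>x\<in>X. g x) = (\<Sum>x\<in>X. \<phi> (g x))" for X :: "'a set" and g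
    by (induction X rule: infinite_finite_induct) (auto simp: \<phi> \<phi>0)
  have \<delta>F: "\<delta> \<in> F i" unfolding \<delta> by (rule act_sum_left[OF D, THEN conjunct1])
  have "x \<in> F (c + i + c) \<and> (\<exists>r. to_fract h * \<phi> (act x m) = to_fract ([:-\<alpha>, 1:] * r))"
    if "x \<in> A.span {mul (mul a \<delta>) b | a b. a \<in> F c \<and> b \<in> F c}" for x
    using that
  proof (induction x rule: A.span_induct_alt)
    case base
    have "0 \<in> F (c + i + c)" using A.subspace_0[OF F_subspace] .
    moreover have "act 0 m = 0"
      using act_sum_left[of "{}" 0 "\<lambda>_. 0" m] by simp
    ultimately show ?case using \<phi>0 by (auto intro: exI[of _ 0])
  next
    case (step \<gamma> x y)
    then obtain a b where x: "x = mul (mul a \<delta>) b" "a \<in> F c" "b \<in> F c" by blast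
    from step.IH obtain r1 where y: "y \<in> F (c + i + c)"
      "to_fract h * \<phi> (act y m) = to_fract ([:-\<alpha>, 1:] * r1)" by blast
    have xF: "x \<in> F (c + i + c)" unfolding x using F_mul[OF F_mul[OF x(2) \<delta>F] x(3)] .
    have sxF: "scA \<gamma> x \<in> F (c + i + c)" using A.subspace_scale[OF F_subspace xF] .
    define w where "w = act b m"
    define u where "u = (\<Sum>x\<in>D. scV (to_fract (q x)) (act x w))"
    have u: "u \<in> P" unfolding u_def w_def by (rule kill[OF x(3)])
    have "\<exists>t. [:poly (q x) \<alpha>:] - q x = [:-\<alpha>, 1:] * t" for x
    proof -
      have "poly ([:poly (q x) \<alpha>:] - q x) \<alpha> = 0" by simp
      then show ?thesis unfolding poly_eq_0_iff_dvd dvd_def .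
    qed
    then obtain t where t: "\<And>x. [:poly (q x) \<alpha>:] - q x = [:-\<alpha>, 1:] * t x" by metis
    \<comment> \<open>the value at \<open>s = \<alpha>\<close> differs from \<open>u\<close>, which lies in \<open>P\<close>, by a multiple of \<open>s - \<alpha>\<close>\<close>
    have "act \<delta> w = (\<Sum>x\<in>D. scV (const_rf (poly (q x) \<alpha>)) (act x w))"
      unfolding \<delta> by (rule act_sum_left[OF D, THEN conjunct2])
    also have "\<dots> = u + (\<Sum>x\<in>D. scV (to_fract ([:-\<alpha>, 1:] * t x)) (act x w))"
      unfolding u_def sum.distrib[symmetric] V.scale_left_distrib[symmetric] to_fract_add[symmetric]
        t[symmetric] by simp
    finally have \<delta>w: "act \<delta> w = u + (\<Sum>x\<in>D. scV (to_fract ([:-\<alpha>, 1:] * t x)) (act x w))" .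
    have "act x m = act a (act \<delta> w)"
      unfolding x w_def using act_mul[OF F_mul[OF x(2) \<delta>F] x(3)] act_mul[OF x(2) \<delta>F] by simp
    also have "\<dots> = act a u + (\<Sum>x\<in>D. scV (to_fract ([:-\<alpha>, 1:] * t x)) (act a (act x w)))"
      unfolding \<delta>w by (simp only: act_add[OF x(2)] act_sum[OF x(2)] act_scale[OF x(2)])
    also have "(\<Sum>x\<in>D. scV (to_fract ([:-\<alpha>, 1:] * t x)) (act a (act x w)))
        = (\<Sum>x\<in>D. scV (to_fract ([:-\<alpha>, 1:] * t x)) (act (mul (mul a x) b) m))"
    proof (intro sum.cong refl)
      fix z assume "z \<in> D"
      then have z: "z \<in> F i" using D by blast
      show "scV (to_fract ([:-\<alpha>, 1:] * t z)) (act a (act z w))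
          = scV (to_fract ([:-\<alpha>, 1:] * t z)) (act (mul (mul a z) b) m)"
        unfolding w_def using act_mul[OF F_mul[OF x(2) z] x(3)] act_mul[OF x(2) z] by simp
    qed
    finally have "\<phi> (act x m) = (\<Sum>z\<in>D. to_fract ([:-\<alpha>, 1:] * t z) * \<phi> (act (mul (mul a z) b) m))"
      using P u x(2) unfolding stable_def by (simp only: \<phi> \<phi>sum) simp
    then have hx: "to_fract h * \<phi> (act x m)
        = to_fract [:-\<alpha>, 1:] * (\<Sum>z\<in>D. to_fract (t z) * (to_fract h * \<phi> (act (mul (mul a z) b) m)))"
      by (simp only: sum_distrib_left to_fract_mult ac_simps)
    have "\<exists>r. to_fract h * \<phi> (act (mul (mul a z) b) m) = to_fract r" if "z \<in> D" for z
      using h F_mul[OF F_mul[OF x(2)] x(3)] D that by blast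
    then obtain r where r: "\<And>z. z \<in> D \<Longrightarrow> to_fract h * \<phi> (act (mul (mul a z) b) m) = to_fract (r z)" by metis
    have hx2: "to_fract h * \<phi> (act x m) = to_fract ([:-\<alpha>, 1:] * (\<Sum>z\<in>D. t z * r z))"
      unfolding hx to_fract_mult to_fract_sum by (simp add: r)
    have "act (scA \<gamma> x + y) m = scV (const_rf \<gamma>) (act x m) + act y m"
      using act_add_left[OF sxF y(1)] act_scale_left[OF xF] by simp
    then have "to_fract h * \<phi> (act (scA \<gamma> x + y) m)
        = const_rf \<gamma> * (to_fract h * \<phi> (act x m)) + to_fract h * \<phi> (act y m)"
      by (simp only: \<phi> distrib_left ac_simps)
    also have "\<dots> = to_fract ([:-\<alpha>, 1:] * ([:\<gamma>:] * (\<Sum>z\<in>D. t z * r z) + r1))"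
      unfolding hx2 y(2) to_fract_mult to_fract_add by (simp only: distrib_left ac_simps)
    finally show ?case using A.subspace_add[OF F_subspace sxF y(1)] by blast
  qed
  from this[OF lin] show ?thesis by (simp add: act_unit)
qed

text \<open>The right-hand side counts the equations which a combination over \<open>k(s)\<close> of a basis of \<open>F i\<close> must
satisfy in order to map \<open>Q \<inter> G (C * i + n)\<close> into \<open>P\<close>. With fewer equations than basis elements
there is such a combination; specialising it at infinitely many \<open>\<alpha>\<close> makes a nonzero polynomial
vanish at all of them.\<close>

lemma bernstein_inequality:
  assumes lin: "\<And>i \<delta>. \<lbrakk>\<delta> \<in> F i; \<delta> \<noteq> 0\<rbrakk> \<Longrightarrow>
      e \<in> A.span {mul (mul a \<delta>) b | a b. a \<in> F (C * i) \<and> b \<in> F (C * i)}"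
    and P: "stable P" and Q: "stable Q" "P \<subseteq> Q"
    and m: "m \<in> Q" "m \<notin> P" "m \<in> G n"
  shows "A.dim (F i) \<le>
      (V.dim (Q \<inter> G (C * i + n)) - V.dim (P \<inter> G (C * i + n))) *
      (V.dim (Q \<inter> G (C * i + i + n)) - V.dim (P \<inter> G (C * i + i + n)))"
proof (rule ccontr)
  assume neg: "\<not> ?thesis"
  have fin: "finite_dim_subspace scV (S \<inter> G j)" if "stable S" for S j
    using V.finite_dim_subspace_Int[OF G_fin] that unfolding stable_def by blast
  obtain B0 B where B: "B0 \<subseteq> B" "finite B" "V.independent B" "V.span B0 = P \<inter> G (C * i + n)"
      "V.span B = Q \<inter> G (C * i + n)"
      "card (B - B0) = V.dim (Q \<inter> G (C * i + n)) - V.dim (P \<inter> G (C * i + n))"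
    using V.relative_basis[OF fin[OF P] fin[OF Q(1)]] Q(2) by (metis Int_mono subset_refl)
  obtain E0 E where E: "E0 \<subseteq> E" "finite E" "V.independent E" "V.span E0 = P \<inter> G (C * i + i + n)"
      "V.span E = Q \<inter> G (C * i + i + n)"
      "card (E - E0) = V.dim (Q \<inter> G (C * i + i + n)) - V.dim (P \<inter> G (C * i + i + n))"
    using V.relative_basis[OF fin[OF P] fin[OF Q(1)]] Q(2) by (metis Int_mono subset_refl)
  have "finite_dim_subspace scA (F i)" using filt unfolding filtration_def by blast
  then obtain D where D: "finite D" "A.independent D" "A.span D = F i" "card D = A.dim (F i)"
    using A.finite_dim_subspace_basis by blast
  have DF: "D \<subseteq> F i" using D(3) A.span_superset by blast
  have "card ((B - B0) \<times> (E - E0)) < card D"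
    using neg B(6) E(6) D(4) by (simp add: card_cartesian_product)
  moreover have "finite ((B - B0) \<times> (E - E0))" using B E by blast
  ultimately obtain p where p: "\<exists>x\<in>D. p x \<noteq> 0"
    "\<forall>be\<in>(B - B0) \<times> (E - E0). (\<Sum>x\<in>D. p x * V.representation E (act x (fst be)) (snd be)) = 0"
    using homogeneous_system_nontrivial_solution[OF _ D(1),
        of "(B - B0) \<times> (E - E0)" "\<lambda>be x. V.representation E (act x (fst be)) (snd be)"] by blast
  define T where "T w = (\<Sum>x\<in>D. scV (p x) (act x w))" for w
  have Psub: "V.subspace P" and Pact: "\<And>j a v. a \<in> F j \<Longrightarrow> v \<in> P \<Longrightarrow> act a v \<in> P"
    using P unfolding stable_def by auto
  have TP: "T w \<in> P" if "w \<in> P" for w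
    unfolding T_def using that DF Pact
    by (intro V.subspace_sum[OF Psub] V.subspace_scale[OF Psub]) blast
  have TB: "T b \<in> P" if b: "b \<in> B - B0" for b
  proof -
    have bQ: "b \<in> Q \<inter> G (C * i + n)" using b B(5) V.span_superset by blast
    have actE: "act x b \<in> V.span E" if "x \<in> D" for x
    proof -
      have x: "x \<in> F i" using that DF by blast
      have "act x b \<in> Q" using x bQ Q(1) unfolding stable_def by blast
      moreover have "act x b \<in> G (i + (C * i + n))" using G_act[OF x] bQ by blast
      ultimately show ?thesis using E(5) by (simp add: ac_simps)
    qed
    then have TE: "T b \<in> V.span E" unfolding T_def by (intro V.span_sum V.span_scale)
    have rep: "V.representation E (T b) y = (\<Sum>x\<in>D. p x * V.representation E (act x b) y)" for y
      unfolding T_def using actE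
      by (subst V.representation_sum[OF E(3)]) (auto simp: V.span_scale V.representation_scale[OF E(3)])
    have rep0: "V.representation E (T b) y = 0" if "y \<in> E - E0" for y
      using p(2) b that unfolding rep by force
    have "T b = (\<Sum>y\<in>E. scV (V.representation E (T b) y) y)"
      using V.sum_representation_eq[OF E(3) TE E(2) subset_refl] by simp
    also have "\<dots> = (\<Sum>y\<in>E0. scV (V.representation E (T b) y) y)"
      using E(1,2) rep0 by (intro sum.mono_neutral_right) auto
    also have "\<dots> \<in> V.span E0" by (intro V.span_sum V.span_scale V.span_base)
    finally show ?thesis using E(4) by blast
  qed
  have Tadd: "T (v + w) = T v + T w" for v w
    unfolding T_def sum.distrib[symmetric] V.scale_right_distrib[symmetric]
    using DF act_add by (intro sum.cong refl) (metis subsetD)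
  have Tscale: "T (scV c v) = scV c (T v)" for c v
    unfolding T_def V.scale_sum_right
    by (intro sum.cong refl) (metis act_scale DF subsetD V.scale_left_commute)
  have TQ: "T w \<in> P" if "w \<in> Q \<inter> G (C * i + n)" for w
  proof -
    have "w \<in> V.span B" using that B(5) by simp
    then show ?thesis
    proof (induction w rule: V.span_induct_alt)
      case base
      show ?case using TP V.subspace_0[OF Psub] by blast
    next
      case (step c x y)
      have "T x \<in> P"
      proof (cases "x \<in> B0")
        case True
        then have "x \<in> P" using B(4) V.span_base by blast
        then show ?thesis by (rule TP)
      qed (use TB step.hyps in blast)
      then show ?case using step.IH
        by (simp add: Tadd Tscale V.subspace_add[OF Psub] V.subspace_scale[OF Psub])
    qed
  qed
  obtain h0 where h0: "h0 \<noteq> 0" "\<And>x. x \<in> D \<Longrightarrow> \<exists>q. to_fract h0 * p x = to_fract q"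
    using common_denominator[of "p ` D"] D(1) by auto
  then obtain q where q: "\<And>x. x \<in> D \<Longrightarrow> to_fract h0 * p x = to_fract (q x)" by metis
  obtain x0 where x0: "x0 \<in> D" "p x0 \<noteq> 0" using p(1) by blast
  \<comment> \<open>as \<open>q x0\<close> has finitely many roots, the specialised operator is nonzero for almost all \<open>\<alpha>\<close>\<close>
  have "q x0 \<noteq> 0"
  proof
    assume "q x0 = 0"
    then have "to_fract h0 * p x0 = 0" using q[OF x0(1)] by simp
    then show False using h0(1) x0(2) by simp
  qed
  have kill: "(\<Sum>x\<in>D. scV (to_fract (q x)) (act x (act b m))) \<in> P" if b: "b \<in> F (C * i)" for b
  proof -
    have "act b m \<in> Q \<inter> G (C * i + n)" using b m Q(1) G_act unfolding stable_def by blast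
    then have "scV (to_fract h0) (T (act b m)) \<in> P" using TQ V.subspace_scale[OF Psub] by blast
    also have "scV (to_fract h0) (T (act b m)) = (\<Sum>x\<in>D. scV (to_fract (q x)) (act x (act b m)))"
      unfolding T_def V.scale_sum_right using q by (intro sum.cong refl) simp
    finally show ?thesis .
  qed
  obtain \<phi> where \<phi>: "\<And>x y. \<phi> (x + y) = \<phi> x + \<phi> y" "\<And>c x. \<phi> (scV c x) = c * \<phi> x"
    "\<And>x. x \<in> P \<Longrightarrow> \<phi> x = 0" "\<phi> m \<noteq> 0"
    using V.separating_functional[OF Psub m(2)] by blast
  let ?c = "C * i"
  have "finite_dim_subspace scA (F (?c + i + ?c))" using filt unfolding filtration_def by blast
  then obtain W where W: "finite W" "A.span W = F (?c + i + ?c)"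
    unfolding finite_dim_subspace_def by blast
  obtain h where h: "h \<noteq> 0" "\<And>x. x \<in> W \<Longrightarrow> \<exists>r. to_fract h * \<phi> (act x m) = to_fract r"
    using common_denominator[of "(\<lambda>x. \<phi> (act x m)) ` W"] W(1) by auto
  have hF: "\<exists>r. to_fract h * \<phi> (act x m) = to_fract r" if "x \<in> F (?c + i + ?c)" for x
  proof -
    have "x \<in> A.span W" using that W by simp
    then have "x \<in> F (?c + i + ?c) \<and> (\<exists>r. to_fract h * \<phi> (act x m) = to_fract r)"
    proof (induction x rule: A.span_induct_alt)
      case base
      have "act 0 m = 0" using act_sum_left[of "{}" 0 "\<lambda>_. 0" m] by simp
      moreover have "\<phi> 0 = 0" using \<phi>(2)[of 0 0] by simp
      ultimately show ?case using A.subspace_0[OF F_subspace] by (auto intro: exI[of _ 0])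
    next
      case (step c x y)
      have x: "x \<in> F (?c + i + ?c)" using step.hyps W A.span_base by blast
      have sx: "scA c x \<in> F (?c + i + ?c)" using A.subspace_scale[OF F_subspace x] .
      obtain r1 r2 where r: "to_fract h * \<phi> (act x m) = to_fract r1"
        "to_fract h * \<phi> (act y m) = to_fract r2" using h(2) step by blast
      from step.IH have y: "y \<in> F (?c + i + ?c)" by blast
      have "to_fract h * \<phi> (act (scA c x + y) m)
          = const_rf c * (to_fract h * \<phi> (act x m)) + to_fract h * \<phi> (act y m)"
        by (simp only: act_add_left[OF sx y] act_scale_left[OF x] \<phi> distrib_left mult.left_commute)
      also have "\<dots> = to_fract ([:c:] * r1 + r2)" unfolding r by (simp only: to_fract_add to_fract_mult)
      finally show ?case using A.subspace_add[OF F_subspace sx y] by blast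
    qed
    then show ?thesis by blast
  qed
  obtain r where r: "to_fract h * \<phi> m = to_fract r" using hF[OF unit_mem] act_unit by metis
  have "r \<noteq> 0"
  proof
    assume "r = 0"
    then have "to_fract h * \<phi> m = 0" using r by simp
    then show False using h(1) \<phi>(4) by simp
  qed
  \<comment> \<open>a fixed nonzero polynomial with almost all \<open>\<alpha>\<close> as roots\<close>
  have "poly r \<alpha> = 0" if \<alpha>: "poly (q x0) \<alpha> \<noteq> 0" for \<alpha>
  proof -
    define \<delta> where "\<delta> = (\<Sum>x\<in>D. scA (poly (q x) \<alpha>) x)"
    have "\<delta> \<noteq> 0" using A.independentD[OF D(2,1) subset_refl, of "\<lambda>x. poly (q x) \<alpha>" x0] x0 \<alpha>
      unfolding \<delta>_def by blast
    moreover have "\<delta> \<in> F i" unfolding \<delta>_def by (rule act_sum_left[OF D(1) DF, THEN conjunct1])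
    ultimately have "e \<in> A.span {mul (mul a \<delta>) b | a b. a \<in> F ?c \<and> b \<in> F ?c}" by (intro lin)
    from specialised_factor[OF this D(1) DF \<delta>_def P kill \<phi>(1-3) hF] obtain r' where
      "to_fract h * \<phi> m = to_fract ([:-\<alpha>, 1:] * r')" by blast
    then have "r = [:-\<alpha>, 1:] * r'" unfolding r by (simp only: to_fract_eq_iff)
    then show ?thesis by simp
  qed
  then have "UNIV \<subseteq> {\<alpha>. poly r \<alpha> = 0} \<union> {\<alpha>. poly (q x0) \<alpha> = 0}" by auto
  moreover have "finite ({\<alpha>. poly r \<alpha> = 0} \<union> {\<alpha>. poly (q x0) \<alpha> = 0})"
    using poly_roots_finite \<open>r \<noteq> 0\<close> \<open>q x0 \<noteq> 0\<close> by blast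
  ultimately have "finite (UNIV :: 'k set)" by (rule finite_subset)
  then show False using infinite_UNIV_char_0 by blast
qed

text \<open>For \<open>i\<close> with \<open>dim F i \<ge> c * i powr (2 * t)\<close>, Bernstein's inequality and the inequality of
arithmetic and geometric means give every subquotient of the chain a dimension of at least
\<open>sqrt c * i powr t\<close>, on average over the steps \<open>C * i + a\<close> and \<open>C * i + i + a\<close>. These dimensions
add up to at most the dimension of \<open>G\<close>. The shift \<open>a\<close> depends on the chain, but it does not enter
the bound, as \<open>i\<close> may be taken larger than \<open>a\<close>.\<close>

lemma chain_length_bounded:
  assumes lin: "linearly_simple scA mul e F"
    and lower: "c > 0" "\<exists>\<^sub>F i in sequentially. c * real i powr (2 * t) \<le> real (A.dim (F i))"
    and upper: "\<forall>\<^sub>F i in sequentially. real (V.dim (G i)) \<le> K * real i powr t"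
    and t: "t \<ge> 0"
  shows "\<exists>L. \<forall>l N. (\<forall>i\<le>l. stable (N i)) \<and> (\<forall>i<l. N i \<subset> N (Suc i)) \<and> N l \<subseteq> (\<Union>i. G i) \<longrightarrow> l \<le> L"
proof -
  obtain C where C: "\<And>i \<delta>. \<lbrakk>\<delta> \<in> F i; \<delta> \<noteq> 0\<rbrakk> \<Longrightarrow>
      e \<in> A.span {mul (mul a \<delta>) b | a b. a \<in> F (C * i) \<and> b \<in> F (C * i)}" and Cpos: "C > 0"
    using lin unfolding linearly_simple_def by blast
  define K' where "K' = max K 0"
  have upper': "\<forall>\<^sub>F i in sequentially. real (V.dim (G i)) \<le> K' * real i powr t"
    using upper
  proof eventually_elim
    case (elim i)
    also have "K * real i powr t \<le> K' * real i powr t"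
      unfolding K'_def by (intro mult_right_mono) auto
    finally show ?case .
  qed
  then obtain n0 where n0: "\<And>i. i \<ge> n0 \<Longrightarrow> real (V.dim (G i)) \<le> K' * real i powr t"
    unfolding eventually_sequentially by blast
  define L where "L = K' * real (C + 2) powr t / sqrt c"
  have "real l \<le> L" if st: "\<forall>i\<le>l. stable (N i)" and ch: "\<forall>i<l. N i \<subset> N (Suc i)"
    and ex: "N l \<subseteq> (\<Union>i. G i)" for l N
  proof -
    have Nl: "N i \<subseteq> N l" if "i \<le> l" for i
    proof -
      have "N i \<subseteq> N j" if "i \<le> j" "j \<le> l" for j
        using that
      proof (induction j rule: dec_induct)
        case (step j)
        then have "N j \<subset> N (Suc j)" using ch by simp
        then show ?case using step by auto
      qed auto
      then show ?thesis using that by blast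
    qed
    have "\<exists>m n. m \<in> N (Suc j) \<and> m \<notin> N j \<and> m \<in> G n" if "j < l" for j
      using ch ex Nl[of "Suc j"] that by fastforce
    then obtain m n where mn: "\<And>j. j < l \<Longrightarrow> m j \<in> N (Suc j) \<and> m j \<notin> N j \<and> m j \<in> G (n j)" by metis
    define a where "a = (\<Sum>j<l. n j)"
    have ma: "m j \<in> G a" if "j < l" for j
    proof -
      have "n j \<le> a" unfolding a_def using that by (intro member_le_sum) auto
      then show ?thesis using mn[OF that] G_mono by blast
    qed
    \<comment> \<open>for \<open>i \<ge> a\<close> both steps that occur below are at most \<open>(C + 2) * i\<close>\<close>
    define i0 where "i0 = max (max n0 a) 1"
    obtain i where i: "i \<ge> i0" "c * real i powr (2 * t) \<le> real (A.dim (F i))"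
      using lower(2) unfolding frequently_sequentially by blast
    have ige: "i \<ge> n0" "i \<ge> a" "i \<ge> 1" using i(1) unfolding i0_def by auto
    define r where "r j k = V.dim (N (Suc j) \<inter> G k) - V.dim (N j \<inter> G k)" for j k
    have dimle: "V.dim (N j \<inter> G k) \<le> V.dim (N (Suc j) \<inter> G k)" if "j < l" for j k
    proof -
      have s: "stable (N j)" "stable (N (Suc j))" using st that by auto
      have fd: "finite_dim_subspace scV (N j \<inter> G k)" "finite_dim_subspace scV (N (Suc j) \<inter> G k)"
        using V.finite_dim_subspace_Int[OF G_fin] s unfolding stable_def by blast+
      have "N j \<inter> G k \<subseteq> N (Suc j) \<inter> G k" using ch that by blast
      from V.relative_basis[OF fd this] obtain B0 B where
        "B0 \<subseteq> B" "finite B" "V.independent B" "V.span B0 = N j \<inter> G k"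
        "V.span B = N (Suc j) \<inter> G k" by metis
      then show ?thesis by (metis V.dim_span V.dim_eq_card_independent V.independent_mono card_mono)
    qed
    have tele: "real (\<Sum>j<l'. r j k) \<le> real (V.dim (N l' \<inter> G k))" if "l' \<le> l" for l' k
      using that
    proof (induction l')
      case (Suc l')
      then show ?case using dimle[of l' k] unfolding r_def by simp
    qed simp
    have dimG: "V.dim (N l \<inter> G k) \<le> V.dim (G k)" for k
    proof -
      obtain B where B: "B \<subseteq> N l \<inter> G k" "V.independent B" "card B = V.dim (N l \<inter> G k)"
        using V.basis_exists by metis
      obtain B' where B': "finite B'" "V.span B' = G k" "card B' = V.dim (G k)"
        using V.finite_dim_subspace_basis[OF G_fin] by metis
      show ?thesis using V.independent_span_bound[OF B'(1) B(2)] B B' by auto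
    qed
    have sumr: "real (\<Sum>j<l. r j k) \<le> K' * real ((C + 2) * i) powr t"
      if k: "i \<le> k" "k \<le> (C + 2) * i" for k
    proof -
      have "real (\<Sum>j<l. r j k) \<le> real (V.dim (G k))" using tele[of l k] dimG[of k] by linarith
      also have "\<dots> \<le> K' * real k powr t" using n0 ige k by simp
      also have "\<dots> \<le> K' * real ((C + 2) * i) powr t"
        using k t unfolding K'_def by (intro mult_left_mono powr_mono2) (auto simp del: of_nat_mult)
      finally show ?thesis .
    qed
    have each: "sqrt c * real i powr t \<le> (real (r j (C * i + a)) + real (r j (C * i + i + a))) / 2"
      if j: "j < l" for j
    proof -
      have s: "stable (N j)" "stable (N (Suc j))" "N j \<subseteq> N (Suc j)" using st ch j by auto
      have "A.dim (F i) \<le> r j (C * i + a) * r j (C * i + i + a)"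
        unfolding r_def using bernstein_inequality[OF C s] mn[OF j] ma[OF j] by blast
      then have "c * real i powr (2 * t) \<le> real (r j (C * i + a)) * real (r j (C * i + i + a))"
        using i(2) by (metis of_nat_le_iff of_nat_mult order_trans)
      then have "sqrt (c * real i powr (2 * t)) \<le> sqrt (real (r j (C * i + a)) * real (r j (C * i + i + a)))"
        by simp
      also have "\<dots> \<le> (real (r j (C * i + a)) + real (r j (C * i + i + a))) / 2"
        by (intro arith_geo_mean_sqrt) auto
      also have "real i powr (2 * t) = (real i powr t)\<^sup>2"
        by (simp add: power2_eq_square powr_add[symmetric])
      finally show ?thesis by (simp add: real_sqrt_mult)
    qed
    have Ci: "C * i \<ge> i" using Cpos by simp
    have "real l * (sqrt c * real i powr t) = (\<Sum>j<l. sqrt c * real i powr t)" by simp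
    also have "\<dots> \<le> (\<Sum>j<l. (real (r j (C * i + a)) + real (r j (C * i + i + a))) / 2)"
      using each by (intro sum_mono) auto
    also have "\<dots> = (real (\<Sum>j<l. r j (C * i + a)) + real (\<Sum>j<l. r j (C * i + i + a))) / 2"
      by (simp add: sum.distrib sum_divide_distrib[symmetric])
    also have "\<dots> \<le> K' * real ((C + 2) * i) powr t"
    proof -
      have "real (\<Sum>j<l. r j (C * i + a)) \<le> K' * real ((C + 2) * i) powr t"
        using ige Ci by (intro sumr) (simp_all add: algebra_simps trans_le_add2)
      moreover have "real (\<Sum>j<l. r j (C * i + i + a)) \<le> K' * real ((C + 2) * i) powr t"
        using ige Ci by (intro sumr) (simp_all add: algebra_simps trans_le_add2)
      moreover have "(x + y) / 2 \<le> z" if "x \<le> z" "y \<le> z" for x y z :: real using that by simp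
      ultimately show ?thesis by blast
    qed
    also have "\<dots> = K' * real (C + 2) powr t * real i powr t"
      unfolding of_nat_mult by (subst powr_mult) (simp_all only: of_nat_0_le_iff mult.assoc)
    finally have "(real l * sqrt c) * real i powr t \<le> (K' * real (C + 2) powr t) * real i powr t"
      by (simp only: ac_simps)
    then have "real l * sqrt c \<le> K' * real (C + 2) powr t"
      using ige(3) by (subst (asm) mult_le_cancel_right) auto
    then show ?thesis unfolding L_def using lower(1) by (simp add: field_simps)
  qed
  then have "l \<le> nat \<lceil>L\<rceil>" if "\<forall>i\<le>l. stable (N i)" "\<forall>i<l. N i \<subset> N (Suc i)" "N l \<subseteq> (\<Union>i. G i)" for l N
    using that real_nat_ceiling_ge[of L] by (metis of_nat_le_iff order_trans)
  then show ?thesis by blast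
qed

end

section \<open>Rational functions at large integers\<close>

text \<open>The choice of the fraction is immaterial for large \<open>n\<close>, where neither of two denominators vanishes.\<close>

definition rf_eval :: "'k::field_char_0 ratfun \<Rightarrow> nat \<Rightarrow> 'k" where
  "rf_eval p n = (case SOME (a, b). b \<noteq> 0 \<and> p = Fract a b of
     (a, b) \<Rightarrow> poly a (of_nat n) / poly b (of_nat n))"

lemma eventually_poly_nonzero:
  fixes b :: "'k::field_char_0 poly"
  assumes "b \<noteq> 0"
  shows "\<forall>\<^sub>F n in sequentially. poly b (of_nat n) \<noteq> 0"
proof -
  have "finite (of_nat -` {x. poly b x = 0} :: nat set)"
    using poly_roots_finite[OF assms] by (intro finite_vimageI) (auto simp: inj_on_def)
  then show ?thesis
    by (simp add: cofinite_eq_sequentially[symmetric] eventually_cofinite vimage_def)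
qed

lemma rf_eval_Fract:
  fixes a b :: "'k::field_char_0 poly"
  assumes "b \<noteq> 0"
  shows "\<forall>\<^sub>F n in sequentially. rf_eval (Fract a b) n = poly a (of_nat n) / poly b (of_nat n)"
proof -
  define ab where "ab = (SOME (a', b'). b' \<noteq> 0 \<and> Fract a b = Fract a' b')"
  obtain a' b' where ab': "ab = (a', b')" by (cases ab) auto
  have "case ab of (a', b') \<Rightarrow> b' \<noteq> 0 \<and> Fract a b = Fract a' b'"
    unfolding ab_def by (rule someI[of _ "(a, b)"]) (use assms in auto)
  then have *: "b' \<noteq> 0" "Fract a b = Fract a' b'" using ab' by auto
  have eq: "a * b' = a' * b" using * assms by (simp add: eq_fract)
  show ?thesis
    using eventually_poly_nonzero[OF assms] eventually_poly_nonzero[OF *(1)]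
  proof eventually_elim
    case (elim n)
    have "rf_eval (Fract a b) n = poly a' (of_nat n) / poly b' (of_nat n)"
      unfolding rf_eval_def using ab' unfolding ab_def by simp
    moreover have "poly a (of_nat n) * poly b' (of_nat n) = poly a' (of_nat n) * poly b (of_nat n)"
      using eq by (metis poly_mult)
    ultimately show ?case using elim by (simp add: frac_eq_eq)
  qed
qed

lemma rf_eval_to_fract:
  fixes a :: "'k::field_char_0 poly"
  shows "\<forall>\<^sub>F n in sequentially. rf_eval (to_fract a) n = poly a (of_nat n)"
  using rf_eval_Fract[of 1 a] by (simp add: to_fract_def)

lemma rf_eval_add:
  fixes p q :: "'k::field_char_0 ratfun"
  shows "\<forall>\<^sub>F n in sequentially. rf_eval (p + q) n = rf_eval p n + rf_eval q n"
proof -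
  obtain a b where p: "p = Fract a b" "b \<noteq> 0" by (cases p) auto
  obtain c d where q: "q = Fract c d" "d \<noteq> 0" by (cases q) auto
  have "p + q = Fract (a * d + c * b) (b * d)" using p q by simp
  then have "\<forall>\<^sub>F n in sequentially. rf_eval (p + q) n
      = poly (a * d + c * b) (of_nat n) / poly (b * d) (of_nat n)"
    using rf_eval_Fract[of "b * d" "a * d + c * b"] p(2) q(2) by (simp only: mult_eq_0_iff simp_thms)
  then show ?thesis
    using rf_eval_Fract[OF p(2), of a, folded p(1)] rf_eval_Fract[OF q(2), of c, folded q(1)]
      eventually_poly_nonzero[OF p(2)] eventually_poly_nonzero[OF q(2)]
    by eventually_elim (simp add: add_frac_eq)
qed

lemma rf_eval_mult:
  fixes p q :: "'k::field_char_0 ratfun"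
  shows "\<forall>\<^sub>F n in sequentially. rf_eval (p * q) n = rf_eval p n * rf_eval q n"
proof -
  obtain a b where p: "p = Fract a b" "b \<noteq> 0" by (cases p) auto
  obtain c d where q: "q = Fract c d" "d \<noteq> 0" by (cases q) auto
  have "p * q = Fract (a * c) (b * d)" using p q by simp
  then have "\<forall>\<^sub>F n in sequentially. rf_eval (p * q) n
      = poly (a * c) (of_nat n) / poly (b * d) (of_nat n)"
    using rf_eval_Fract[of "b * d" "a * c"] p(2) q(2) by (simp only: mult_eq_0_iff simp_thms)
  then show ?thesis
    using rf_eval_Fract[OF p(2), of a] rf_eval_Fract[OF q(2), of c]
    by eventually_elim (simp add: p(1) q(1))
qed

lemma rf_eval_const:
  fixes c :: "'k::field_char_0"
  shows "\<forall>\<^sub>F n in sequentially. rf_eval (const_rf c) n = c"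
  using rf_eval_to_fract[of "[:c:]"] by simp

text \<open>The shifted binomial coefficient \<open>(s - m) choose l\<close>.\<close>

definition shifted_binom :: "nat \<Rightarrow> nat \<Rightarrow> 'k::field_char_0 ratfun" where
  "shifted_binom m l = to_fract ([:inverse (fact l):] * (\<Prod>j<l. [:- of_nat m - of_nat j, 1:]))"

lemma to_fract_of_nat: "to_fract (of_nat n :: 'a::idom) = of_nat n"
  by (induction n) (simp_all add: to_fract_def[of 1])

lemma to_fract_prod: "to_fract (\<Prod>x\<in>X. g x) = (\<Prod>x\<in>X. to_fract (g x))"
  by (induction X rule: infinite_finite_induct) auto

lemma binom_s_eq: "(binom_s l :: 'k::field_char_0 ratfun) = shifted_binom 0 l"
proof -
  have lin: "to_fract [:- of_nat j, 1 :: 'k:] = s_rf - of_nat j" for j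
  proof -
    have "[:- of_nat j, 1 :: 'k:] = [:0, 1:] - of_nat j" by (simp add: of_nat_poly)
    then show ?thesis by (simp only: to_fract_diff to_fract_of_nat)
  qed
  have "to_fract [:fact l :: 'k:] = of_nat (fact l)"
    by (metis of_nat_fact of_nat_poly to_fract_of_nat)
  then have "of_nat (fact l) * to_fract [:inverse (fact l) :: 'k:] = to_fract ([:fact l:] * [:inverse (fact l):])"
    by (simp only: to_fract_mult)
  also have "[:fact l:] * [:inverse (fact l) :: 'k:] = 1" by (simp add: one_pCons)
  finally have "to_fract [:inverse (fact l) :: 'k:] = inverse (of_nat (fact l))"
    by (metis inverse_unique to_fract_1)
  then show ?thesis
    unfolding binom_s_def shifted_binom_def to_fract_mult to_fract_prod
    by (simp add: lin divide_inverse mult.commute)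
qed

lemma rf_eval_shifted_binom:
  "\<forall>\<^sub>F n in sequentially. rf_eval (shifted_binom m l :: 'k::field_char_0 ratfun) n = (of_nat n - of_nat m) gchoose l"
  using rf_eval_to_fract[of "[:inverse (fact l):] * (\<Prod>j<l. [:- of_nat m - of_nat j, 1:]) :: 'k poly"]
  unfolding shifted_binom_def
proof eventually_elim
  case (elim n)
  have "poly ([:inverse (fact l):] * (\<Prod>j<l. [:- of_nat m - of_nat j, 1:])) (of_nat n)
     = (\<Prod>j<l. (of_nat n - of_nat m :: 'k) - of_nat j) / fact l"
    by (simp add: poly_prod field_simps)
  also have "\<dots> = (of_nat n - of_nat m) gchoose l"
    by (simp add: gbinomial_prod_rev atLeast0LessThan)
  finally show ?case using elim by simp
qed

lemma rf_eval_inject: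
  fixes p q :: "'k::field_char_0 ratfun"
  assumes "\<forall>\<^sub>F n in sequentially. rf_eval p n = rf_eval q n"
  shows "p = q"
proof -
  obtain a b where ab: "p - q = Fract a b" "b \<noteq> 0" by (cases "p - q") auto
  have "p = q + Fract a b" using ab by (metis add.commute diff_add_cancel)
  then have ev: "\<forall>\<^sub>F n in sequentially. rf_eval p n = rf_eval q n + rf_eval (Fract a b) n"
    using rf_eval_add by blast
  have "a = 0"
  proof (rule ccontr)
    assume "a \<noteq> 0"
    from eventually_poly_nonzero[OF this] eventually_poly_nonzero[OF ab(2)] rf_eval_Fract[OF ab(2), of a] ev assms
    have "\<forall>\<^sub>F n::nat in sequentially. False" by eventually_elim auto
    then show False by simp
  qed
  then have "p - q = 0" using ab by (simp add: fract_collapse)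
  then show ?thesis by simp
qed

text \<open>Both sides agree at all large integers, where the identity is the Vandermonde identity in \<open>k\<close>.\<close>

lemma shifted_binom_Vandermonde:
  "(\<Sum>i\<le>t. shifted_binom 0 i * const_rf ((- of_nat m) gchoose (t - i)))
     = (shifted_binom m t :: 'k::field_char_0 ratfun)"
proof (rule rf_eval_inject)
  have sum: "\<forall>\<^sub>F n in sequentially. rf_eval (\<Sum>i\<in>I. p i) n = (\<Sum>i\<in>I. rf_eval (p i) n)"
    if "finite I" for I and p :: "nat \<Rightarrow> 'k ratfun"
    using that
  proof (induction I rule: finite_induct)
    case empty
    show ?case using rf_eval_const[of "0::'k"] by eventually_elim simp
  next
    case (insert i I)
    from insert.IH rf_eval_add[of "p i" "\<Sum>i\<in>I. p i"] show ?case
      by eventually_elim (simp add: insert.hyps)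
  qed
  have "\<forall>\<^sub>F n in sequentially. \<forall>i\<in>{..t}. rf_eval (shifted_binom 0 i * const_rf ((- of_nat m) gchoose (t - i))) n
      = (of_nat n gchoose i) * ((- of_nat m :: 'k) gchoose (t - i))"
  proof (intro eventually_ball_finite ballI)
    fix i
    show "\<forall>\<^sub>F n in sequentially. rf_eval (shifted_binom 0 i * const_rf ((- of_nat m) gchoose (t - i))) n
      = (of_nat n gchoose i) * ((- of_nat m :: 'k) gchoose (t - i))"
      using rf_eval_mult[of "shifted_binom 0 i" "const_rf ((- of_nat m :: 'k) gchoose (t - i))"]
        rf_eval_const[of "(- of_nat m :: 'k) gchoose (t - i)"] rf_eval_shifted_binom[of 0 i, where 'k = 'k]
      by eventually_elim simp
  qed simp
  then show "\<forall>\<^sub>F n in sequentially. rf_eval (\<Sum>i\<le>t. shifted_binom 0 i * const_rf ((- of_nat m :: 'k) gchoose (t - i))) n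
      = rf_eval (shifted_binom m t) n"
    using rf_eval_shifted_binom[of m t, where 'k = 'k]
      sum[of "{..t}" "\<lambda>i. shifted_binom 0 i * const_rf ((- of_nat m :: 'k) gchoose (t - i))", OF finite_atMost]
  proof eventually_elim
    case (elim n)
    then have "rf_eval (\<Sum>i\<le>t. shifted_binom 0 i * const_rf ((- of_nat m :: 'k) gchoose (t - i))) n
       = (\<Sum>i\<le>t. (of_nat n gchoose i) * ((- of_nat m :: 'k) gchoose (t - i)))" by simp
    also have "\<dots> = (of_nat n + - of_nat m) gchoose t"
      using gbinomial_Vandermonde[of "of_nat n :: 'k" "- of_nat m" t] by (simp add: atLeast0AtMost)
    finally show ?case using elim by simp
  qed
qed

section \<open>Germs at infinity of sequences\<close>

text \<open>Rational functions have poles and \<open>f ^ (n - m)\<close> is only meaningful for \<open>n \<ge> m\<close>, whence germs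
at infinity in place of sequences.\<close>

quotient_type 'a germ = "nat \<Rightarrow> 'a" / "\<lambda>x y. \<forall>\<^sub>F n in sequentially. x n = y n"
  morphisms rep_germ germ_of
proof (rule equivpI)
  show "symp (\<lambda>x y. \<forall>\<^sub>F n in sequentially. x n = (y n :: 'a))"
    by (rule sympI) (simp add: eq_commute)
  show "transp (\<lambda>x y. \<forall>\<^sub>F n in sequentially. x n = (y n :: 'a))"
  proof (rule transpI)
    fix x y z :: "nat \<Rightarrow> 'a"
    assume "\<forall>\<^sub>F n in sequentially. x n = y n" "\<forall>\<^sub>F n in sequentially. y n = z n"
    then show "\<forall>\<^sub>F n in sequentially. x n = z n" by eventually_elim simp
  qed
qed (auto simp: reflp_def)

lemma germ_of_eq_iff: "germ_of x = germ_of y \<longleftrightarrow> (\<forall>\<^sub>F n in sequentially. x n = y n)"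
  by (rule germ.abs_eq_iff)

lemma germ_of_cases: obtains x where "y = germ_of x"
  by (induction y rule: germ.abs_induct) blast

instantiation germ :: (ab_group_add) ab_group_add
begin

lift_definition zero_germ :: "'a germ" is "\<lambda>_. 0" .
lift_definition plus_germ :: "'a germ \<Rightarrow> 'a germ \<Rightarrow> 'a germ" is "\<lambda>x y n. x n + y n"
  by (erule (1) eventually_elim2) simp
lift_definition minus_germ :: "'a germ \<Rightarrow> 'a germ \<Rightarrow> 'a germ" is "\<lambda>x y n. x n - y n"
  by (erule (1) eventually_elim2) simp
lift_definition uminus_germ :: "'a germ \<Rightarrow> 'a germ" is "\<lambda>x n. - x n"
  by (elim eventually_mono) auto

instance
  by standard (transfer; simp; fail | transfer; simp add: algebra_simps; fail)+

end

lift_definition germ_map :: "('a \<Rightarrow> 'b) \<Rightarrow> 'a germ \<Rightarrow> 'b germ" is "\<lambda>g x n. g (x n)"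
  by (elim eventually_mono) auto

lift_definition germ_scale :: "('k::field_char_0 \<Rightarrow> 'a \<Rightarrow> 'a) \<Rightarrow> 'k ratfun \<Rightarrow> 'a germ \<Rightarrow> 'a germ"
  is "\<lambda>sc p x n. sc (rf_eval p n) (x n)"
  by (elim eventually_mono) auto

lemma germ_of_0: "germ_of (\<lambda>_. 0) = 0"
  by (simp add: zero_germ.abs_eq)

lemma germ_of_sum: "germ_of (\<lambda>n. \<Sum>i\<in>I. x i n) = (\<Sum>i\<in>I. germ_of (x i))"
  by (induction I rule: infinite_finite_induct) (simp_all add: germ_of_0 plus_germ.abs_eq[symmetric])

lemma vector_space_germ:
  fixes sc :: "'k::field_char_0 \<Rightarrow> 'v::ab_group_add \<Rightarrow> 'v"
  assumes "vector_space sc"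
  shows "vector_space (germ_scale sc)"
proof -
  interpret vector_space sc by fact
  show ?thesis
  proof
    fix p q :: "'k ratfun" and y z :: "'v germ"
    obtain x where y: "y = germ_of x" by (rule germ_of_cases)
    obtain x' where z: "z = germ_of x'" by (rule germ_of_cases)
    show "germ_scale sc p (y + z) = germ_scale sc p y + germ_scale sc p z"
      unfolding y z germ_scale.abs_eq plus_germ.abs_eq by (simp add: scale_right_distrib)
    show "germ_scale sc (p + q) y = germ_scale sc p y + germ_scale sc q y"
      unfolding y germ_scale.abs_eq plus_germ.abs_eq germ_of_eq_iff
      using rf_eval_add[of p q] by eventually_elim (simp add: scale_left_distrib)
    show "germ_scale sc p (germ_scale sc q y) = germ_scale sc (p * q) y"
      unfolding y germ_scale.abs_eq germ_of_eq_iff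
      using rf_eval_mult[of p q] by eventually_elim simp
    show "germ_scale sc 1 y = y"
      unfolding y germ_scale.abs_eq germ_of_eq_iff
      using rf_eval_const[of "1::'k"] by eventually_elim (simp add: pCons_one)
  qed
qed

lemma germ_scale_const: "germ_scale sc (const_rf c) (germ_of x) = germ_of (\<lambda>n. sc c (x n))"
  unfolding germ_scale.abs_eq germ_of_eq_iff using rf_eval_const[of c] by eventually_elim simp

lemma germ_map_add: "germ_map (\<delta> + \<epsilon>) y = germ_map \<delta> y + germ_map \<epsilon> (y :: 'a germ)"
  for \<delta> \<epsilon> :: "'a \<Rightarrow> 'b::ab_group_add"
  by (rule germ_of_cases[of y]) (simp add: germ_map.abs_eq plus_germ.abs_eq)

lemma germ_map_comp: "germ_map (\<delta> \<circ> \<epsilon>) y = germ_map \<delta> (germ_map \<epsilon> y)"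
  by (rule germ_of_cases[of y]) (simp add: germ_map.abs_eq)

lemma germ_map_id: "germ_map id y = y"
  by (rule germ_of_cases[of y]) (simp add: germ_map.abs_eq)

lemma germ_map_op_scale: "germ_map (op_scale sc c \<delta>) y = germ_scale sc (const_rf c) (germ_map \<delta> y)"
  by (rule germ_of_cases[of y]) (simp add: germ_map.abs_eq germ_scale_const op_scale_def)

section \<open>Differential operators and iterated commutators\<close>

abbreviation ad_pow :: "'r::comm_ring_1 \<Rightarrow> nat \<Rightarrow> ('r \<Rightarrow> 'r) \<Rightarrow> 'r \<Rightarrow> 'r" where
  "ad_pow f i \<delta> \<equiv> ((\<lambda>\<epsilon>. commutator \<epsilon> f) ^^ i) \<delta>"

lemma ad_pow_Suc_apply: "ad_pow f (Suc i) \<delta> x = ad_pow f i \<delta> (f * x) - f * ad_pow f i \<delta> x"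
  by (simp add: commutator_def)

lemma ad_pow_add: "ad_pow f l (ad_pow f i \<delta>) = ad_pow f (i + l) \<delta>"
  by (simp add: funpow_add add.commute[of i l])

lemma commutator_sum:
  "commutator (\<lambda>x. \<Sum>j\<in>J. r j * \<epsilon> j x) f = (\<lambda>x. \<Sum>j\<in>J. r j * commutator (\<epsilon> j) f x)"
  unfolding commutator_def
  by (rule ext) (simp add: sum_distrib_left sum_subtractf right_diff_distrib mult.left_commute)

text \<open>Commutators with \<open>f\<close> do not see left multiplication by elements of the commutative ring.\<close>

lemma ad_pow_sum:
  "ad_pow f l (\<lambda>x. \<Sum>j\<in>J. r j * \<epsilon> j x) = (\<lambda>x. \<Sum>j\<in>J. r j * ad_pow f l (\<epsilon> j) x)"
  by (induction l) (simp_all add: commutator_sum)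

lemma commutator_leibniz:
  fixes f :: "'r::comm_ring_1"
  shows "\<delta> (f ^ n * x) = (\<Sum>j\<le>n. of_nat (n choose j) * f ^ (n - j) * ad_pow f j \<delta> x)"
proof (induction n arbitrary: \<delta> x)
  case (Suc n)
  have IH: "\<delta> (f ^ n * f * x) = (\<Sum>j\<le>n. of_nat (n choose j) * f ^ (n - j) * ad_pow f j \<delta> (f * x))"
    using Suc.IH[of \<delta> "f * x"] by (simp only: mult.assoc)
  have "ad_pow f j \<delta> (f * x) = f * ad_pow f j \<delta> x + ad_pow f (Suc j) \<delta> x" for j
    using ad_pow_Suc_apply[where f = f and i = j and \<delta> = \<delta> and x = x] by (simp only: algebra_simps)
  then have "\<delta> (f ^ n * f * x) = (\<Sum>j\<le>n. of_nat (n choose j) * f ^ (n - j) * (f * ad_pow f j \<delta> x + ad_pow f (Suc j) \<delta> x))"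
    unfolding IH by (simp only:)
  also have "\<dots> = (\<Sum>j\<le>n. of_nat (n choose j) * f ^ (Suc n - j) * ad_pow f j \<delta> x)
      + (\<Sum>j\<le>n. of_nat (n choose j) * f ^ (n - j) * ad_pow f (Suc j) \<delta> x)"
    unfolding sum.distrib[symmetric]
  proof (intro sum.cong refl)
    fix j assume "j \<in> {..n}"
    then have "f ^ (Suc n - j) = f ^ (n - j) * f" by (simp add: Suc_diff_le)
    then show "of_nat (n choose j) * f ^ (n - j) * (f * ad_pow f j \<delta> x + ad_pow f (Suc j) \<delta> x)
      = of_nat (n choose j) * f ^ (Suc n - j) * ad_pow f j \<delta> x
       + of_nat (n choose j) * f ^ (n - j) * ad_pow f (Suc j) \<delta> x"
      by (simp only: distrib_left mult.assoc)
  qed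
  also have "(\<Sum>j\<le>n. of_nat (n choose j) * f ^ (Suc n - j) * ad_pow f j \<delta> x)
      = (\<Sum>j\<le>Suc n. of_nat (n choose j) * f ^ (Suc n - j) * ad_pow f j \<delta> x)"
    by (simp add: binomial_eq_0)
  also have "\<dots> = f ^ Suc n * \<delta> x + (\<Sum>j\<le>n. of_nat (n choose Suc j) * f ^ (n - j) * ad_pow f (Suc j) \<delta> x)"
    unfolding sum.atMost_Suc_shift by (simp del: funpow.simps add: funpow_0 binomial_eq_0)
  also have "\<dots> + (\<Sum>j\<le>n. of_nat (n choose j) * f ^ (n - j) * ad_pow f (Suc j) \<delta> x)
      = f ^ Suc n * \<delta> x + (\<Sum>j\<le>n. of_nat (Suc n choose Suc j) * f ^ (n - j) * ad_pow f (Suc j) \<delta> x)"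
    by (simp del: funpow.simps add: sum.distrib algebra_simps)
  also have "\<dots> = (\<Sum>j\<le>Suc n. of_nat (Suc n choose j) * f ^ (Suc n - j) * ad_pow f j \<delta> x)"
    unfolding sum.atMost_Suc_shift by (simp del: funpow.simps binomial_Suc_Suc add: funpow_0)
  finally show ?case by (simp only: power_Suc2)
qed simp

context comm_algebra
begin

lemma scale_of_nat: "sc (of_nat n) x = of_nat n * x"
  by (induction n) (auto simp: scale_left_distrib algebra_simps)

lemma commutator_mem: "\<delta> \<in> diff_ops_le sc (Suc n) \<Longrightarrow> commutator \<delta> r \<in> diff_ops_le sc n"
  by simp

lemma commutator_diff_ops_le_0: "\<delta> \<in> diff_ops_le sc 0 \<Longrightarrow> commutator \<delta> r = (\<lambda>_. 0)"
  by (auto simp: commutator_def mult.left_commute)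

lemma zero_mem_diff_ops_le_0: "(\<lambda>_. 0) \<in> diff_ops_le sc 0"
  by (auto simp: fun_eq_iff intro: exI[of _ 0])

lemma linear_mult: "Vector_Spaces.linear sc sc (\<lambda>x. r * x)"
proof (unfold_locales)
  show "r * sc c x = sc c (r * x)" for c x by (metis mult.commute sc_mult)
qed (simp add: distrib_left)

lemma diff_ops_le_Suc: "diff_ops_le sc n \<subseteq> diff_ops_le sc (Suc n)"
proof (induction n)
  case 0
  show ?case
  proof
    fix \<delta> assume \<delta>: "\<delta> \<in> diff_ops_le sc 0"
    then have "Vector_Spaces.linear sc sc \<delta>" using linear_mult by auto
    moreover have "commutator \<delta> r \<in> diff_ops_le sc 0" for r
      using commutator_diff_ops_le_0[OF \<delta>, of r] zero_mem_diff_ops_le_0 by simp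
    ultimately show "\<delta> \<in> diff_ops_le sc (Suc 0)" by simp
  qed
next
  case (Suc n)
  then show ?case by auto
qed

lemma diff_ops_le_linear: "\<delta> \<in> diff_ops_le sc n \<Longrightarrow> Vector_Spaces.linear sc sc \<delta>"
  using diff_ops_le_Suc[of n] by auto

lemma diff_ops_linear: "\<delta> \<in> diff_ops sc \<Longrightarrow> Vector_Spaces.linear sc sc \<delta>"
  unfolding diff_ops_def using diff_ops_le_linear by blast

lemma commutator_mem_same: "\<delta> \<in> diff_ops_le sc n \<Longrightarrow> commutator \<delta> r \<in> diff_ops_le sc (n - 1)"
  using commutator_diff_ops_le_0[of \<delta> r] zero_mem_diff_ops_le_0 by (cases n) auto

lemma ad_pow_mem: "\<delta> \<in> diff_ops_le sc n \<Longrightarrow> ad_pow f i \<delta> \<in> diff_ops_le sc (n - i)"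
proof (induction i)
  case (Suc i)
  then have "commutator (ad_pow f i \<delta>) f \<in> diff_ops_le sc (n - i - 1)" by (intro commutator_mem_same)
  then show ?case by simp
qed simp

lemma ad_pow_eq_0:
  assumes "\<delta> \<in> diff_ops_le sc n" "i > n"
  shows "ad_pow f i \<delta> = (\<lambda>_. 0)"
  using assms(2)
proof (induction i)
  case (Suc i)
  show ?case
  proof (cases "i = n")
    case True
    have "ad_pow f n \<delta> \<in> diff_ops_le sc 0" using ad_pow_mem[OF assms(1), where f = f and i = n] by simp
    then show ?thesis using commutator_diff_ops_le_0 True by simp
  next
    case False
    then show ?thesis using Suc by (simp add: commutator_def)
  qed
qed simp

lemma diff_order_mem: "\<delta> \<in> diff_ops sc \<Longrightarrow> \<delta> \<in> diff_ops_le sc (diff_order sc \<delta>)"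
  unfolding diff_ops_def diff_order_def by (auto intro: LeastI)

lemma ad_pow_diff_ops: "\<delta> \<in> diff_ops sc \<Longrightarrow> ad_pow f i \<delta> \<in> diff_ops sc"
  unfolding diff_ops_def using ad_pow_mem by blast

end

section \<open>Fractions as germs\<close>

text \<open>The specialisations of \<open>(a / f ^ m) f\<^sup>s\<close> at \<open>s = n\<close>, for the pair \<open>(a, m)\<close>. The truncated
subtraction does not matter, since germs only depend on the entries with \<open>n \<ge> m\<close>.\<close>

definition frac_germ :: "'r::comm_ring_1 \<Rightarrow> 'r \<times> nat \<Rightarrow> 'r germ" where
  "frac_germ f p = germ_of (\<lambda>n. f ^ (n - snd p) * fst p)"

lemma frac_germ_cancel: "frac_germ f (f ^ j * a, m + j) = frac_germ f (a, m)"
proof -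
  have "f ^ (n - (m + j)) * (f ^ j * a) = f ^ (n - m) * a" if "n \<ge> m + j" for n
  proof -
    have "n - m = n - (m + j) + j" using that by simp
    then show ?thesis by (metis mult.assoc power_add)
  qed
  then show ?thesis unfolding frac_germ_def germ_of_eq_iff
    by (auto simp: eventually_sequentially intro!: exI[of _ "m + j"])
qed

text \<open>A zero divisor \<open>f\<close> causes no trouble: an extra power of \<open>f\<close> is a shift of \<open>n\<close>. Thus the
localization embeds into the space of germs.\<close>

lemma frac_germ_eq_iff: "frac_germ f p = frac_germ f q \<longleftrightarrow> (p, q) \<in> loc_rel f"
proof -
  obtain a m b n where pq: "p = (a, m)" "q = (b, n)" by (cases p, cases q) auto
  show ?thesis
  proof
    assume "frac_germ f p = frac_germ f q"
    then obtain N where N: "\<And>k. k \<ge> N \<Longrightarrow> f ^ (k - m) * a = f ^ (k - n) * b"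
      unfolding pq frac_germ_def germ_of_eq_iff eventually_sequentially by auto
    have "f ^ N * f ^ n * a = f ^ N * f ^ m * b"
      using N[of "N + m + n"] by (simp add: power_add[symmetric] add.commute add.left_commute)
    then have "f ^ N * (f ^ n * a - f ^ m * b) = 0" by (simp add: algebra_simps)
    then show "(p, q) \<in> loc_rel f" unfolding pq loc_rel_def by blast
  next
    assume "(p, q) \<in> loc_rel f"
    then obtain l where "f ^ l * (f ^ n * a - f ^ m * b) = 0" unfolding pq loc_rel_def by blast
    then have "f ^ (l + n) * a = f ^ (l + m) * b" by (simp add: algebra_simps power_add)
    moreover have "frac_germ f p = frac_germ f (f ^ (l + n) * a, m + (l + n))"
      unfolding pq by (rule frac_germ_cancel[symmetric])
    moreover have "frac_germ f q = frac_germ f (f ^ (l + m) * b, n + (l + m))"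
      unfolding pq by (rule frac_germ_cancel[symmetric])
    moreover have "m + (l + n) = n + (l + m)" by simp
    ultimately show "frac_germ f p = frac_germ f q" by metis
  qed
qed

lemma frac_germ_0: "frac_germ f (0, m) = 0"
  by (simp add: frac_germ_def germ_of_0)

lemma frac_germ_same_denominator_add: "frac_germ f (a + b, m) = frac_germ f (a, m) + frac_germ f (b, m)"
  by (simp add: frac_germ_def plus_germ.abs_eq distrib_left)

lemma frac_germ_same_denominator_diff: "frac_germ f (a - b, m) = frac_germ f (a, m) - frac_germ f (b, m)"
  by (simp add: frac_germ_def minus_germ.abs_eq right_diff_distrib)

lemma frac_germ_sum: "frac_germ f (\<Sum>i\<in>I. a i, m) = (\<Sum>i\<in>I. frac_germ f (a i, m))"
  by (simp add: frac_germ_def germ_of_sum sum_distrib_left)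

text \<open>On the germs of fractions, this is the division by \<open>f ^ m\<close>.\<close>

lift_definition germ_shift :: "nat \<Rightarrow> 'a germ \<Rightarrow> 'a germ" is "\<lambda>m x n. x (n - m)"
proof -
  fix m and x y :: "nat \<Rightarrow> 'a"
  assume "\<forall>\<^sub>F n in sequentially. x n = y n"
  moreover have "filterlim (\<lambda>n. n - m) at_top sequentially"
    by (simp add: filterlim_minus_const_nat_at_top)
  ultimately show "\<forall>\<^sub>F n in sequentially. x (n - m) = y (n - m)"
    by (rule eventually_compose_filterlim)
qed

lemma germ_shift_frac_germ: "germ_shift k (frac_germ f (a, m)) = frac_germ f (a, m + k)"
  by (simp add: frac_germ_def germ_shift.abs_eq add.commute)

lemma germ_shift_add: "germ_shift m (x + y) = germ_shift m x + germ_shift m y"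
  by transfer simp

lemma germ_shift_0: "germ_shift m 0 = 0"
  by transfer simp

lemma germ_shift_sum: "germ_shift m (\<Sum>i\<in>I. x i) = (\<Sum>i\<in>I. germ_shift m (x i))"
  by (induction I rule: infinite_finite_induct) (simp_all add: germ_shift_add germ_shift_0)

lemma germ_shift_scale_const:
  "germ_shift m (germ_scale sc (const_rf c) y) = germ_scale sc (const_rf c) (germ_shift m y)"
  by (rule germ_of_cases[of y]) (simp add: germ_scale_const germ_shift.abs_eq)

locale comm_algebra_char_0 = comm_algebra sc
  for sc :: "'k::field_char_0 \<Rightarrow> 'r::comm_ring_1 \<Rightarrow> 'r"
begin

sublocale germs: vector_space "germ_scale sc"
  by (rule vector_space_germ) unfold_locales

lemma frac_germ_scale: "frac_germ f (sc c a, m) = germ_scale sc (const_rf c) (frac_germ f (a, m))"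
  unfolding frac_germ_def germ_scale_const by (simp add: sc_mult[symmetric] mult.commute)

lemma frac_germ_of_nat_mult:
  "frac_germ f (of_nat k * a, m) = germ_scale sc (const_rf (of_nat k)) (frac_germ f (a, m))"
  unfolding frac_germ_scale[symmetric] scale_of_nat ..

text \<open>The Leibniz rule, read at all large \<open>n\<close> simultaneously.\<close>

lemma germ_map_frac_germ:
  assumes "\<delta> \<in> diff_ops_le sc N"
  shows "germ_map \<delta> (frac_germ f (a, m))
    = (\<Sum>l\<le>N. germ_scale sc (shifted_binom m l) (frac_germ f (ad_pow f l \<delta> a, m + l)))"
proof -
  have "\<forall>\<^sub>F n in sequentially. \<forall>l\<in>{..N}. rf_eval (shifted_binom m l) n = (of_nat n - of_nat m :: 'k) gchoose l"
    using rf_eval_shifted_binom by (intro eventually_ball_finite ballI) auto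
  then have "\<forall>\<^sub>F n in sequentially. \<delta> (f ^ (n - m) * a)
     = (\<Sum>l\<le>N. sc (rf_eval (shifted_binom m l) n) (f ^ (n - (m + l)) * ad_pow f l \<delta> a))"
    using eventually_ge_at_top[of "m + N"]
  proof eventually_elim
    case (elim n)
    have "\<delta> (f ^ (n - m) * a) = (\<Sum>j\<le>n - m. of_nat ((n - m) choose j) * f ^ (n - m - j) * ad_pow f j \<delta> a)"
      by (rule commutator_leibniz)
    also have "\<dots> = (\<Sum>j\<le>N. of_nat ((n - m) choose j) * f ^ (n - m - j) * ad_pow f j \<delta> a)"
      using elim ad_pow_eq_0[OF assms] by (intro sum.mono_neutral_right) auto
    also have "\<dots> = (\<Sum>l\<le>N. sc (rf_eval (shifted_binom m l) n) (f ^ (n - (m + l)) * ad_pow f l \<delta> a))"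
    proof (intro sum.cong refl)
      fix l assume l: "l \<in> {..N}"
      have "(of_nat n - of_nat m :: 'k) = of_nat (n - m)" using elim by (simp add: of_nat_diff)
      then have "rf_eval (shifted_binom m l) n = (of_nat ((n - m) choose l) :: 'k)"
        using elim l by (simp add: binomial_gbinomial)
      then show "of_nat ((n - m) choose l) * f ^ (n - m - l) * ad_pow f l \<delta> a
        = sc (rf_eval (shifted_binom m l) n) (f ^ (n - (m + l)) * ad_pow f l \<delta> a)"
        by (simp add: scale_of_nat mult.assoc)
    qed
    finally show ?case .
  qed
  then show ?thesis
    unfolding frac_germ_def germ_map.abs_eq germ_scale.abs_eq germ_of_sum[symmetric] germ_of_eq_iff by simp
qed

text \<open>The closed formula \<open>\<epsilon> (a / f ^ m) = (\<Sum>l. ((- m) choose l) * \<epsilon>\<^sup>(\<^sup>l\<^sup>) a / f ^ (m + l))\<close> for the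
recursively defined extension to the localization. In the induction, \<open>[\<epsilon>, f ^ m]\<close> is expanded by
the Leibniz rule with coefficients \<open>m choose j\<close>, and these cancel against \<open>(- m) choose l\<close> by the
Vandermonde identity for \<open>- m + m = 0\<close>.\<close>

lemma ext_frac_germ:
  assumes "\<epsilon> \<in> diff_ops_le sc N"
  shows "frac_germ f (ext_frac f N \<epsilon> (a, m))
    = (\<Sum>l\<le>N. germ_scale sc (const_rf ((- of_nat m) gchoose l)) (frac_germ f (ad_pow f l \<epsilon> a, m + l)))"
  using assms
proof (induction N arbitrary: \<epsilon>)
  case 0
  show ?case by (simp add: one_pCons[symmetric])
next
  case (Suc N)
  define c where "c t = frac_germ f (ad_pow f t \<epsilon> a, m + t)" for t
  define B where "B l = const_rf ((- of_nat m :: 'k) gchoose l)" for l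
  define A where "A l = const_rf ((of_nat m :: 'k) gchoose l)" for l
  have c0: "c t = 0" if "t > Suc N" for t
    using ad_pow_eq_0[OF Suc.prems that, where f = f] unfolding c_def by (simp add: frac_germ_0)
  obtain b k where bk: "ext_frac f N (commutator \<epsilon> (f ^ m)) (a, m) = (b, k)" by fastforce
  have IH: "frac_germ f (b, k) = (\<Sum>l\<le>N. germ_scale sc (B l)
      (frac_germ f (ad_pow f l (commutator \<epsilon> (f ^ m)) a, m + l)))"
    unfolding bk[symmetric] B_def using Suc.IH[OF commutator_mem[OF Suc.prems]] .
  have comm: "commutator \<epsilon> (f ^ m) = (\<lambda>x. \<Sum>j\<in>{1..m}. of_nat (m choose j) * f ^ (m - j) * ad_pow f j \<epsilon> x)"
  proof
    fix x
    have "{..m} = insert 0 {1..m}" by auto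
    then have "\<epsilon> (f ^ m * x) = f ^ m * \<epsilon> x + (\<Sum>j\<in>{1..m}. of_nat (m choose j) * f ^ (m - j) * ad_pow f j \<epsilon> x)"
      unfolding commutator_leibniz[of \<epsilon> f m x] by simp
    then show "commutator \<epsilon> (f ^ m) x = (\<Sum>j\<in>{1..m}. of_nat (m choose j) * f ^ (m - j) * ad_pow f j \<epsilon> x)"
      unfolding commutator_def by simp
  qed
  have ad_germ: "frac_germ f (ad_pow f l (commutator \<epsilon> (f ^ m)) a, m + l + m)
      = (\<Sum>j\<le>Suc N. germ_scale sc (A j) (c (l + j))) - c l" for l
  proof -
    have "frac_germ f (ad_pow f l (commutator \<epsilon> (f ^ m)) a, m + l + m)
       = (\<Sum>j\<in>{1..m}. frac_germ f (of_nat (m choose j) * f ^ (m - j) * ad_pow f (j + l) \<epsilon> a, m + l + m))"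
      unfolding comm ad_pow_sum frac_germ_sum ad_pow_add ..
    also have "\<dots> = (\<Sum>j\<in>{1..m}. germ_scale sc (A j) (c (l + j)))"
    proof (intro sum.cong refl)
      fix j assume j: "j \<in> {1..m}"
      have "frac_germ f (f ^ (m - j) * ad_pow f (j + l) \<epsilon> a, m + l + m)
         = frac_germ f (f ^ (m - j) * ad_pow f (j + l) \<epsilon> a, (m + (l + j)) + (m - j))"
        using j by (simp add: add.assoc)
      also have "\<dots> = c (l + j)" unfolding frac_germ_cancel c_def by (simp add: add.commute)
      finally show "frac_germ f (of_nat (m choose j) * f ^ (m - j) * ad_pow f (j + l) \<epsilon> a, m + l + m)
        = germ_scale sc (A j) (c (l + j))"
        unfolding mult.assoc frac_germ_of_nat_mult A_def by (simp add: binomial_gbinomial)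
    qed
    also have "\<dots> = (\<Sum>j\<in>{..m}. germ_scale sc (A j) (c (l + j))) - c l"
    proof -
      have "{..m} = insert 0 {1..m}" by auto
      then show ?thesis unfolding A_def by (simp add: one_pCons[symmetric])
    qed
    also have "(\<Sum>j\<in>{..m}. germ_scale sc (A j) (c (l + j))) = (\<Sum>j\<in>{..m + Suc N}. germ_scale sc (A j) (c (l + j)))"
      by (rule sum.mono_neutral_left) (auto simp: A_def binomial_gbinomial[symmetric])
    also have "\<dots> = (\<Sum>j\<le>Suc N. germ_scale sc (A j) (c (l + j)))"
      by (rule sum.mono_neutral_right) (auto simp: c0)
    finally show ?thesis .
  qed
  have "frac_germ f (b, k + m) = germ_shift m (frac_germ f (b, k))"
    by (simp add: germ_shift_frac_germ)
  also have "\<dots> = (\<Sum>l\<le>N. germ_scale sc (B l)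
      ((\<Sum>j\<le>Suc N. germ_scale sc (A j) (c (l + j))) - c l))"
    unfolding IH germ_shift_sum B_def germ_shift_scale_const
      germ_shift_frac_germ ad_germ ..
  also have "\<dots> = (\<Sum>l\<le>Suc N. germ_scale sc (B l)
      ((\<Sum>j\<le>Suc N. germ_scale sc (A j) (c (l + j))) - c l))"
  proof -
    have "(\<Sum>j\<le>Suc N. germ_scale sc (A j) (c (Suc N + j))) = (\<Sum>j\<in>{0}. germ_scale sc (A j) (c (Suc N + j)))"
      by (rule sum.mono_neutral_right) (auto simp: c0)
    also have "\<dots> = c (Suc N)" unfolding A_def by (simp add: one_pCons[symmetric])
    finally show ?thesis by (subst (2) sum.atMost_Suc) simp
  qed
  also have "\<dots> = (\<Sum>l\<le>Suc N. \<Sum>j\<le>Suc N. germ_scale sc (B l * A j) (c (l + j)))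
      - (\<Sum>l\<le>Suc N. germ_scale sc (B l) (c l))"
    unfolding germs.scale_right_diff_distrib germs.scale_sum_right germs.scale_scale sum_subtractf ..
  also have "(\<Sum>l\<le>Suc N. \<Sum>j\<le>Suc N. germ_scale sc (B l * A j) (c (l + j)))
      = (\<Sum>t\<le>Suc N. germ_scale sc (\<Sum>l\<le>t. B l * A (t - l)) (c t))"
    by (rule germs.double_sum_diagonals) (rule c0)
  also have "\<dots> = (\<Sum>t\<le>Suc N. germ_scale sc (const_rf (0 gchoose t)) (c t))"
  proof (intro sum.cong refl arg_cong2[where f = "germ_scale sc"])
    fix t
    have csum: "(\<Sum>x\<in>X. const_rf (g x)) = const_rf (\<Sum>x\<in>X. g x :: 'k)" for X :: "nat set" and g
      by (induction X rule: infinite_finite_induct) (auto simp flip: to_fract_add)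
    have "B l * A (t - l) = const_rf (((- of_nat m) gchoose l) * (of_nat m gchoose (t - l)))" for l
      unfolding A_def B_def by (simp flip: to_fract_mult)
    then show "(\<Sum>l\<le>t. B l * A (t - l)) = const_rf (0 gchoose t)"
      using gbinomial_Vandermonde[of "- of_nat m :: 'k" "of_nat m" t] by (simp add: csum atLeast0AtMost)
  qed
  also have "\<dots> = c 0"
  proof -
    have "(\<Sum>t\<le>Suc N. germ_scale sc (const_rf ((0::'k) gchoose t)) (c t))
       = (\<Sum>t\<in>{0}. germ_scale sc (const_rf ((0::'k) gchoose t)) (c t))"
      by (rule sum.mono_neutral_right) (auto simp: gbinomial_0_left)
    then show ?thesis by (simp add: one_pCons[symmetric])
  qed
  finally have bkm: "frac_germ f (b, k + m) = c 0 - (\<Sum>l\<le>Suc N. germ_scale sc (B l) (c l))" .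
  have "frac_germ f (ext_frac f (Suc N) \<epsilon> (a, m)) = frac_germ f (f ^ k * \<epsilon> a - b, k + m)"
    using bk by simp
  also have "\<dots> = c 0 - frac_germ f (b, k + m)"
    unfolding frac_germ_same_denominator_diff add.commute[of k m] frac_germ_cancel c_def by simp
  finally show ?case unfolding bkm c_def B_def by simp
qed

text \<open>Two equivalent fractions become the same pair after expansion by powers of \<open>f\<close>, so it suffices to
compare \<open>(a, m)\<close> and \<open>(f * a, m + 1)\<close>. For these the closed formula reduces the claim to Pascal's
rule.\<close>

lemma ext_frac_cong:
  assumes "\<epsilon> \<in> diff_ops_le sc N" "frac_germ f p = frac_germ f q"
  shows "frac_germ f (ext_frac f N \<epsilon> p) = frac_germ f (ext_frac f N \<epsilon> q)"
proof -
  have step: "frac_germ f (ext_frac f N \<epsilon> (f * a, m + 1)) = frac_germ f (ext_frac f N \<epsilon> (a, m))" for a m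
  proof -
    define c where "c t = frac_germ f (ad_pow f t \<epsilon> a, m + t)" for t
    define B where "B l = const_rf ((- of_nat (m + 1) :: 'k) gchoose l)" for l
    have "frac_germ f (ad_pow f l \<epsilon> (f * a), m + 1 + l) = c l + c (Suc l)" for l
    proof -
      have "ad_pow f l \<epsilon> (f * a) = f ^ 1 * ad_pow f l \<epsilon> a + ad_pow f (Suc l) \<epsilon> a"
        unfolding ad_pow_Suc_apply by simp
      moreover have "frac_germ f (f ^ 1 * ad_pow f l \<epsilon> a, m + 1 + l) = c l"
        unfolding c_def using frac_germ_cancel[of f 1 "ad_pow f l \<epsilon> a" "m + l"] by simp
      ultimately show ?thesis unfolding c_def by (simp add: frac_germ_same_denominator_add)
    qed
    then have "frac_germ f (ext_frac f N \<epsilon> (f * a, m + 1)) = (\<Sum>l\<le>N. germ_scale sc (B l) (c l + c (Suc l)))"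
      unfolding ext_frac_germ[OF assms(1)] B_def by simp
    also have "\<dots> = (\<Sum>l\<le>N. germ_scale sc (B l) (c l)) + (\<Sum>l\<le>N. germ_scale sc (B l) (c (Suc l)))"
      by (simp add: germs.scale_right_distrib sum.distrib)
    also have "(\<Sum>l\<le>N. germ_scale sc (B l) (c (Suc l))) = (\<Sum>l<N. germ_scale sc (B l) (c (Suc l)))"
      using ad_pow_eq_0[OF assms(1), where i = "Suc N" and f = f] unfolding c_def
      by (simp add: lessThan_Suc_atMost[symmetric] frac_germ_0 del: funpow.simps)
    also have "(\<Sum>l\<le>N. germ_scale sc (B l) (c l)) = c 0 + (\<Sum>l<N. germ_scale sc (B (Suc l)) (c (Suc l)))"
      by (subst lessThan_Suc_atMost[symmetric], subst sum.lessThan_Suc_shift)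
        (simp add: B_def one_pCons[symmetric])
    also have "\<dots> + (\<Sum>l<N. germ_scale sc (B l) (c (Suc l)))
        = c 0 + (\<Sum>l<N. germ_scale sc (const_rf ((- of_nat m) gchoose Suc l)) (c (Suc l)))"
    proof -
      have "B (Suc l) + B l = const_rf ((- of_nat m) gchoose Suc l)" for l
        unfolding B_def using gbinomial_Suc_Suc[of "- of_nat (m + 1) :: 'k" l]
        by (simp flip: to_fract_add add: add.commute)
      then show ?thesis
        by (simp add: add.assoc sum.distrib[symmetric] germs.scale_left_distrib[symmetric])
    qed
    also have "\<dots> = (\<Sum>l\<le>N. germ_scale sc (const_rf ((- of_nat m) gchoose l)) (c l))"
      by (subst lessThan_Suc_atMost[symmetric], subst sum.lessThan_Suc_shift)
        (simp add: one_pCons[symmetric])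
    finally show ?thesis unfolding ext_frac_germ[OF assms(1)] c_def .
  qed
  have steps: "frac_germ f (ext_frac f N \<epsilon> (f ^ j * a, m + j)) = frac_germ f (ext_frac f N \<epsilon> (a, m))" for j a m
  proof (induction j)
    case (Suc j)
    show ?case using step[of "f ^ j * a" "m + j"] Suc by (simp add: mult.assoc)
  qed simp
  obtain a m b n where pq: "p = (a, m)" "q = (b, n)" by (cases p, cases q) auto
  obtain l where "f ^ l * (f ^ n * a - f ^ m * b) = 0"
    using assms(2) unfolding frac_germ_eq_iff pq loc_rel_def by blast
  then have "f ^ (l + n) * a = f ^ (l + m) * b" by (simp add: algebra_simps power_add)
  moreover have "m + (l + n) = n + (l + m)" by simp
  ultimately show ?thesis unfolding pq using steps[of "l + n" a m] steps[of "l + m" b n] by metis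
qed

end

section \<open>The localization as a space of germs\<close>

text \<open>The embedding of the localization, at a class by way of an arbitrary representative.\<close>

definition loc_germ :: "'r::comm_ring_1 \<Rightarrow> ('r \<times> nat) set \<Rightarrow> 'r germ" where
  "loc_germ f X = frac_germ f (SOME p. p \<in> X)"

lemma loc_frac_eq: "loc_frac f p = {q. frac_germ f q = frac_germ f p}"
  unfolding loc_frac_def by (auto simp: frac_germ_eq_iff[symmetric])

lemma loc_germ_loc_frac: "loc_germ f (loc_frac f p) = frac_germ f p"
  unfolding loc_germ_def loc_frac_eq by (rule someI2[of _ p]) auto

lemma loc_frac_eq_iff: "loc_frac f p = loc_frac f q \<longleftrightarrow> frac_germ f p = frac_germ f q"
  by (metis loc_germ_loc_frac loc_frac_eq)

lemma UN_loc_frac: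
  assumes "\<And>q. frac_germ f q = frac_germ f p \<Longrightarrow> frac_germ f (g q) = frac_germ f (g p)"
  shows "(\<Union>q\<in>loc_frac f p. loc_frac f (g q)) = loc_frac f (g p)"
  using assms unfolding loc_frac_eq by fastforce

lemma UN2_loc_frac:
  assumes "\<And>p' q'. frac_germ f p' = frac_germ f p \<Longrightarrow> frac_germ f q' = frac_germ f q \<Longrightarrow>
      frac_germ f (g p' q') = frac_germ f (g p q)"
  shows "(\<Union>p'\<in>loc_frac f p. \<Union>q'\<in>loc_frac f q. loc_frac f (g p' q')) = loc_frac f (g p q)"
  using assms unfolding loc_frac_eq by fastforce

lemma carrier_localization: "carrier (localization sc f) = range (loc_frac f)"
  unfolding localization_def quotient_def loc_frac_def by auto

lemma loc_germ_inject:
  assumes "X \<in> carrier (localization sc f)" "Y \<in> carrier (localization sc f)" "loc_germ f X = loc_germ f Y"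
  shows "X = Y"
proof -
  obtain p q where "X = loc_frac f p" "Y = loc_frac f q" using assms(1,2) unfolding carrier_localization by blast
  then show ?thesis using assms(3) by (simp add: loc_germ_loc_frac loc_frac_eq_iff)
qed

lemma frac_germ_mult_cong:
  assumes "frac_germ f (a, m) = frac_germ f (a', m')" "frac_germ f (b, n) = frac_germ f (b', n')"
  shows "frac_germ f (a * b, m + n) = frac_germ f (a' * b', m' + n')"
proof -
  obtain l j where l: "f ^ l * (f ^ m' * a - f ^ m * a') = 0" and j: "f ^ j * (f ^ n' * b - f ^ n * b') = 0"
    using assms unfolding frac_germ_eq_iff loc_rel_def by auto
  have "f ^ (l + j) * (f ^ (m' + n') * (a * b) - f ^ (m + n) * (a' * b'))
     = (f ^ l * (f ^ m' * a - f ^ m * a')) * (f ^ j * (f ^ n' * b))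
     + (f ^ l * (f ^ m * a')) * (f ^ j * (f ^ n' * b - f ^ n * b'))"
    by (simp add: power_add algebra_simps)
  then have "f ^ (l + j) * (f ^ (m' + n') * (a * b) - f ^ (m + n) * (a' * b')) = 0"
    unfolding l j by simp
  then show ?thesis unfolding frac_germ_eq_iff loc_rel_def by blast
qed

lemma frac_germ_add: "frac_germ f (f ^ n * a + f ^ m * b, m + n) = frac_germ f (a, m) + frac_germ f (b, n)"
  unfolding frac_germ_same_denominator_add frac_germ_cancel
  using frac_germ_cancel[of f m b n] by (simp add: add.commute)

lemma loc_mult:
  "loc_frac f (a, m) \<otimes>\<^bsub>localization sc f\<^esub> loc_frac f (b, n) = loc_frac f (a * b, m + n)"
proof -
  have "frac_germ f (fst p * fst q, snd p + snd q) = frac_germ f (a * b, m + n)"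
    if "frac_germ f p = frac_germ f (a, m)" "frac_germ f q = frac_germ f (b, n)" for p q
    using frac_germ_mult_cong[of f "fst p" "snd p" a m "fst q" "snd q" b n] that by simp
  then show ?thesis
    using UN2_loc_frac[of f "(a, m)" "(b, n)" "\<lambda>p q. (fst p * fst q, snd p + snd q)"]
    unfolding localization_def by (simp add: case_prod_beta)
qed

lemma loc_add:
  "loc_frac f (a, m) \<oplus>\<^bsub>localization sc f\<^esub> loc_frac f (b, n) = loc_frac f (f ^ n * a + f ^ m * b, m + n)"
proof -
  have "frac_germ f (f ^ snd q * fst p + f ^ snd p * fst q, snd p + snd q)
      = frac_germ f (f ^ n * a + f ^ m * b, m + n)"
    if "frac_germ f p = frac_germ f (a, m)" "frac_germ f q = frac_germ f (b, n)" for p q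
    using that by (simp add: frac_germ_add)
  then show ?thesis
    using UN2_loc_frac[of f "(a, m)" "(b, n)" "\<lambda>p q. (f ^ snd q * fst p + f ^ snd p * fst q, snd p + snd q)"]
    unfolding localization_def by (simp add: case_prod_beta)
qed

context comm_algebra_char_0
begin

lemma loc_smult: "c \<odot>\<^bsub>localization sc f\<^esub> loc_frac f (a, m) = loc_frac f (sc c a, m)"
proof -
  have "frac_germ f (sc c (fst p), snd p) = frac_germ f (sc c a, m)"
    if "frac_germ f p = frac_germ f (a, m)" for p
    using that by (simp add: frac_germ_scale)
  then show ?thesis
    using UN_loc_frac[of f "(a, m)" "\<lambda>p. (sc c (fst p), snd p)"]
    unfolding localization_def by (simp add: case_prod_beta)
qed

lemma loc_op_loc_frac:
  assumes "\<delta> \<in> diff_ops sc"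
  shows "loc_op sc f \<delta> (loc_frac f p) = loc_frac f (ext_frac f (diff_order sc \<delta>) \<delta> p)"
  unfolding loc_op_def by (rule UN_loc_frac) (rule ext_frac_cong[OF diff_order_mem[OF assms]])

lemma loc_germ_add:
  assumes "X \<in> carrier (localization sc f)" "Y \<in> carrier (localization sc f)"
  shows "X \<oplus>\<^bsub>localization sc f\<^esub> Y \<in> carrier (localization sc f)"
    and "loc_germ f (X \<oplus>\<^bsub>localization sc f\<^esub> Y) = loc_germ f X + loc_germ f Y"
  using assms unfolding carrier_localization by (auto simp: loc_add loc_germ_loc_frac frac_germ_add)

lemma loc_germ_smult:
  assumes "X \<in> carrier (localization sc f)"
  shows "c \<odot>\<^bsub>localization sc f\<^esub> X \<in> carrier (localization sc f)"
    and "loc_germ f (c \<odot>\<^bsub>localization sc f\<^esub> X) = germ_scale sc (const_rf c) (loc_germ f X)"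
  using assms unfolding carrier_localization by (auto simp: loc_smult loc_germ_loc_frac frac_germ_scale)

text \<open>The operator \<open>\<delta>\<close> expands at \<open>(a / f ^ m) f\<^sup>s = a f\<^sup>s\<^sup>-\<^sup>m\<close> with coefficients
\<open>(s - m) choose t\<close>. The twisted action reaches the same terms in two stages, with coefficients
\<open>s choose i\<close> from \<open>f\<^sup>s\<close> and \<open>(- m) choose l\<close> from the extension of \<open>\<delta>\<^sup>(\<^sup>i\<^sup>)\<close>; the two agree by the
Vandermonde identity.\<close>

lemma twisted_action_germ:
  assumes \<delta>: "\<delta> \<in> diff_ops sc" and u: "u \<in> carrier (localization sc f)"
  shows "(\<Sum>i\<le>diff_order sc \<delta>. germ_scale sc (binom_s i)
      (loc_germ f (loc_frac f (1, i) \<otimes>\<^bsub>localization sc f\<^esub> loc_op sc f (ad_pow f i \<delta>) u)))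
    = germ_map \<delta> (loc_germ f u)"
proof -
  obtain a m where u: "u = loc_frac f (a, m)" using u unfolding carrier_localization by auto
  define N where "N = diff_order sc \<delta>"
  have N: "\<delta> \<in> diff_ops_le sc N" unfolding N_def by (rule diff_order_mem[OF \<delta>])
  define c where "c t = frac_germ f (ad_pow f t \<delta> a, m + t)" for t
  have c0: "c t = 0" if "t > N" for t
    unfolding c_def ad_pow_eq_0[OF N that] by (rule frac_germ_0)
  define B where "B l = const_rf ((- of_nat m :: 'k) gchoose l)" for l
  have summand: "loc_germ f (loc_frac f (1, i) \<otimes>\<^bsub>localization sc f\<^esub> loc_op sc f (ad_pow f i \<delta>) u)
      = (\<Sum>l\<le>N. germ_scale sc (B l) (c (i + l)))" for i
  proof -
    define \<epsilon> where "\<epsilon> = ad_pow f i \<delta>"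
    have \<epsilon>: "\<epsilon> \<in> diff_ops sc" unfolding \<epsilon>_def by (rule ad_pow_diff_ops[OF \<delta>])
    define M where "M = diff_order sc \<epsilon>"
    have M: "\<epsilon> \<in> diff_ops_le sc M" unfolding M_def by (rule diff_order_mem[OF \<epsilon>])
    obtain b k where bk: "ext_frac f M \<epsilon> (a, m) = (b, k)" by fastforce
    have "loc_germ f (loc_frac f (1, i) \<otimes>\<^bsub>localization sc f\<^esub> loc_op sc f \<epsilon> u) = frac_germ f (b, i + k)"
      unfolding u loc_op_loc_frac[OF \<epsilon>] M_def[symmetric] bk loc_mult loc_germ_loc_frac by simp
    also have "\<dots> = germ_shift i (frac_germ f (ext_frac f M \<epsilon> (a, m)))"
      unfolding bk germ_shift_frac_germ by (simp add: add.commute)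
    also have "\<dots> = (\<Sum>l\<le>M. germ_scale sc (B l) (c (i + l)))"
      unfolding ext_frac_germ[OF M] germ_shift_sum germ_shift_scale_const germ_shift_frac_germ B_def c_def
      by (simp add: \<epsilon>_def ad_pow_add ac_simps)
    also have "\<dots> = (\<Sum>l\<le>M + N. germ_scale sc (B l) (c (i + l)))"
    proof (rule sum.mono_neutral_left)
      show "\<forall>l\<in>{..M + N} - {..M}. germ_scale sc (B l) (c (i + l)) = 0"
      proof
        fix l assume "l \<in> {..M + N} - {..M}"
        then have "ad_pow f l \<epsilon> = (\<lambda>_. 0)" using ad_pow_eq_0[OF M] by simp
        then have "ad_pow f (i + l) \<delta> = (\<lambda>_. 0)" unfolding \<epsilon>_def ad_pow_add .
        then show "germ_scale sc (B l) (c (i + l)) = 0" unfolding c_def by (simp add: frac_germ_0)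
      qed
    qed auto
    also have "\<dots> = (\<Sum>l\<le>N. germ_scale sc (B l) (c (i + l)))"
      by (rule sum.mono_neutral_right) (auto simp: c0)
    finally show ?thesis unfolding \<epsilon>_def .
  qed
  have "(\<Sum>i\<le>N. germ_scale sc (binom_s i)
      (loc_germ f (loc_frac f (1, i) \<otimes>\<^bsub>localization sc f\<^esub> loc_op sc f (ad_pow f i \<delta>) u)))
     = (\<Sum>i\<le>N. \<Sum>l\<le>N. germ_scale sc (shifted_binom 0 i * B l) (c (i + l)))"
    unfolding summand binom_s_eq by (simp add: germs.scale_sum_right)
  also have "\<dots> = (\<Sum>t\<le>N. germ_scale sc (\<Sum>i\<le>t. shifted_binom 0 i * B (t - i)) (c t))"
    by (rule germs.double_sum_diagonals) (rule c0)
  also have "\<dots> = (\<Sum>t\<le>N. germ_scale sc (shifted_binom m t) (c t))"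
    unfolding B_def shifted_binom_Vandermonde ..
  also have "\<dots> = germ_map \<delta> (loc_germ f u)"
    unfolding u loc_germ_loc_frac germ_map_frac_germ[OF N] c_def ..
  finally show ?thesis unfolding N_def .
qed

end

section \<open>Evaluating tensors\<close>

lemma module_frag_cmul: "Modules.module (frag_cmul :: int \<Rightarrow> ('a \<Rightarrow>\<^sub>0 int) \<Rightarrow> _)"
  by unfold_locales (auto simp: frag_cmul_distrib frag_cmul_distrib2)

interpretation frag: Modules.module "frag_cmul :: int \<Rightarrow> ('a \<Rightarrow>\<^sub>0 int) \<Rightarrow> 'a \<Rightarrow>\<^sub>0 int"
  by (rule module_frag_cmul)

text \<open>The additive map on the free abelian group that sends the pair of \<open>u\<close> and \<open>p\<close> to \<open>p * \<gamma> u\<close>. It is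
used both for elements of the module and, with \<open>\<gamma> \<delta> = \<delta> v\<close>, for scalars acting on a fixed vector \<open>v\<close>.\<close>

definition (in vector_space) tensor_eval :: "('u \<Rightarrow> 'b) \<Rightarrow> ('u \<times> 'a \<Rightarrow>\<^sub>0 int) \<Rightarrow> 'b" where
  "tensor_eval \<gamma> x = (\<Sum>k\<in>Poly_Mapping.keys x. scale (of_int (Poly_Mapping.lookup x k) * snd k) (\<gamma> (fst k)))"

context vector_space
begin

lemma tensor_eval_superset:
  assumes "finite A" "Poly_Mapping.keys x \<subseteq> A"
  shows "tensor_eval \<gamma> x = (\<Sum>k\<in>A. scale (of_int (Poly_Mapping.lookup x k) * snd k) (\<gamma> (fst k)))"
  unfolding tensor_eval_def using assms
  by (intro sum.mono_neutral_left) (auto simp: in_keys_iff)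

lemma tensor_eval_add: "tensor_eval \<gamma> (x + y) = tensor_eval \<gamma> x + tensor_eval \<gamma> y"
proof -
  let ?A = "Poly_Mapping.keys x \<union> Poly_Mapping.keys y"
  have "Poly_Mapping.keys (x + y) \<subseteq> ?A" by (rule Poly_Mapping.keys_add)
  then show ?thesis
    by (subst (1 2 3) tensor_eval_superset[of ?A])
      (auto simp: lookup_add distrib_right scale_left_distrib sum.distrib)
qed

lemma tensor_eval_0: "tensor_eval \<gamma> 0 = 0"
  by (simp add: tensor_eval_def)

lemma tensor_eval_cmul: "tensor_eval \<gamma> (frag_cmul c x) = scale (of_int c) (tensor_eval \<gamma> x)"
  by (subst tensor_eval_superset[of "Poly_Mapping.keys x"])
    (auto simp: keys_cmul tensor_eval_def scale_sum_right mult.assoc)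

lemma tensor_eval_uminus: "tensor_eval \<gamma> (- x) = - tensor_eval \<gamma> x"
  using tensor_eval_cmul[of \<gamma> "-1" x] by simp

lemma tensor_eval_diff: "tensor_eval \<gamma> (x - y) = tensor_eval \<gamma> x - tensor_eval \<gamma> y"
  using tensor_eval_add[of \<gamma> x "- y"] by (simp add: tensor_eval_uminus)

lemma tensor_eval_of: "tensor_eval \<gamma> (frag_of (u, p)) = scale p (\<gamma> u)"
  by (simp add: tensor_eval_def)

lemma tensor_eval_sum: "tensor_eval \<gamma> (\<Sum>i\<in>I. x i) = (\<Sum>i\<in>I. tensor_eval \<gamma> (x i))"
  by (induction I rule: infinite_finite_induct) (auto simp: tensor_eval_add tensor_eval_0)

lemma tensor_eval_frag_extend:
  assumes "\<And>u p. (u, p) \<in> Poly_Mapping.keys x \<Longrightarrow> tensor_eval \<gamma> (h (u, p)) = scale p (\<gamma>' u)"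
  shows "tensor_eval \<gamma> (frag_extend h x) = tensor_eval \<gamma>' x"
  unfolding frag_extend_def tensor_eval_sum tensor_eval_cmul unfolding tensor_eval_def[of \<gamma>']
proof (intro sum.cong refl)
  fix k assume "k \<in> Poly_Mapping.keys x"
  then show "scale (of_int (Poly_Mapping.lookup x k)) (tensor_eval \<gamma> (h k))
     = scale (of_int (Poly_Mapping.lookup x k) * snd k) (\<gamma>' (fst k))"
    using assms[of "fst k" "snd k"] by simp
qed

end

lemma tensor_eval_span:
  fixes scale :: "'k::field ratfun \<Rightarrow> 'w::ab_group_add \<Rightarrow> 'w" and V :: "('k, 'v, 'd) module_scheme"
  assumes "vector_space scale"
    and add: "\<And>v w. v \<in> carrier V \<Longrightarrow> w \<in> carrier V \<Longrightarrow> \<gamma> (v \<oplus>\<^bsub>V\<^esub> w) = \<gamma> v + \<gamma> w"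
    and smult: "\<And>c v. v \<in> carrier V \<Longrightarrow> \<gamma> (c \<odot>\<^bsub>V\<^esub> v) = scale (const_rf c) (\<gamma> v)"
    and x: "x \<in> frag.span (tensor_gens V)"
  shows "vector_space.tensor_eval scale \<gamma> x = 0"
proof -
  interpret vector_space scale by fact
  show ?thesis
    using x
  proof (induction x rule: frag.span_induct_alt)
    case base
    show ?case by (rule tensor_eval_0)
  next
    case (step c x y)
    from step.hyps have "tensor_eval \<gamma> x = 0"
      unfolding tensor_gens_def
      by (auto simp: tensor_eval_diff tensor_eval_of add smult scale_left_distrib scale_right_distrib mult.commute)
    then show ?case using step.IH by (simp add: tensor_eval_add tensor_eval_cmul)
  qed
qed

context comm_algebra_char_0
begin

text \<open>The powers of \<open>s\<close> are linearly independent over the localization. With a common denominator the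
relation reads \<open>f ^ (n - M) * (\<Sum>e<E. n ^ e * z e) = 0\<close> for large \<open>n\<close>; only \<open>E\<close> values of
\<open>n\<close> are needed, and one power of \<open>f\<close> serves them all.\<close>

lemma loc_germs_independent:
  assumes y: "\<And>e. e < E \<Longrightarrow> y e \<in> carrier (localization sc f)"
    and zero: "(\<Sum>e<E. germ_scale sc (to_fract (monom 1 e)) (loc_germ f (y e))) = 0"
    and e: "e < E"
  shows "loc_germ f (y e) = 0"
proof -
  have "\<exists>a m. y e = loc_frac f (a, m)" if "e < E" for e
    using y[OF that] unfolding carrier_localization by auto
  then obtain a m where am: "\<And>e. e < E \<Longrightarrow> y e = loc_frac f (a e, m e)" by metis
  define M where "M = (\<Sum>e<E. m e)"
  define z where "z e = f ^ (M - m e) * a e" for e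
  have yz: "loc_germ f (y e) = frac_germ f (z e, M)" if "e < E" for e
  proof -
    have "m e \<le> M" unfolding M_def using that by (intro member_le_sum) auto
    then show ?thesis
      using frac_germ_cancel[of f "M - m e" "a e" "m e"] by (simp add: am[OF that] loc_germ_loc_frac z_def)
  qed
  have "(\<Sum>e<E. germ_scale sc (to_fract (monom 1 e)) (frac_germ f (z e, M))) = 0"
    using zero yz by simp
  then have ev: "\<forall>\<^sub>F n in sequentially. (\<Sum>e<E. sc (rf_eval (to_fract (monom 1 e)) n) (f ^ (n - M) * z e)) = 0"
    unfolding frac_germ_def germ_scale.abs_eq germ_of_sum[symmetric] zero_germ.abs_eq germ_of_eq_iff by simp
  have "\<forall>\<^sub>F n in sequentially. \<forall>e\<in>{..<E}. rf_eval (to_fract (monom 1 e)) n = (of_nat n ^ e :: 'k)"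
  proof (intro eventually_ball_finite ballI)
    fix e
    show "\<forall>\<^sub>F n in sequentially. rf_eval (to_fract (monom 1 e)) n = (of_nat n ^ e :: 'k)"
      using rf_eval_to_fract[of "monom 1 e :: 'k poly"] by (simp add: poly_monom)
  qed simp
  then have "\<forall>\<^sub>F n in sequentially. (\<Sum>e<E. sc (of_nat n ^ e) (f ^ (n - M) * z e)) = 0"
    using ev by eventually_elim simp
  then obtain N where N: "\<And>n. n \<ge> N \<Longrightarrow> (\<Sum>e<E. sc (of_nat n ^ e) (f ^ (n - M) * z e)) = 0"
    unfolding eventually_sequentially by blast
  \<comment> \<open>\<open>f ^ L\<close> is a multiple of \<open>f ^ (n - M)\<close> for the \<open>E\<close> values \<open>n = N, \<dots>, N + E - 1\<close>\<close>
  define L where "L = N + E"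
  have "f ^ L * z e = 0"
  proof (rule vandermonde_independence[where N = N and E = E and w = "\<lambda>e. f ^ L * z e"])
    show "inj (of_nat :: nat \<Rightarrow> 'k)" by (rule inj_of_nat)
    fix n assume n: "N \<le> n" "n < N + E"
    have L: "L = (L - (n - M)) + (n - M)" using n unfolding L_def by simp
    have "sc (of_nat n ^ e) (f ^ L * z e) = f ^ (L - (n - M)) * sc (of_nat n ^ e) (f ^ (n - M) * z e)" for e
      by (subst L) (metis (no_types, lifting) power_add sc_mult mult.commute mult.assoc)
    then have "(\<Sum>e<E. sc (of_nat n ^ e) (f ^ L * z e)) = f ^ (L - (n - M)) * (\<Sum>e<E. sc (of_nat n ^ e) (f ^ (n - M) * z e))"
      by (simp add: sum_distrib_left)
    then show "(\<Sum>e<E. sc (of_nat n ^ e) (f ^ L * z e)) = 0" using N[OF n(1)] by simp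
  qed (rule e)
  then have "frac_germ f (z e, M) = 0"
    using frac_germ_cancel[of f L "z e" M] by (simp add: frac_germ_0)
  then show ?thesis using yz[OF e] by simp
qed

text \<open>The germ determines the tensor. Modulo the relations of the tensor product every tensor can be
written as \<open>\<Sum>e<E. y e \<otimes> (s ^ e / h)\<close>, where \<open>h\<close> is a common denominator; if its germ is zero, all
\<open>y e\<close> vanish by independence of the powers of \<open>s\<close>.\<close>

lemma tensor_eval_eq_0_imp_span:
  assumes x: "x \<in> tensor_reps (localization sc f)" and zero: "germs.tensor_eval (loc_germ f) x = 0"
  shows "x \<in> frag.span (tensor_gens (localization sc f))"
proof -
  define V where "V = localization sc f"
  define S where "S = frag.span (tensor_gens V)"
  have Sadd: "a + b \<in> S" and Sdiff: "a - b \<in> S" and Sneg: "- a \<in> S" if "a \<in> S" "b \<in> S" for a b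
    using that unfolding S_def by (auto intro: frag.span_add frag.span_diff frag.span_neg)
  have Ssum: "(\<Sum>i\<in>I. g i) \<in> S" if "\<And>i. i \<in> I \<Longrightarrow> g i \<in> S" for I :: "nat set" and g
    using that unfolding S_def by (rule frag.span_sum)
  have g1: "frag_of (v \<oplus>\<^bsub>V\<^esub> w, p) - frag_of (v, p) - frag_of (w, p) \<in> S" if "v \<in> carrier V" "w \<in> carrier V" for v w p
    using that unfolding S_def tensor_gens_def by (intro frag.span_base) blast
  have g2: "frag_of (v, p + q) - frag_of (v, p) - frag_of (v, q) \<in> S" if "v \<in> carrier V" for v p q
    using that unfolding S_def tensor_gens_def by (intro frag.span_base) blast
  have g3: "frag_of (c \<odot>\<^bsub>V\<^esub> v, p) - frag_of (v, const_rf c * p) \<in> S" if "v \<in> carrier V" for c v p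
    using that unfolding S_def tensor_gens_def by (intro frag.span_base) blast
  have z2: "frag_of (v, 0) \<in> S" if "v \<in> carrier V" for v
    using Sneg[OF g2[OF that, of 0 0]] g2[OF that, of 0 0] by simp
  have sum2: "frag_of (v, \<Sum>i\<in>I. p i) - (\<Sum>i\<in>I. frag_of (v, p i)) \<in> S"
    if v: "v \<in> carrier V" and I: "finite I" for v p and I :: "nat set"
    using I
  proof (induction I rule: finite_induct)
    case (insert i I)
    have "frag_of (v, \<Sum>i\<in>insert i I. p i) - (\<Sum>i\<in>insert i I. frag_of (v, p i))
      = (frag_of (v, p i + (\<Sum>i\<in>I. p i)) - frag_of (v, p i) - frag_of (v, \<Sum>i\<in>I. p i))
        + (frag_of (v, \<Sum>i\<in>I. p i) - (\<Sum>i\<in>I. frag_of (v, p i)))"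
      using insert.hyps by simp
    then show ?case using Sadd[OF g2[OF v] insert.IH] by (simp only:)
  qed (use z2[OF v] in simp)
  obtain h where h: "h \<noteq> 0" "\<And>k. k \<in> Poly_Mapping.keys x \<Longrightarrow> \<exists>q. to_fract h * snd k = to_fract q"
    using common_denominator[of "snd ` Poly_Mapping.keys x"] by auto
  then obtain q where q: "\<And>k. k \<in> Poly_Mapping.keys x \<Longrightarrow> to_fract h * snd k = to_fract (q k)" by metis
  \<comment> \<open>one bound for the degrees of all numerators, so that all tensors are brought to the same form\<close>
  define E where "E = Suc (\<Sum>k\<in>Poly_Mapping.keys x. degree (q k))"
  have qE: "degree (q k) < E" if "k \<in> Poly_Mapping.keys x" for k
    unfolding E_def less_Suc_eq_le using that by (intro member_le_sum) auto
  define w where "w e = (to_fract (monom 1 e) / to_fract h :: 'k ratfun)" for e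
  have h': "to_fract h \<noteq> 0" using h(1) by simp
  have "\<exists>y. (\<forall>e. y e \<in> carrier V) \<and> x - (\<Sum>e<E. frag_of (y e, w e)) \<in> S"
  proof (rule frag_induction[of x "Poly_Mapping.keys x"])
    define o' where "o' = loc_frac f (0, 0)"
    have o': "o' \<in> carrier V" unfolding V_def o'_def carrier_localization by simp
    have "o' \<oplus>\<^bsub>V\<^esub> o' = o'" unfolding o'_def V_def loc_add by simp
    then have "frag_of (o', p) \<in> S" for p using Sneg[OF g1[OF o' o', of p]] g1[OF o' o', of p] by simp
    then show "\<exists>y. (\<forall>e. y e \<in> carrier V) \<and> 0 - (\<Sum>e<E. frag_of (y e, w e)) \<in> S"
      using o' Sneg[OF Ssum, of "{..<E}" "\<lambda>e. frag_of (o', w e)"]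
      by (intro exI[of _ "\<lambda>_. o'"]) (auto simp: Sneg)
  next
    fix k assume k: "k \<in> Poly_Mapping.keys x"
    obtain u p where up: "k = (u, p)" by (cases k)
    have u: "u \<in> carrier V" using x k unfolding tensor_reps_def V_def up by auto
    define y where "y e = coeff (q k) e \<odot>\<^bsub>V\<^esub> u" for e
    have y: "y e \<in> carrier V" for e unfolding y_def V_def using u loc_germ_smult(1) unfolding V_def by blast
    have "q k = (\<Sum>e<E. monom (coeff (q k) e) e)"
      using qE[OF k] by (intro poly_eqI) (simp add: coeff_sum sum.delta coeff_eq_0 cong: if_cong)
    then have "to_fract (q k) = (\<Sum>e<E. to_fract (monom (coeff (q k) e) e))" by (metis to_fract_sum)
    also have "\<dots> = (\<Sum>e<E. const_rf (coeff (q k) e) * to_fract (monom 1 e))"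
      by (simp flip: to_fract_mult add: smult_monom)
    finally have "p = (\<Sum>e<E. const_rf (coeff (q k) e) * to_fract (monom 1 e)) / to_fract h"
      using q[OF k] h' up by (simp add: field_simps)
    also have "\<dots> = (\<Sum>e<E. const_rf (coeff (q k) e) * w e)"
      unfolding w_def by (simp add: sum_divide_distrib)
    finally have p: "p = (\<Sum>e<E. const_rf (coeff (q k) e) * w e)" .
    have "frag_of k - (\<Sum>e<E. frag_of (y e, w e))
       = (frag_of (u, p) - (\<Sum>e<E. frag_of (u, const_rf (coeff (q k) e) * w e)))
        - (\<Sum>e<E. frag_of (y e, w e) - frag_of (u, const_rf (coeff (q k) e) * w e))"
      unfolding up sum_subtractf by simp
    also have "\<dots> \<in> S"
      unfolding p y_def by (intro Sdiff sum2 Ssum g3 u) auto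
    finally show "\<exists>y. (\<forall>e. y e \<in> carrier V) \<and> frag_of k - (\<Sum>e<E. frag_of (y e, w e)) \<in> S"
      using y by blast
  next
    fix a b
    assume "\<exists>y. (\<forall>e. y e \<in> carrier V) \<and> a - (\<Sum>e<E. frag_of (y e, w e)) \<in> S"
      "\<exists>y. (\<forall>e. y e \<in> carrier V) \<and> b - (\<Sum>e<E. frag_of (y e, w e)) \<in> S"
    then obtain y y' where y: "\<And>e. y e \<in> carrier V" "a - (\<Sum>e<E. frag_of (y e, w e)) \<in> S"
      and y': "\<And>e. y' e \<in> carrier V" "b - (\<Sum>e<E. frag_of (y' e, w e)) \<in> S" by blast
    define n where "n e = (- 1) \<odot>\<^bsub>V\<^esub> y' e" for e
    have n: "n e \<in> carrier V" for e unfolding n_def V_def using y'(1) loc_germ_smult(1) unfolding V_def by blast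
    define Y where "Y e = y e \<oplus>\<^bsub>V\<^esub> n e" for e
    have Y: "Y e \<in> carrier V" for e unfolding Y_def V_def using y(1) n loc_germ_add(1) unfolding V_def by blast
    have nS: "frag_of (n e, w e) + frag_of (y' e, w e) \<in> S" for e
    proof -
      have "const_rf (- 1 :: 'k) = - 1"
      proof -
        have "[:- 1 :: 'k:] = - 1" by (simp add: one_pCons)
        then show ?thesis by (simp only: to_fract_uminus to_fract_1)
      qed
      then have n1: "frag_of (n e, w e) - frag_of (y' e, - w e) \<in> S"
        using g3[OF y'(1), of "-1" e "w e"] unfolding n_def by simp
      have n2: "frag_of (y' e, 0) - frag_of (y' e, w e) - frag_of (y' e, - w e) \<in> S"
        using g2[OF y'(1), of e "w e" "- w e"] by simp
      show ?thesis using Sadd[OF n1 Sdiff[OF z2[OF y'(1)[of e]] n2]] by (simp add: algebra_simps)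
    qed
    have gY: "frag_of (Y e, w e) - frag_of (y e, w e) - frag_of (n e, w e) \<in> S" for e
      unfolding Y_def by (rule g1[OF y(1) n])
    have "(a - b) - (\<Sum>e<E. frag_of (Y e, w e))
       = (a - (\<Sum>e<E. frag_of (y e, w e))) - (b - (\<Sum>e<E. frag_of (y' e, w e)))
         - (\<Sum>e<E. (frag_of (Y e, w e) - frag_of (y e, w e) - frag_of (n e, w e))
             + (frag_of (n e, w e) + frag_of (y' e, w e)))"
      by (simp add: sum.distrib sum_subtractf)
    also have "\<dots> \<in> S"
      by (rule Sdiff[OF Sdiff[OF y(2) y'(2)] Ssum[OF Sadd[OF gY nS]]])
    finally show "\<exists>y. (\<forall>e. y e \<in> carrier V) \<and> a - b - (\<Sum>e<E. frag_of (y e, w e)) \<in> S"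
      using Y by blast
  qed auto
  then obtain y where y: "\<And>e. y e \<in> carrier V" "x - (\<Sum>e<E. frag_of (y e, w e)) \<in> S" by blast
  have "germs.tensor_eval (loc_germ f) (x - (\<Sum>e<E. frag_of (y e, w e))) = 0"
    using y(2) unfolding S_def V_def
    by (intro tensor_eval_span) (auto simp: loc_germ_add loc_germ_smult germs.vector_space_axioms)
  then have "(\<Sum>e<E. germ_scale sc (w e) (loc_germ f (y e))) = 0"
    by (simp add: germs.tensor_eval_diff germs.tensor_eval_sum germs.tensor_eval_of zero)
  then have "germ_scale sc (to_fract h) (\<Sum>e<E. germ_scale sc (w e) (loc_germ f (y e))) = 0" by simp
  then have "(\<Sum>e<E. germ_scale sc (to_fract (monom 1 e)) (loc_germ f (y e))) = 0"
    unfolding germs.scale_sum_right w_def using h' by simp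
  then have y0: "loc_germ f (y e) = 0" if "e < E" for e
    using loc_germs_independent[of E y f e] y(1) that unfolding V_def by blast
  have "frag_of (y e, w e) \<in> S" if "e < E" for e
  proof -
    have "y e \<oplus>\<^bsub>V\<^esub> y e = y e"
    proof (rule loc_germ_inject)
      show "loc_germ f (y e \<oplus>\<^bsub>V\<^esub> y e) = loc_germ f (y e)"
        using y(1) y0[OF that] unfolding V_def by (simp add: loc_germ_add)
    qed (use y(1) loc_germ_add(1) in \<open>auto simp: V_def\<close>)
    then have "- frag_of (y e, w e) \<in> S" using g1[OF y(1) y(1), of e e "w e"] by simp
    then show ?thesis using Sneg by fastforce
  qed
  then have "(x - (\<Sum>e<E. frag_of (y e, w e))) + (\<Sum>e<E. frag_of (y e, w e)) \<in> S"
    by (intro Sadd y(2) Ssum) auto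
  then show ?thesis unfolding S_def V_def by simp
qed

lemma germ_map_right_add:
  assumes "Vector_Spaces.linear sc sc \<delta>"
  shows "germ_map \<delta> (y + z) = germ_map \<delta> y + germ_map \<delta> z"
proof -
  interpret Vector_Spaces.linear sc sc \<delta> by fact
  obtain x x' where y: "y = germ_of x" "z = germ_of x'" by (metis germ_of_cases)
  show ?thesis unfolding y germ_map.abs_eq plus_germ.abs_eq by (simp add: add)
qed

lemma germ_map_germ_scale:
  assumes "Vector_Spaces.linear sc sc \<delta>"
  shows "germ_map \<delta> (germ_scale sc p y) = germ_scale sc p (germ_map \<delta> y)"
proof -
  interpret Vector_Spaces.linear sc sc \<delta> by fact
  obtain x where y: "y = germ_of x" by (metis germ_of_cases)
  show ?thesis unfolding y germ_map.abs_eq germ_scale.abs_eq by (simp add: scale)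
qed

lemma germ_map_0:
  assumes "Vector_Spaces.linear sc sc \<delta>"
  shows "germ_map \<delta> 0 = 0"
  using germ_map_germ_scale[OF assms, of 0 0] by simp

lemma germ_map_sum:
  assumes "Vector_Spaces.linear sc sc \<delta>"
  shows "germ_map \<delta> (\<Sum>i\<in>I. y i) = (\<Sum>i\<in>I. germ_map \<delta> (y i))"
  by (induction I rule: infinite_finite_induct) (auto simp: germ_map_0[OF assms] germ_map_right_add[OF assms])

section \<open>Submodules as stable spaces of germs\<close>

abbreviation tensor_germ :: "'r \<Rightarrow> (('r \<times> nat) set \<times> 'k ratfun \<Rightarrow>\<^sub>0 int) \<Rightarrow> 'r germ" where
  "tensor_germ f \<equiv> germs.tensor_eval (loc_germ f)"

lemma tensor_rel_iff:
  assumes "x \<in> tensor_reps (localization sc f)" "y \<in> tensor_reps (localization sc f)"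
  shows "(x, y) \<in> tensor_rel (localization sc f) \<longleftrightarrow> tensor_germ f x = tensor_germ f y"
proof
  assume "(x, y) \<in> tensor_rel (localization sc f)"
  then have "tensor_germ f (x - y) = 0"
    unfolding tensor_rel_def
    by (intro tensor_eval_span) (auto simp: loc_germ_add loc_germ_smult germs.vector_space_axioms)
  then show "tensor_germ f x = tensor_germ f y" by (simp add: germs.tensor_eval_diff)
next
  assume "tensor_germ f x = tensor_germ f y"
  moreover have "x - y \<in> tensor_reps (localization sc f)"
    using assms keys_diff[of x y] unfolding tensor_reps_def by blast
  ultimately have "x - y \<in> frag.span (tensor_gens (localization sc f))"
    by (intro tensor_eval_eq_0_imp_span) (auto simp: germs.tensor_eval_diff)
  then show "(x, y) \<in> tensor_rel (localization sc f)" unfolding tensor_rel_def using assms by blast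
qed

lemma tensor_class_eq:
  assumes "x \<in> tensor_reps (localization sc f)"
  shows "tensor_class (localization sc f) x
    = {y \<in> tensor_reps (localization sc f). tensor_germ f y = tensor_germ f x}"
  unfolding tensor_class_def using assms tensor_rel_iff[OF assms]
  by (auto simp: tensor_rel_def)

text \<open>The embedding of \<open>R\<^sub>f(s) f\<^sup>s\<close>, at a class by way of an arbitrary representative.\<close>

definition mod_germ :: "'r \<Rightarrow> (('r \<times> nat) set \<times> 'k ratfun \<Rightarrow>\<^sub>0 int) set \<Rightarrow> 'r germ" where
  "mod_germ f X = tensor_germ f (SOME x. x \<in> X)"

lemma mod_germ_tensor_class:
  assumes "x \<in> tensor_reps (localization sc f)"
  shows "mod_germ f (tensor_class (localization sc f) x) = tensor_germ f x"
  unfolding mod_germ_def tensor_class_eq[OF assms] by (rule someI2[of _ x]) (use assms in auto)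

lemma carrier_fs_module:
  "carrier (fs_module sc f) = tensor_class (localization sc f) ` tensor_reps (localization sc f)"
  unfolding fs_module_def ratfun_ext_def Let_def tensor_class_def quotient_def by auto

lemma mod_germ_inject:
  assumes "X \<in> carrier (fs_module sc f)" "Y \<in> carrier (fs_module sc f)" "mod_germ f X = mod_germ f Y"
  shows "X = Y"
proof -
  obtain x y where x: "X = tensor_class (localization sc f) x" "x \<in> tensor_reps (localization sc f)"
    and y: "Y = tensor_class (localization sc f) y" "y \<in> tensor_reps (localization sc f)"
    using assms(1,2) unfolding carrier_fs_module by blast
  then have "tensor_germ f x = tensor_germ f y" using assms(3) by (simp add: mod_germ_tensor_class)
  then show ?thesis by (simp add: x y tensor_class_eq)
qed

lemma reps_add: "\<lbrakk>x \<in> tensor_reps V; y \<in> tensor_reps V\<rbrakk> \<Longrightarrow> x + y \<in> tensor_reps V"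
  using Poly_Mapping.keys_add[of x y] unfolding tensor_reps_def by blast

lemma reps_uminus: "x \<in> tensor_reps V \<Longrightarrow> - x \<in> tensor_reps V"
  unfolding tensor_reps_def by simp

lemma reps_0: "0 \<in> tensor_reps V"
  unfolding tensor_reps_def by simp

lemma UN_UN_eq_UN_Times: "(\<Union>x\<in>X. \<Union>y\<in>Y. h x y) = (\<Union>i\<in>X \<times> Y. h (fst i) (snd i))"
  by force

lemma UN_tensor_class:
  assumes "I \<noteq> {}" "\<And>i. i \<in> I \<Longrightarrow> g i \<in> tensor_reps (localization sc f)"
    "\<And>i. i \<in> I \<Longrightarrow> tensor_germ f (g i) = tensor_germ f z" "z \<in> tensor_reps (localization sc f)"
  shows "(\<Union>i\<in>I. tensor_class (localization sc f) (g i)) = tensor_class (localization sc f) z"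
proof -
  have "tensor_class (localization sc f) (g i) = tensor_class (localization sc f) z" if "i \<in> I" for i
    using assms(2,3)[OF that] assms(4) by (simp add: tensor_class_eq)
  then show ?thesis using assms(1) by auto
qed

lemma fs_module_zero: "\<zero>\<^bsub>fs_module sc f\<^esub> \<in> carrier (fs_module sc f)" "mod_germ f \<zero>\<^bsub>fs_module sc f\<^esub> = 0"
proof -
  have z: "\<zero>\<^bsub>fs_module sc f\<^esub> = tensor_class (localization sc f) 0"
    unfolding fs_module_def ratfun_ext_def Let_def by simp
  show "\<zero>\<^bsub>fs_module sc f\<^esub> \<in> carrier (fs_module sc f)" unfolding z carrier_fs_module by (simp add: reps_0)
  show "mod_germ f \<zero>\<^bsub>fs_module sc f\<^esub> = 0"
    unfolding z by (simp add: mod_germ_tensor_class reps_0 germs.tensor_eval_0)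
qed

lemma fs_module_add:
  assumes "X \<in> carrier (fs_module sc f)" "Y \<in> carrier (fs_module sc f)"
  shows "X \<oplus>\<^bsub>fs_module sc f\<^esub> Y \<in> carrier (fs_module sc f)"
    "mod_germ f (X \<oplus>\<^bsub>fs_module sc f\<^esub> Y) = mod_germ f X + mod_germ f Y"
proof -
  let ?V = "localization sc f"
  obtain x y where x: "X = tensor_class ?V x" "x \<in> tensor_reps ?V"
    and y: "Y = tensor_class ?V y" "y \<in> tensor_reps ?V" using assms unfolding carrier_fs_module by blast
  have "X \<oplus>\<^bsub>fs_module sc f\<^esub> Y = (\<Union>x\<in>X. \<Union>y\<in>Y. tensor_class ?V (x + y))"
    unfolding fs_module_def ratfun_ext_def Let_def by simp
  also have "\<dots> = (\<Union>i\<in>X \<times> Y. tensor_class ?V (fst i + snd i))" by (rule UN_UN_eq_UN_Times)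
  also have "\<dots> = tensor_class ?V (x + y)"
    by (rule UN_tensor_class)
      (use x y in \<open>auto simp: tensor_class_eq germs.tensor_eval_add intro: reps_add\<close>)
  finally have eq: "X \<oplus>\<^bsub>fs_module sc f\<^esub> Y = tensor_class ?V (x + y)" .
  show "X \<oplus>\<^bsub>fs_module sc f\<^esub> Y \<in> carrier (fs_module sc f)"
    unfolding eq carrier_fs_module using reps_add[OF x(2) y(2)] by blast
  show "mod_germ f (X \<oplus>\<^bsub>fs_module sc f\<^esub> Y) = mod_germ f X + mod_germ f Y"
    unfolding eq mod_germ_tensor_class[OF reps_add[OF x(2) y(2)]] germs.tensor_eval_add
    unfolding x(1) y(1) mod_germ_tensor_class[OF x(2)] mod_germ_tensor_class[OF y(2)] ..
qed

lemma tensor_germ_fs_action: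
  assumes \<delta>: "\<delta> \<in> diff_ops sc" and u: "u \<in> carrier (localization sc f)"
  shows "fs_action sc f \<delta> (u, p) \<in> tensor_reps (localization sc f)"
    and "tensor_germ f (fs_action sc f \<delta> (u, p)) = germ_scale sc p (germ_map \<delta> (loc_germ f u))"
proof -
  let ?V = "localization sc f"
  let ?u = "\<lambda>i. loc_frac f (1, i) \<otimes>\<^bsub>?V\<^esub> loc_op sc f (ad_pow f i \<delta>) u"
  have u': "?u i \<in> carrier ?V" for i
  proof -
    obtain a m where u: "u = loc_frac f (a, m)" using u unfolding carrier_localization by auto
    obtain b n where "ext_frac f (diff_order sc (ad_pow f i \<delta>)) (ad_pow f i \<delta>) (a, m) = (b, n)" by fastforce
    then show ?thesis
      unfolding u loc_op_loc_frac[OF ad_pow_diff_ops[OF \<delta>]] carrier_localization by (simp add: loc_mult)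
  qed
  have fs: "fs_action sc f \<delta> (u, p) = (\<Sum>i\<le>diff_order sc \<delta>. frag_of (?u i, binom_s i * p))"
    unfolding fs_action_def by simp
  have "(\<Sum>i\<in>I. frag_of (?u i, binom_s i * p)) \<in> tensor_reps ?V" for I
  proof (induction I rule: infinite_finite_induct)
    case (insert i I)
    have "frag_of (?u i, binom_s i * p) \<in> tensor_reps ?V" using u'[of i] unfolding tensor_reps_def by simp
    then show ?case using insert reps_add by simp
  qed (auto simp: reps_0)
  then show "fs_action sc f \<delta> (u, p) \<in> tensor_reps ?V" unfolding fs .
  have "tensor_germ f (fs_action sc f \<delta> (u, p))
     = germ_scale sc p (\<Sum>i\<le>diff_order sc \<delta>. germ_scale sc (binom_s i) (loc_germ f (?u i)))"
    unfolding fs germs.tensor_eval_sum germs.tensor_eval_of by (simp add: germs.scale_sum_right mult.commute)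
  then show "tensor_germ f (fs_action sc f \<delta> (u, p)) = germ_scale sc p (germ_map \<delta> (loc_germ f u))"
    unfolding twisted_action_germ[OF \<delta> u] .
qed

text \<open>The operations of the module are unions over all representatives. They are well defined because
both the germ of the result and the operation on germs are independent of the representatives.\<close>

lemma fs_module_smult:
  assumes P: "P \<in> carrier (diff_op_algebra_s sc)" and X: "X \<in> carrier (fs_module sc f)" and t: "t \<in> P"
  shows "P \<odot>\<^bsub>fs_module sc f\<^esub> X \<in> carrier (fs_module sc f)"
    "mod_germ f (P \<odot>\<^bsub>fs_module sc f\<^esub> X) = germs.tensor_eval (\<lambda>\<delta>. germ_map \<delta> (mod_germ f X)) t"
proof -
  let ?V = "localization sc f" and ?D = "diff_op_algebra sc"
  define act where "act t x = frag_extend (\<lambda>(\<delta>, q). frag_extend (\<lambda>(u, p). fs_action sc f \<delta> (u, q * p)) x) t" for t x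
  have D: "carrier ?D = diff_ops sc" unfolding diff_op_algebra_def by simp
  obtain x where x: "X = tensor_class ?V x" "x \<in> tensor_reps ?V" using X unfolding carrier_fs_module by blast
  obtain t0 where t0: "P = tensor_rel ?D `` {t0}"
    using P unfolding diff_op_algebra_s_def ratfun_ext_def quotient_def by auto
  have reps_sum: "frag_extend h y \<in> tensor_reps ?V"
    if "\<And>k. k \<in> Poly_Mapping.keys y \<Longrightarrow> h k \<in> tensor_reps ?V" for h and y :: "'u \<Rightarrow>\<^sub>0 int"
    using that keys_frag_extend[of h y] unfolding tensor_reps_def by blast
  have actx: "act t x \<in> tensor_reps ?V"
    "tensor_germ f (act t x) = germs.tensor_eval (\<lambda>\<delta>. germ_map \<delta> (tensor_germ f x)) t"
    if t: "t \<in> tensor_reps ?D" and x: "x \<in> tensor_reps ?V" for t x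
  proof -
    have kt: "\<delta> \<in> diff_ops sc" if "(\<delta>, q) \<in> Poly_Mapping.keys t" for \<delta> q
      using t that D unfolding tensor_reps_def by auto
    have kx: "u \<in> carrier ?V" if "(u, p) \<in> Poly_Mapping.keys x" for u p
      using x that unfolding tensor_reps_def by auto
    show "act t x \<in> tensor_reps ?V"
      unfolding act_def using kt kx tensor_germ_fs_action(1)
      by (auto intro!: reps_sum split: prod.split)
    show "tensor_germ f (act t x) = germs.tensor_eval (\<lambda>\<delta>. germ_map \<delta> (tensor_germ f x)) t"
      unfolding act_def
    proof (rule germs.tensor_eval_frag_extend, simp only: prod.case)
      fix \<delta> q assume "(\<delta>, q) \<in> Poly_Mapping.keys t"
      then have \<delta>: "\<delta> \<in> diff_ops sc" by (rule kt)
      note lin = diff_ops_linear[OF \<delta>]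
      have "tensor_germ f (frag_extend (\<lambda>(u, p). fs_action sc f \<delta> (u, q * p)) x)
        = germs.tensor_eval (\<lambda>u. germ_scale sc q (germ_map \<delta> (loc_germ f u))) x"
      proof (rule germs.tensor_eval_frag_extend, simp only: prod.case)
        fix u p assume "(u, p) \<in> Poly_Mapping.keys x"
        then show "tensor_germ f (fs_action sc f \<delta> (u, q * p)) = germ_scale sc p (germ_scale sc q (germ_map \<delta> (loc_germ f u)))"
          using tensor_germ_fs_action(2)[OF \<delta> kx] by (simp add: mult.commute)
      qed
      also have "\<dots> = germ_scale sc q (germ_map \<delta> (tensor_germ f x))"
        unfolding germs.tensor_eval_def germ_map_sum[OF lin] germ_map_germ_scale[OF lin] germs.scale_sum_right
        by (simp add: mult.commute)
      finally show "tensor_germ f (frag_extend (\<lambda>(u, p). fs_action sc f \<delta> (u, q * p)) x)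
          = germ_scale sc q (germ_map \<delta> (tensor_germ f x))" .
    qed
  qed
  have P_reps: "t' \<in> tensor_reps ?D" if "t' \<in> P" for t'
    using that unfolding t0 tensor_rel_def by blast
  have P_eval: "germs.tensor_eval (\<lambda>\<delta>. germ_map \<delta> v) t' = germs.tensor_eval (\<lambda>\<delta>. germ_map \<delta> v) t0"
    if "t' \<in> P" for t' v
  proof -
    have "t0 - t' \<in> frag.span (tensor_gens ?D)" using that unfolding t0 tensor_rel_def by blast
    then have "germs.tensor_eval (\<lambda>\<delta>. germ_map \<delta> v) (t0 - t') = 0"
      by (intro tensor_eval_span)
        (auto simp: germs.vector_space_axioms diff_op_algebra_def germ_map_add germ_map_op_scale)
    then show ?thesis by (simp add: germs.tensor_eval_diff)
  qed
  have "P \<odot>\<^bsub>fs_module sc f\<^esub> X = (\<Union>t\<in>P. \<Union>x\<in>X. tensor_class ?V (act t x))"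
    unfolding fs_module_def Let_def act_def by simp
  also have "\<dots> = (\<Union>i\<in>P \<times> X. tensor_class ?V (act (fst i) (snd i)))" by (rule UN_UN_eq_UN_Times)
  also have "\<dots> = tensor_class ?V (act t x)"
  proof (rule UN_tensor_class)
    have "x \<in> X" unfolding x(1) tensor_class_eq[OF x(2)] using x(2) by simp
    then show "P \<times> X \<noteq> {}" using t by blast
    show "act t x \<in> tensor_reps ?V" using actx P_reps t x(2) by blast
    fix i assume "i \<in> P \<times> X"
    then have i: "fst i \<in> P" "snd i \<in> tensor_reps ?V" "tensor_germ f (snd i) = tensor_germ f x"
      unfolding x(1) tensor_class_eq[OF x(2)] by auto
    show "act (fst i) (snd i) \<in> tensor_reps ?V" using actx(1)[OF P_reps[OF i(1)] i(2)] .
    show "tensor_germ f (act (fst i) (snd i)) = tensor_germ f (act t x)"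
      unfolding actx(2)[OF P_reps[OF i(1)] i(2)] actx(2)[OF P_reps[OF t] x(2)] i(3) P_eval[OF i(1)] P_eval[OF t] ..
  qed
  finally have eq: "P \<odot>\<^bsub>fs_module sc f\<^esub> X = tensor_class ?V (act t x)" .
  note actt = actx[OF P_reps[OF t] x(2)]
  show "P \<odot>\<^bsub>fs_module sc f\<^esub> X \<in> carrier (fs_module sc f)"
    unfolding eq carrier_fs_module using actt(1) by blast
  show "mod_germ f (P \<odot>\<^bsub>fs_module sc f\<^esub> X) = germs.tensor_eval (\<lambda>\<delta>. germ_map \<delta> (mod_germ f X)) t"
    unfolding eq mod_germ_tensor_class[OF actt(1)] actt(2)
    unfolding x(1) mod_germ_tensor_class[OF x(2)] ..
qed

lemma diff_op_algebra_s_nonempty: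
  assumes "P \<in> carrier (diff_op_algebra_s sc)"
  obtains t where "t \<in> P" "t \<in> tensor_reps (diff_op_algebra sc)"
proof -
  obtain t0 where t0: "t0 \<in> tensor_reps (diff_op_algebra sc)" "P = tensor_rel (diff_op_algebra sc) `` {t0}"
    using assms unfolding diff_op_algebra_s_def ratfun_ext_def quotient_def by auto
  then have "t0 \<in> P" unfolding tensor_rel_def by (simp add: frag.span_zero)
  then show thesis using that t0(1) by blast
qed

lemma id_diff_ops: "id \<in> diff_ops sc"
proof -
  have "id \<in> diff_ops_le sc 0" by (auto simp: fun_eq_iff intro: exI[of _ 1])
  then show ?thesis unfolding diff_ops_def by blast
qed

text \<open>The scalars \<open>id \<otimes> q\<close> and \<open>\<delta> \<otimes> 1\<close> give stability under \<open>k(s)\<close> and under \<open>D\<close>.\<close>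

lemma submodule_image:
  assumes N: "submodule N (diff_op_algebra_s sc) (fs_module sc f)"
  shows "germs.subspace (mod_germ f ` N)"
    and "\<delta> \<in> diff_ops sc \<Longrightarrow> v \<in> mod_germ f ` N \<Longrightarrow> germ_map \<delta> v \<in> mod_germ f ` N"
proof -
  interpret N: submodule N "diff_op_algebra_s sc" "fs_module sc f" by fact
  have sub: "N \<subseteq> carrier (fs_module sc f)" using N.subset by simp
  have op: "germ_scale sc q (germ_map \<delta> (mod_germ f X)) \<in> mod_germ f ` N"
    if "X \<in> N" "\<delta> \<in> diff_ops sc" for X \<delta> q
  proof -
    let ?t = "frag_of (\<delta>, q)" and ?D = "diff_op_algebra sc"
    have t: "?t \<in> tensor_reps ?D" using that(2) unfolding tensor_reps_def diff_op_algebra_def by simp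
    define P where "P = tensor_rel ?D `` {?t}"
    have P: "P \<in> carrier (diff_op_algebra_s sc)"
      unfolding P_def diff_op_algebra_s_def ratfun_ext_def quotient_def using t by auto
    have tP: "?t \<in> P" unfolding P_def tensor_rel_def using t by (simp add: frag.span_zero)
    have "mod_germ f (P \<odot>\<^bsub>fs_module sc f\<^esub> X) = germ_scale sc q (germ_map \<delta> (mod_germ f X))"
      using fs_module_smult(2)[OF P _ tP] sub that(1) by (auto simp: germs.tensor_eval_of)
    moreover have "P \<odot>\<^bsub>fs_module sc f\<^esub> X \<in> N" using N.smult_closed[OF P that(1)] .
    ultimately show ?thesis by (metis imageI)
  qed
  show "germs.subspace (mod_germ f ` N)"
  proof (rule germs.subspaceI)
    have "\<zero>\<^bsub>fs_module sc f\<^esub> \<in> N" using N.one_closed by simp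
    then show "0 \<in> mod_germ f ` N" using fs_module_zero(2) by (metis imageI)
    show "v + w \<in> mod_germ f ` N" if "v \<in> mod_germ f ` N" "w \<in> mod_germ f ` N" for v w
    proof -
      obtain X Y where XY: "X \<in> N" "Y \<in> N" "v = mod_germ f X" "w = mod_germ f Y" using \<open>v \<in> _\<close> \<open>w \<in> _\<close> by blast
      have "X \<oplus>\<^bsub>fs_module sc f\<^esub> Y \<in> N" using N.m_closed[OF XY(1,2)] by simp
      moreover have "v + w = mod_germ f (X \<oplus>\<^bsub>fs_module sc f\<^esub> Y)"
        unfolding XY(3,4) by (rule fs_module_add(2)[symmetric]) (use XY(1,2) sub in blast)+
      ultimately show ?thesis by blast
    qed
    show "germ_scale sc c v \<in> mod_germ f ` N" if "v \<in> mod_germ f ` N" for c v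
    proof -
      obtain X where X: "X \<in> N" "v = mod_germ f X" using \<open>v \<in> _\<close> by blast
      show ?thesis using op[OF X(1) id_diff_ops, of c] unfolding germ_map_id X(2) .
    qed
  qed
  show "germ_map \<delta> v \<in> mod_germ f ` N" if "\<delta> \<in> diff_ops sc" "v \<in> mod_germ f ` N"
  proof -
    obtain X where X: "X \<in> N" "v = mod_germ f X" using \<open>v \<in> _\<close> by blast
    show ?thesis using op[OF X(1) \<open>\<delta> \<in> _\<close>, of 1] unfolding X(2) by simp
  qed
qed

lemma submodule_if_closed:
  assumes N: "N \<subseteq> carrier (fs_module sc f)" "\<zero>\<^bsub>fs_module sc f\<^esub> \<in> N"
    and add: "\<And>X Y. X \<in> N \<Longrightarrow> Y \<in> N \<Longrightarrow> X \<oplus>\<^bsub>fs_module sc f\<^esub> Y \<in> N"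
    and neg: "\<And>X Y. X \<in> N \<Longrightarrow> Y \<in> carrier (fs_module sc f) \<Longrightarrow> mod_germ f Y = - mod_germ f X \<Longrightarrow> Y \<in> N"
    and smult: "\<And>P X. P \<in> carrier (diff_op_algebra_s sc) \<Longrightarrow> X \<in> N \<Longrightarrow> P \<odot>\<^bsub>fs_module sc f\<^esub> X \<in> N"
  shows "submodule N (diff_op_algebra_s sc) (fs_module sc f)"
proof
  let ?M = "fs_module sc f" and ?V = "localization sc f"
  show "N \<subseteq> carrier (add_monoid ?M)" using N by simp
  show "x \<otimes>\<^bsub>add_monoid ?M\<^esub> y \<in> N" if "x \<in> N" "y \<in> N" for x y using add that by simp
  show "\<one>\<^bsub>add_monoid ?M\<^esub> \<in> N" using N by simp
  show "inv\<^bsub>add_monoid ?M\<^esub> X \<in> N" if X: "X \<in> N" for X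
  proof -
    have Xc: "X \<in> carrier ?M" using X N by blast
    obtain x where x: "X = tensor_class ?V x" "x \<in> tensor_reps ?V" using Xc unfolding carrier_fs_module by blast
    define Y where "Y = tensor_class ?V (- x)"
    have Y: "Y \<in> carrier ?M" unfolding Y_def carrier_fs_module using reps_uminus[OF x(2)] by blast
    have mY: "mod_germ f Y = - mod_germ f X"
      unfolding Y_def x(1) mod_germ_tensor_class[OF x(2)] mod_germ_tensor_class[OF reps_uminus[OF x(2)]]
      by (rule germs.tensor_eval_uminus)
    have inv_iff: "Z \<oplus>\<^bsub>?M\<^esub> X = \<zero>\<^bsub>?M\<^esub> \<and> X \<oplus>\<^bsub>?M\<^esub> Z = \<zero>\<^bsub>?M\<^esub> \<longleftrightarrow> Z = Y" if Z: "Z \<in> carrier ?M" for Z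
    proof -
      have zero_iff: "W = \<zero>\<^bsub>?M\<^esub> \<longleftrightarrow> mod_germ f W = 0" if "W \<in> carrier ?M" for W
        using mod_germ_inject[OF that fs_module_zero(1)] fs_module_zero(2) by metis
      have "mod_germ f Z + mod_germ f X = 0 \<longleftrightarrow> mod_germ f Z = mod_germ f Y"
        unfolding mY by (simp add: eq_neg_iff_add_eq_0)
      then show ?thesis
        using zero_iff[OF fs_module_add(1)[OF Z Xc]] zero_iff[OF fs_module_add(1)[OF Xc Z]]
          fs_module_add(2)[OF Z Xc] fs_module_add(2)[OF Xc Z] mod_germ_inject[OF Z Y]
        by (metis add.commute)
    qed
    have "inv\<^bsub>add_monoid ?M\<^esub> X = (THE Z. Z \<in> carrier ?M \<and> X \<oplus>\<^bsub>?M\<^esub> Z = \<zero>\<^bsub>?M\<^esub> \<and> Z \<oplus>\<^bsub>?M\<^esub> X = \<zero>\<^bsub>?M\<^esub>)"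
      unfolding m_inv_def by simp
    also have "\<dots> = Y" by (rule the_equality) (use inv_iff Y in blast)+
    finally show ?thesis using neg[OF X Y mY] by simp
  qed
  show "P \<odot>\<^bsub>?M\<^esub> X \<in> N" if "P \<in> carrier (diff_op_algebra_s sc)" "X \<in> N" for P X using smult that .
qed

lemma submodule_carrier: "submodule (carrier (fs_module sc f)) (diff_op_algebra_s sc) (fs_module sc f)"
proof (rule submodule_if_closed)
  fix P X assume "P \<in> carrier (diff_op_algebra_s sc)" "X \<in> carrier (fs_module sc f)"
  then show "P \<odot>\<^bsub>fs_module sc f\<^esub> X \<in> carrier (fs_module sc f)"
    by (metis diff_op_algebra_s_nonempty fs_module_smult(1))
qed (auto simp: fs_module_zero fs_module_add)

lemma submodule_zero: "submodule {\<zero>\<^bsub>fs_module sc f\<^esub>} (diff_op_algebra_s sc) (fs_module sc f)"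
proof (rule submodule_if_closed)
  note zero = fs_module_zero[of f]
  have eq0: "X \<in> {\<zero>\<^bsub>fs_module sc f\<^esub>}" if "X \<in> carrier (fs_module sc f)" "mod_germ f X = 0" for X
    using mod_germ_inject[OF that(1) zero(1)] that(2) zero(2) by simp
  show "X \<oplus>\<^bsub>fs_module sc f\<^esub> Y \<in> {\<zero>\<^bsub>fs_module sc f\<^esub>}"
    if "X \<in> {\<zero>\<^bsub>fs_module sc f\<^esub>}" "Y \<in> {\<zero>\<^bsub>fs_module sc f\<^esub>}" for X Y
    using that zero by (intro eq0) (auto simp: fs_module_add)
  show "Y \<in> {\<zero>\<^bsub>fs_module sc f\<^esub>}" if "X \<in> {\<zero>\<^bsub>fs_module sc f\<^esub>}" "Y \<in> carrier (fs_module sc f)"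
      "mod_germ f Y = - mod_germ f X" for X Y
    using that zero by (intro eq0) auto
  show "P \<odot>\<^bsub>fs_module sc f\<^esub> X \<in> {\<zero>\<^bsub>fs_module sc f\<^esub>}"
    if P: "P \<in> carrier (diff_op_algebra_s sc)" and X: "X \<in> {\<zero>\<^bsub>fs_module sc f\<^esub>}" for P X
  proof -
    obtain t where t: "t \<in> P" "t \<in> tensor_reps (diff_op_algebra sc)"
      using diff_op_algebra_s_nonempty[OF P] by blast
    have Xc: "X \<in> carrier (fs_module sc f)" "mod_germ f X = 0" using X zero by auto
    have "germ_map (fst k) 0 = (0 :: 'r germ)" if "k \<in> Poly_Mapping.keys t" for k
      using t(2) that germ_map_0[OF diff_ops_linear] unfolding tensor_reps_def diff_op_algebra_def by force
    then have "germs.tensor_eval (\<lambda>\<delta>. germ_map \<delta> (mod_germ f X)) t = 0"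
      unfolding germs.tensor_eval_def Xc(2) by (intro sum.neutral) simp
    then show ?thesis using fs_module_smult[OF P Xc(1) t(1)] by (intro eq0) auto
  qed
qed (use fs_module_zero in auto)

end

section \<open>Growth of filtrations and finite length\<close>

text \<open>A chain of maximal length from \<open>0\<close> to \<open>M\<close> cannot be refined.\<close>

lemma finite_length_if_chains_bounded:
  assumes zero: "submodule {\<zero>\<^bsub>M\<^esub>} A M" and all: "submodule (carrier M) A M"
    and bound: "\<And>l N. (\<forall>i\<le>l. submodule (N i) A M) \<Longrightarrow> (\<forall>i<l. N i \<subset> N (Suc i)) \<Longrightarrow> l \<le> L"
  shows "finite_length A M"
proof -
  define chain where "chain l N \<longleftrightarrow> N 0 = {\<zero>\<^bsub>M\<^esub>} \<and> N l = carrier M \<and>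
    (\<forall>i\<le>l. submodule (N i) A M) \<and> (\<forall>i<l. N i \<subset> N (Suc i))" for l N
  have "\<exists>l N. chain l N"
  proof (cases "{\<zero>\<^bsub>M\<^esub>} = carrier M")
    case True
    then have "chain 0 (\<lambda>_. carrier M)" unfolding chain_def using all by simp
    then show ?thesis by blast
  next
    case False
    have "\<zero>\<^bsub>M\<^esub> \<in> carrier M"
      using submodule.axioms(1)[OF zero] subgroup.subset by fastforce
    then have "chain 1 (\<lambda>i. if i = 0 then {\<zero>\<^bsub>M\<^esub>} else carrier M)"
      unfolding chain_def using all zero False by auto
    then show ?thesis by blast
  qed
  then obtain l0 where "\<exists>N. chain l0 N" by blast
  moreover have "\<forall>l. (\<exists>N. chain l N) \<longrightarrow> l \<le> L" using bound unfolding chain_def by blast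
  ultimately obtain l where l: "\<exists>N. chain l N" "\<And>l'. \<exists>N. chain l' N \<Longrightarrow> l' \<le> l"
    using GreatestI_nat[of "\<lambda>l. \<exists>N. chain l N" l0 L] Greatest_le_nat[of "\<lambda>l. \<exists>N. chain l N" _ L] by blast
  then obtain N where N: "chain l N" by blast
  have simple: "\<not> (\<exists>K. submodule K A M \<and> N i \<subset> K \<and> K \<subset> N (Suc i))" if i: "i < l" for i
  proof
    assume "\<exists>K. submodule K A M \<and> N i \<subset> K \<and> K \<subset> N (Suc i)"
    then obtain K where K: "submodule K A M" "N i \<subset> K" "K \<subset> N (Suc i)" by blast
    define N' where "N' j = (if j \<le> i then N j else if j = Suc i then K else N (j - 1))" for j
    have "submodule (N' j) A M" if "j \<le> Suc l" for j
      using N K that i unfolding chain_def N'_def by auto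
    moreover have "N' j \<subset> N' (Suc j)" if j: "j < Suc l" for j
    proof -
      consider "j < i" | "j = i" | "j = Suc i" | "j > Suc i" by linarith
      then show ?thesis
      proof cases
        case 4
        then have "j - 1 < l" "Suc (j - 1) = j" using j by auto
        then have "N (j - 1) \<subset> N j" using N unfolding chain_def by metis
        then show ?thesis using 4 unfolding N'_def by simp
      qed (use N K i in \<open>auto simp: chain_def N'_def\<close>)
    qed
    moreover have "N' 0 = {\<zero>\<^bsub>M\<^esub>}" "N' (Suc l) = carrier M"
    proof -
      have "N 0 = {\<zero>\<^bsub>M\<^esub>}" "N l = carrier M" using N unfolding chain_def by blast+
      then show "N' 0 = {\<zero>\<^bsub>M\<^esub>}" "N' (Suc l) = carrier M" using i unfolding N'_def by simp_all
    qed
    ultimately have "chain (Suc l) N'" unfolding chain_def by blast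
    then have "Suc l \<le> l" using l(2) by blast
    then show False by simp
  qed
  show ?thesis
    unfolding finite_length_def
    by (rule exI[of _ l], rule exI[of _ N]) (use N simple in \<open>simp add: chain_def\<close>)
qed

lemma vector_space_op_scale:
  assumes "vector_space sc"
  shows "vector_space (op_scale sc)"
proof -
  interpret vector_space sc by fact
  show ?thesis
    by unfold_locales (simp_all add: op_scale_def fun_eq_iff scale_right_distrib scale_left_distrib)
qed

lemma growth_lower:
  assumes pos: "0 < filtration_mult scA F" and d: "filtration_Dim scA F = ereal d"
  shows "\<exists>c>0. \<exists>\<^sub>F i in sequentially. c * real i powr d \<le> real (vector_space.dim scA (F i))"
proof -
  let ?x = "\<lambda>i. ereal (real (vector_space.dim scA (F i)) / real i powr d)"
  have "0 < limsup ?x" using pos unfolding filtration_mult_def d by simp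
  then obtain c where c: "0 < ereal c" "ereal c < limsup ?x" using ereal_dense2 by blast
  have "\<exists>\<^sub>F i in sequentially. ereal c < ?x i"
  proof (rule ccontr)
    assume "\<not> ?thesis"
    then have "\<forall>\<^sub>F i in sequentially. ?x i \<le> ereal c" unfolding not_frequently by (simp add: not_less)
    then have "limsup ?x \<le> ereal c" by (rule Limsup_bounded)
    then show False using c(2) by simp
  qed
  then have "\<exists>\<^sub>F i in sequentially. c * real i powr d \<le> real (vector_space.dim scA (F i))"
  proof (rule frequently_elim1)
    fix i assume i: "ereal c < ?x i"
    show "c * real i powr d \<le> real (vector_space.dim scA (F i))"
    proof (cases "real i powr d = 0")
      case False
      then have "real i powr d > 0" by simp
      then show ?thesis using i by (simp add: field_simps)
    qed simp
  qed
  then show ?thesis using c(1) by auto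
qed

lemma growth_upper:
  assumes fin: "filtration_mult scM G < \<infinity>" and d: "filtration_Dim scM G = ereal t"
  shows "\<exists>K. \<forall>\<^sub>F i in sequentially. real (vector_space.dim scM (G i)) \<le> K * real i powr t"
proof -
  let ?x = "\<lambda>i. ereal (real (vector_space.dim scM (G i)) / real i powr t)"
  have "limsup ?x < \<infinity>" using fin unfolding filtration_mult_def d by simp
  then obtain K where K: "limsup ?x < ereal K" using ereal_dense2 by blast
  have "\<forall>\<^sub>F i in sequentially. ?x i < ereal K" by (rule Limsup_lessD[OF K])
  then have "\<forall>\<^sub>F i in sequentially. real (vector_space.dim scM (G i)) \<le> K * real i powr t"
    using eventually_gt_at_top[of 0] by eventually_elim (simp add: field_simps)
  then show ?thesis by blast
qed

context comm_algebra_char_0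
begin

lemma frac_germ_span:
  "(\<lambda>g. frac_germ f (g, m)) ` span X \<subseteq> germs.span ((\<lambda>g. frac_germ f (g, m)) ` X)"
proof clarify
  fix g assume "g \<in> span X"
  then show "frac_germ f (g, m) \<in> germs.span ((\<lambda>g. frac_germ f (g, m)) ` X)"
  proof (induction g rule: span_induct_alt)
    case base
    then show ?case by (simp add: frac_germ_0 germs.span_zero)
  next
    case (step c x y)
    then show ?case unfolding frac_germ_same_denominator_add frac_germ_scale
      by (intro germs.span_add[OF germs.span_scale[OF germs.span_base]]) auto
  qed
qed

text \<open>For fixed \<open>m\<close> the map \<open>g \<mapsto> (g / f ^ m) f\<^sup>s\<close> is \<open>k\<close>-linear, so the span over \<open>k(s)\<close> of an
image has no larger dimension.\<close>

lemma frac_germ_span_dim: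
  assumes "finite_dim_subspace sc U"
  shows "finite_dim_subspace (germ_scale sc) (germs.span ((\<lambda>g. frac_germ f (g, m)) ` U))"
    and "germs.dim (germs.span ((\<lambda>g. frac_germ f (g, m)) ` U)) \<le> dim U"
proof -
  obtain B where B: "finite B" "span B = U" "card B = dim U" using finite_dim_subspace_basis[OF assms] by metis
  let ?h = "\<lambda>g. frac_germ f (g, m)"
  have "germs.span (?h ` U) \<subseteq> germs.span (?h ` B)"
    using frac_germ_span[of f m B] unfolding B(2) by (intro germs.span_minimal) auto
  moreover have "germs.span (?h ` B) \<subseteq> germs.span (?h ` U)"
    using B(2) span_superset by (intro germs.span_mono image_mono) blast
  ultimately have eq: "germs.span (?h ` B) = germs.span (?h ` U)" by blast
  then show "finite_dim_subspace (germ_scale sc) (germs.span (?h ` U))"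
    unfolding finite_dim_subspace_def using B(1) by (intro exI[of _ "?h ` B"]) auto
  have "germs.dim (germs.span (?h ` U)) \<le> card (?h ` B)"
    using B(1) eq germs.span_superset by (intro germs.dim_le_card) auto
  also have "\<dots> \<le> dim U" using card_image_le[OF B(1), of ?h] B(3) by simp
  finally show "germs.dim (germs.span (?h ` U)) \<le> dim U" .
qed

text \<open>The filtration \<open>H i\<close> of the module, spanned over \<open>k(s)\<close> by \<open>(g / f ^ (c * i)) f\<^sup>s\<close> for
\<open>g \<in> G (b * i)\<close>, makes the bound on chains applicable.\<close>

lemma fs_module_finite_length:
  assumes filt: "filtration (op_scale sc) (diff_ops sc) (\<circ>) id F"
    and dom: "linearly_dominated sc F"
    and lin: "linearly_simple (op_scale sc) (\<circ>) id F"
    and compat: "compatible_filtration F sc (\<lambda>\<delta> x. \<delta> x) G"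
    and lower: "c0 > 0" "\<exists>\<^sub>F i in sequentially. c0 * real i powr (2 * t) \<le> real (vector_space.dim (op_scale sc) (F i))"
    and upper: "\<forall>\<^sub>F i in sequentially. real (dim (G i)) \<le> K * real i powr t"
    and t: "t \<ge> 0"
  shows "finite_length (diff_op_algebra_s sc) (fs_module sc f)"
proof -
  interpret ops: vector_space "op_scale sc" by (rule vector_space_op_scale) unfold_locales
  have F_un: "(\<Union>i. F i) = diff_ops sc" and F_Suc: "\<And>i. F i \<subseteq> F (Suc i)"
    and F_mul: "\<And>i j a b. a \<in> F i \<Longrightarrow> b \<in> F j \<Longrightarrow> a \<circ> b \<in> F (i + j)" and F_0: "F 0 = {op_scale sc c id | c. True}"
    and F_fin: "\<And>i. finite_dim_subspace (op_scale sc) (F i)"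
    using filt unfolding filtration_def by blast+
  have G_fin: "\<And>i. finite_dim_subspace sc (G i)" and G_Suc: "\<And>i. G i \<subseteq> G (Suc i)" and G_un: "(\<Union>i. G i) = UNIV"
    and G_act: "\<And>i j a x. a \<in> F i \<Longrightarrow> x \<in> G j \<Longrightarrow> a x \<in> G (i + j)"
    using compat unfolding compatible_filtration_def by blast+
  have F_mono: "F i \<subseteq> F j" if "i \<le> j" for i j using F_Suc that by (metis lift_Suc_mono_le)
  have G_mono: "G i \<subseteq> G j" if "i \<le> j" for i j using G_Suc that by (metis lift_Suc_mono_le)
  have F_sub: "ops.subspace (F i)" for i
    using F_fin[of i] unfolding finite_dim_subspace_def by (metis ops.subspace_span)
  obtain c where c: "c > 0" "\<And>i. F i \<subseteq> diff_ops_le sc (c * i)"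
    using dom unfolding linearly_dominated_def by blast
  have "(\<lambda>x. f * x) \<in> diff_ops_le sc 0" by auto
  then have "(\<lambda>x. f * x) \<in> (\<Union>i. F i)" unfolding F_un diff_ops_def by blast
  then obtain e where e: "(\<lambda>x. f * x) \<in> F e" by blast
  have id0: "id \<in> F 0"
  proof -
    have "op_scale sc 1 id = id" by (simp add: op_scale_def fun_eq_iff)
    then show ?thesis unfolding F_0 by (metis (mono_tags, lifting) mem_Collect_eq)
  qed
  have pow: "(\<lambda>x. f ^ j * x) \<in> F (e * j)" for j
  proof (induction j)
    case 0
    then show ?case using id0 by (simp add: id_def)
  next
    case (Suc j)
    have "(\<lambda>x. f * x) \<circ> (\<lambda>x. f ^ j * x) \<in> F (e + e * j)" by (rule F_mul[OF e Suc])
    then show ?case by (simp add: comp_def mult.assoc)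
  qed
  have ad: "ad_pow f l \<delta> \<in> F (j + e * l)" if "\<delta> \<in> F j" for \<delta> j l
  proof (induction l)
    case (Suc l)
    let ?a = "ad_pow f l \<delta>"
    have "?a \<circ> (\<lambda>x. f * x) \<in> F (j + e * Suc l)" using F_mul[OF Suc e] by (simp add: ac_simps)
    moreover have "(\<lambda>x. f * x) \<circ> ?a \<in> F (j + e * Suc l)" using F_mul[OF e Suc] by (simp add: ac_simps)
    ultimately have "(?a \<circ> (\<lambda>x. f * x)) - ((\<lambda>x. f * x) \<circ> ?a) \<in> F (j + e * Suc l)"
      by (rule ops.subspace_diff[OF F_sub])
    also have "(?a \<circ> (\<lambda>x. f * x)) - ((\<lambda>x. f * x) \<circ> ?a) = commutator ?a f"
      by (simp add: commutator_def fun_eq_iff)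
    finally show ?case by simp
  qed (use that in simp)
  \<comment> \<open>an operator in \<open>F j\<close> raises the index of \<open>G\<close> by \<open>j\<close>, and the expansion to the denominator
    \<open>f ^ (c * (j + i))\<close> multiplies by at most \<open>f ^ (c * j)\<close>, which lies in \<open>F (e * c * j)\<close>\<close>
  define b where "b = 1 + e * c"
  define H where "H i = germs.span ((\<lambda>g. frac_germ f (g, c * i)) ` G (b * i))" for i
  have H_base: "frac_germ f (g, c * i) \<in> H i" if "g \<in> G (b * i)" for g i
    unfolding H_def using that by (intro germs.span_base) blast
  have H_Suc: "H i \<subseteq> H (Suc i)" for i
  proof -
    have "frac_germ f (g, c * i) \<in> H (Suc i)" if g: "g \<in> G (b * i)" for g
    proof -
      have "f ^ c * g \<in> G (e * c + b * i)" using G_act[OF pow g] .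
      moreover have "e * c + b * i \<le> b * Suc i" unfolding b_def by simp
      ultimately have "f ^ c * g \<in> G (b * Suc i)" using G_mono by blast
      then have "frac_germ f (f ^ c * g, c * Suc i) \<in> H (Suc i)" by (rule H_base)
      then show ?thesis using frac_germ_cancel[of f c g "c * i"] by (simp add: add.commute)
    qed
    then show ?thesis unfolding H_def[of i] by (intro germs.span_minimal) (auto simp: H_def)
  qed
  have H_mono: "H i \<subseteq> H j" if "i \<le> j" for i j using H_Suc that by (metis lift_Suc_mono_le)
  have H_sub: "germs.subspace (H i)" for i unfolding H_def by (rule germs.subspace_span)
  have H_act: "germ_map \<delta> v \<in> H (j + i)" if \<delta>: "\<delta> \<in> F j" and v: "v \<in> H i" for \<delta> v i j
  proof -
    have \<delta>c: "\<delta> \<in> diff_ops_le sc (c * j)" using \<delta> c(2) by blast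
    note l\<delta> = diff_ops_le_linear[OF \<delta>c]
    have gen: "germ_map \<delta> (frac_germ f (g, c * i)) \<in> H (j + i)" if g: "g \<in> G (b * i)" for g
      unfolding germ_map_frac_germ[OF \<delta>c]
    proof (intro germs.subspace_sum[OF H_sub] germs.subspace_scale[OF H_sub])
      fix l assume "l \<in> {..c * j}"
      then have l: "l \<le> c * j" by simp
      have "f ^ (c * j - l) * ad_pow f l \<delta> g \<in> G (e * (c * j - l) + (j + e * l + b * i))"
        by (rule G_act[OF pow G_act[OF ad[OF \<delta>] g]])
      moreover have "e * (c * j - l) + (j + e * l + b * i) = b * (j + i)"
      proof -
        have "e * (c * j - l) + e * l = e * (c * j)" using l by (simp add: distrib_left[symmetric])
        then show ?thesis unfolding b_def by (simp add: algebra_simps)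
      qed
      ultimately have "f ^ (c * j - l) * ad_pow f l \<delta> g \<in> G (b * (j + i))" by simp
      then have "frac_germ f (f ^ (c * j - l) * ad_pow f l \<delta> g, c * (j + i)) \<in> H (j + i)" by (rule H_base)
      moreover have "c * (j + i) = (c * i + l) + (c * j - l)" using l by (simp add: algebra_simps)
      ultimately show "frac_germ f (ad_pow f l \<delta> g, c * i + l) \<in> H (j + i)"
        by (simp only: frac_germ_cancel)
    qed
    show ?thesis using v unfolding H_def[of i]
    proof (induction v rule: germs.span_induct_alt)
      case base
      show ?case using germ_map_0[OF l\<delta>] germs.subspace_0[OF H_sub] by simp
    next
      case (step p x y)
      then show ?case unfolding germ_map_right_add[OF l\<delta>] germ_map_germ_scale[OF l\<delta>]
        using gen by (intro germs.subspace_add[OF H_sub] germs.subspace_scale[OF H_sub]) auto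
    qed
  qed
  have F_linear: "Vector_Spaces.linear sc sc \<delta>" if "\<delta> \<in> F j" for \<delta> j
    using diff_ops_le_linear that c(2) by blast
  interpret act: filtered_action "op_scale sc" "germ_scale sc" "(\<circ>)" id F germ_map H
  proof
    show "filtration (op_scale sc) (\<Union>i. F i) (\<circ>) id F" using filt F_un by simp
    show "finite_dim_subspace (germ_scale sc) (H i)" for i
      unfolding H_def by (rule frac_germ_span_dim(1)[OF G_fin])
    show "germ_map a (v + w) = germ_map a v + germ_map a w" if "a \<in> F i" for a i v w
      by (rule germ_map_right_add[OF F_linear[OF that]])
    show "germ_map a (germ_scale sc p v) = germ_scale sc p (germ_map a v)" if "a \<in> F i" for a i p v
      by (rule germ_map_germ_scale[OF F_linear[OF that]])
  qed (simp_all only: H_Suc H_act germ_map_comp germ_map_id germ_map_add germ_map_op_scale)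
  have b: "b \<ge> 1" unfolding b_def by simp
  have H_upper: "\<forall>\<^sub>F i in sequentially. real (germs.dim (H i)) \<le> (K * real b powr t) * real i powr t"
  proof -
    obtain n0 where n0: "\<And>i. i \<ge> n0 \<Longrightarrow> real (dim (G i)) \<le> K * real i powr t"
      using upper unfolding eventually_sequentially by blast
    have "real (germs.dim (H i)) \<le> (K * real b powr t) * real i powr t" if "i \<ge> n0" for i
    proof -
      have "i \<le> b * i" using b by simp
      then have "b * i \<ge> n0" using that by linarith
      have "real (germs.dim (H i)) \<le> real (dim (G (b * i)))"
        unfolding H_def using frac_germ_span_dim(2)[OF G_fin] by simp
      also have "\<dots> \<le> K * real (b * i) powr t" by (rule n0) fact
      also have "\<dots> = (K * real b powr t) * real i powr t"
        unfolding of_nat_mult by (subst powr_mult) (simp_all only: of_nat_0_le_iff mult.assoc)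
      finally show ?thesis .
    qed
    then show ?thesis unfolding eventually_sequentially by blast
  qed
  obtain L where L: "\<forall>l N. (\<forall>i\<le>l. act.stable (N i)) \<and> (\<forall>i<l. N i \<subset> N (Suc i)) \<and> N l \<subseteq> (\<Union>i. H i) \<longrightarrow> l \<le> L"
    using act.chain_length_bounded[OF lin lower H_upper t] by (elim exE)
  have H_add: "v + w \<in> (\<Union>i. H i)" if vw: "v \<in> (\<Union>i. H i)" "w \<in> (\<Union>i. H i)" for v w
  proof -
    obtain i j where ij: "v \<in> H i" "w \<in> H j" using vw by blast
    then have "v \<in> H (i + j)" "w \<in> H (i + j)" using H_mono[of i "i + j"] H_mono[of j "i + j"] by auto
    then have "v + w \<in> H (i + j)" by (rule germs.subspace_add[OF H_sub])
    then show ?thesis by blast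
  qed
  have H_loc: "germ_scale sc p (loc_germ f u) \<in> (\<Union>i. H i)" if uc: "u \<in> carrier (localization sc f)" for u p
  proof -
    obtain a m where u: "u = loc_frac f (a, m)" using uc unfolding carrier_localization by auto
    obtain n0 where n0: "a \<in> G n0" using G_un by blast
    define n where "n = m + n0"
    have cn: "m \<le> c * n" unfolding n_def using c(1) by (metis One_nat_def Suc_leI le_add1 mult_le_mono nat_mult_1)
    have "f ^ (c * n - m) * a \<in> G (e * (c * n - m) + n0)" using G_act[OF pow n0] .
    moreover have "e * (c * n - m) + n0 \<le> b * n"
    proof -
      have "e * (c * n - m) \<le> e * c * n" by simp
      then show ?thesis unfolding b_def n_def by (simp add: algebra_simps)
    qed
    ultimately have "f ^ (c * n - m) * a \<in> G (b * n)" using G_mono by blast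
    then have "frac_germ f (f ^ (c * n - m) * a, c * n) \<in> H n" by (rule H_base)
    then have "loc_germ f u \<in> H n"
      using frac_germ_cancel[of f "c * n - m" a m] cn by (simp add: u loc_germ_loc_frac)
    then show ?thesis using germs.subspace_scale[OF H_sub] by blast
  qed
  have H_tensor: "tensor_germ f x \<in> (\<Union>i. H i)" if x: "x \<in> tensor_reps (localization sc f)" for x
  proof -
    have "(\<Sum>k\<in>S. germ_scale sc (of_int (Poly_Mapping.lookup x k) * snd k) (loc_germ f (fst k))) \<in> (\<Union>i. H i)"
      if "S \<subseteq> Poly_Mapping.keys x" for S
      using that
    proof (induction S rule: infinite_finite_induct)
      case (insert k S)
      then have "fst k \<in> carrier (localization sc f)" using x unfolding tensor_reps_def by auto
      then show ?case using insert H_add H_loc by simp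
    qed (use germs.subspace_0[OF H_sub] in auto)
    then show ?thesis unfolding germs.tensor_eval_def by blast
  qed
  show ?thesis
  proof (rule finite_length_if_chains_bounded[OF submodule_zero submodule_carrier])
    fix l N
    assume sub: "\<forall>i\<le>l. submodule (N i) (diff_op_algebra_s sc) (fs_module sc f)"
      and ch: "\<forall>i<l. N i \<subset> N (Suc i)"
    have Nc: "N i \<subseteq> carrier (fs_module sc f)" if "i \<le> l" for i
      using sub that submodule.axioms(1) subgroup.subset by fastforce
    show "l \<le> L"
    proof (rule L[rule_format, where N = "\<lambda>i. mod_germ f ` N i"], intro conjI)
      show "\<forall>i\<le>l. act.stable (mod_germ f ` N i)"
        unfolding act.stable_def using submodule_image sub F_un by blast
      show "\<forall>i<l. mod_germ f ` N i \<subset> mod_germ f ` N (Suc i)"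
      proof (intro allI impI psubsetI)
        fix i assume i: "i < l"
        then show "mod_germ f ` N i \<subseteq> mod_germ f ` N (Suc i)" using ch by blast
        obtain X where X: "X \<in> N (Suc i)" "X \<notin> N i" using ch i by blast
        have "mod_germ f X \<notin> mod_germ f ` N i"
        proof
          assume "mod_germ f X \<in> mod_germ f ` N i"
          then obtain Y where Y: "Y \<in> N i" "mod_germ f X = mod_germ f Y" by blast
          have "X = Y" using mod_germ_inject[OF _ _ Y(2)] X(1) Y(1) Nc[of i] Nc[of "Suc i"] i by auto
          then show False using X(2) Y(1) by simp
        qed
        then show "mod_germ f ` N i \<noteq> mod_germ f ` N (Suc i)" using X(1) by blast
      qed
      show "mod_germ f ` N l \<subseteq> (\<Union>i. H i)"
        using Nc[of l] H_tensor mod_germ_tensor_class unfolding carrier_fs_module by fastforce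
    qed
  qed
qed

end

theorem corollary4p12:
  fixes sc :: "'k::field_char_0 \<Rightarrow> 'r::comm_ring_1 \<Rightarrow> 'r"
    and F :: "nat \<Rightarrow> ('r \<Rightarrow> 'r) set"
    and f :: 'r
  assumes "comm_algebra sc"
    and "finitely_generated_algebra sc"
    and "filtration (op_scale sc) (diff_ops sc) (\<circ>) id F"
    and "linearly_dominated sc F"
    and "linearly_simple (op_scale sc) (\<circ>) id F"
    and "filtration_Dim (op_scale sc) F < \<infinity>"
    and "0 < filtration_mult (op_scale sc) F"
    and "filtration_mult (op_scale sc) F < \<infinity>"
    and "holonomic (op_scale sc) F sc (\<lambda>\<delta> x. \<delta> x)"
    and "f \<noteq> 0"
  shows "finite_length (diff_op_algebra_s sc) (fs_module sc f)"
proof -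
  interpret comm_algebra_char_0 sc using assms(1) by (rule comm_algebra_char_0.intro)
  have "0 \<le> filtration_Dim (op_scale sc) F"
    unfolding filtration_Dim_def by (rule Inf_greatest) auto
  then obtain d where d: "filtration_Dim (op_scale sc) F = ereal d" "d \<ge> 0"
    using assms(6) by (cases "filtration_Dim (op_scale sc) F") auto
  obtain G where G: "compatible_filtration F sc (\<lambda>\<delta> x. \<delta> x) G"
    "filtration_Dim sc G = filtration_Dim (op_scale sc) F / 2" "filtration_mult sc G < \<infinity>"
    using assms(9,10) unfolding holonomic_def by blast
  have dG: "filtration_Dim sc G = ereal (d / 2)" using G(2) d(1) by simp
  obtain c where c: "c > 0"
    "\<exists>\<^sub>F i in sequentially. c * real i powr d \<le> real (vector_space.dim (op_scale sc) (F i))"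
    using growth_lower[OF assms(7) d(1)] by blast
  obtain K where K: "\<forall>\<^sub>F i in sequentially. real (dim (G i)) \<le> K * real i powr (d / 2)"
    using growth_upper[OF G(3) dG] by blast
  show ?thesis
    by (rule fs_module_finite_length[OF assms(3,4,5) G(1) c(1) _ K]) (use c(2) d(2) in simp_all)
qed

end
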